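(* Assume complete randomization with a non-uniform design, Condition 1 (constant $\sigma_F$), Condition 2 (constants $c,c'$), $Q\ge2(c^2/c')H|\mathcal Q_{\mathrm L}|$, $N\le KQ$ for a constant $K$, and $S(q,q)>0$ for all $q$. Let $T=(\hat\gamma-\gamma)^\top V_{\hat\gamma}^{-1}(\hat\gamma-\gamma)$ and $T_0\sim\chi^2(H)$. Then there is a constant $C>0$ depending only on $c,c',\overline n,\underline c,\sigma_F,K$ such that $$\sup_{t\in\mathbb R}|\mathbb P(T\le t)-\mathbb P(T_0\le t)|\le C\frac{\max_{q\in[Q]}M_N(q)^3}{\{\min_{q\in\mathcal Q_{\mathrm S}}S(q,q)\}^{3/2}}\cdot\frac{H^{19/4}}{N^{1/2}}.$$
   Context: Randomization model: there are $N$ units and $Q$ treatment levels with prescribed group sizes $N_1,\dots,N_Q\ge1$, $\sum_{q=1}^QN_q=N$. Each unit $i\in[N]$ has fixed real potential outcomes $Y_i(1),\dots,Y_i(Q)$. Under complete randomization the treatment vector $Z=(Z_1,\dots,Z_N)$ is uniformly distributed over all vectors in $[Q]^N$ having exactly $N_q$ coordinates equal to $q$ for each $q$; the observed outcome is $Y_i=Y_i(Z_i)$. Write $\overline Y(q)=N^{-1}\sum_iY_i(q)$, $\overline Y=(\overline Y(q))_q$, $S(q,q')=(N-1)^{-1}\sum_i(Y_i(q)-\overline Y(q))(Y_i(q')-\overline Y(q'))$, $S=(S(q,q'))$, $\hat Y_q=N_q^{-1}\sum_{i:Z_i=q}Y_i$, $\hat Y=(\hat Y_q)_q$, $V_{\hat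 Y}=\mathrm{diag}(N_q^{-1}S(q,q))_{q\in[Q]}-N^{-1}S$. For a fixed $F=(f_{qh})\in\mathbb R^{Q\times H}$ let $\gamma=F^\top\overline Y$, $\hat\gamma=F^\top\hat Y$, $V_{\hat\gamma}=F^\top V_{\hat Y}F$ (assumed nonsingular), $M_N(q)=\max_i|Y_i(q)-\overline Y(q)|$, $\|F\|_\infty=\max_{q,h}|f_{qh}|$, $\varrho_{\min}$ the smallest eigenvalue. Non-uniform design: $[Q]=\mathcal Q_{\mathrm S}\cup\mathcal Q_{\mathrm L}$ (disjoint), where there are a positive integer $N_0$ and constants $0<\underline c\le\overline c$ with $N_q=c_qN_0$, $\underline c\le c_q\le\overline c$ for $q\in\mathcal Q_{\mathrm L}$, and a fixed integer $\overline n$ with $N_q\le\overline n$ for $q\in\mathcal Q_{\mathrm S}$. $\mathcal Q_{\mathrm S}$ is further split into $\mathcal Q_{\mathrm U}=\{q:N_q=1\}$ and $\mathcal Q_{\mathrm R}=\{q:2\le N_q\le\overline n\}$. For $\star\in\{\mathrm S,\mathrm U,\mathrm R,\mathrm L\}$, $N_\star=\sum_{q\in\mathcal Q_\star}N_q$. Condition 1: there exists $\sigma_F\ge1$ with $F^\top\mathrm{diag}(N_q^{-1}S(q,q))F\preceq\sigma_F^2F^\top V_{\hat Y}F$. Condition 2: there are constants $c,c'>0$ with $\|F\|_\infty\le cQ^{-1}$ and $\varrho_{\min}(F^\top F)\ge c'Q^{-1}$. *)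

theory Defs
  imports "HOL-Analysis.Analysis" "HOL-Library.FuncSet"
    "Jordan_Normal_Form.Matrix" "Jordan_Normal_Form.Char_Poly"
    "Jordan_Normal_Form.Gauss_Jordan_Elimination"
begin

text \<open>Units are indexed by i < N, treatment levels by q < Q, contrast columns by h < H.
  Potential outcomes: Y i q (= Y_i(q+1)); contrast matrix entries F q h.
  Group sizes: Nq q.\<close>

definition Ybar :: "nat \<Rightarrow> (nat \<Rightarrow> nat \<Rightarrow> real) \<Rightarrow> nat \<Rightarrow> real" where
  "Ybar N Y q = (\<Sum>i<N. Y i q) / real N"

definition Scov :: "nat \<Rightarrow> (nat \<Rightarrow> nat \<Rightarrow> real) \<Rightarrow> nat \<Rightarrow> nat \<Rightarrow> real" where
  "Scov N Y q q' = (\<Sum>i<N. (Y i q - Ybar N Y q) * (Y i q' - Ybar N Y q')) / (real N - 1)"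

definition MN :: "nat \<Rightarrow> (nat \<Rightarrow> nat \<Rightarrow> real) \<Rightarrow> nat \<Rightarrow> real" where
  "MN N Y q = Max {\<bar>Y i q - Ybar N Y q\<bar> | i. i < N}"

definition assignments :: "nat \<Rightarrow> nat \<Rightarrow> (nat \<Rightarrow> nat) \<Rightarrow> (nat \<Rightarrow> nat) set" where
  "assignments N Q Nq = {z \<in> {..<N} \<rightarrow>\<^sub>E {..<Q}. \<forall>q<Q. card {i. i < N \<and> z i = q} = Nq q}"

definition Yhat :: "nat \<Rightarrow> (nat \<Rightarrow> nat) \<Rightarrow> (nat \<Rightarrow> nat \<Rightarrow> real) \<Rightarrow> (nat \<Rightarrow> nat) \<Rightarrow> nat \<Rightarrow> real" where
  "Yhat N Nq Y z q = (\<Sum>i\<in>{i. i < N \<and> z i = q}. Y i q) / real (Nq q)"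

definition Fmat :: "nat \<Rightarrow> nat \<Rightarrow> (nat \<Rightarrow> nat \<Rightarrow> real) \<Rightarrow> real mat" where
  "Fmat Q H F = mat Q H (\<lambda>(q, h). F q h)"

definition VYhat :: "nat \<Rightarrow> nat \<Rightarrow> (nat \<Rightarrow> nat) \<Rightarrow> (nat \<Rightarrow> nat \<Rightarrow> real) \<Rightarrow> real mat" where
  "VYhat N Q Nq Y = mat Q Q (\<lambda>(q, q').
     (if q = q' then Scov N Y q q / real (Nq q) else 0) - Scov N Y q q' / real N)"

definition Dmat :: "nat \<Rightarrow> nat \<Rightarrow> (nat \<Rightarrow> nat) \<Rightarrow> (nat \<Rightarrow> nat \<Rightarrow> real) \<Rightarrow> real mat" where
  "Dmat N Q Nq Y = mat Q Q (\<lambda>(q, q'). if q = q' then Scov N Y q q / real (Nq q) else 0)"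

definition Vgamma :: "nat \<Rightarrow> nat \<Rightarrow> nat \<Rightarrow> (nat \<Rightarrow> nat) \<Rightarrow> (nat \<Rightarrow> nat \<Rightarrow> real) \<Rightarrow> (nat \<Rightarrow> nat \<Rightarrow> real) \<Rightarrow> real mat" where
  "Vgamma N Q H Nq Y F = transpose_mat (Fmat Q H F) * VYhat N Q Nq Y * Fmat Q H F"

definition gamma_vec :: "nat \<Rightarrow> nat \<Rightarrow> nat \<Rightarrow> (nat \<Rightarrow> nat \<Rightarrow> real) \<Rightarrow> (nat \<Rightarrow> nat \<Rightarrow> real) \<Rightarrow> real vec" where
  "gamma_vec N Q H Y F = vec H (\<lambda>h. \<Sum>q<Q. F q h * Ybar N Y q)"

definition gammahat_vec :: "nat \<Rightarrow> nat \<Rightarrow> nat \<Rightarrow> (nat \<Rightarrow> nat) \<Rightarrow> (nat \<Rightarrow> nat \<Rightarrow> real) \<Rightarrow> (nat \<Rightarrow> nat \<Rightarrow> real) \<Rightarrow> (nat \<Rightarrow> nat) \<Rightarrow> real vec" where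
  "gammahat_vec N Q H Nq Y F z = vec H (\<lambda>h. \<Sum>q<Q. F q h * Yhat N Nq Y z q)"

definition Tstat :: "nat \<Rightarrow> nat \<Rightarrow> nat \<Rightarrow> (nat \<Rightarrow> nat) \<Rightarrow> (nat \<Rightarrow> nat \<Rightarrow> real) \<Rightarrow> (nat \<Rightarrow> nat \<Rightarrow> real) \<Rightarrow> (nat \<Rightarrow> nat) \<Rightarrow> real" where
  "Tstat N Q H Nq Y F z =
     (let d = gammahat_vec N Q H Nq Y F z - gamma_vec N Q H Y F
      in scalar_prod d (the (mat_inverse (Vgamma N Q H Nq Y F)) *\<^sub>v d))"

definition prob_T_le :: "nat \<Rightarrow> nat \<Rightarrow> nat \<Rightarrow> (nat \<Rightarrow> nat) \<Rightarrow> (nat \<Rightarrow> nat \<Rightarrow> real) \<Rightarrow> (nat \<Rightarrow> nat \<Rightarrow> real) \<Rightarrow> real \<Rightarrow> real" where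
  "prob_T_le N Q H Nq Y F t =
     real (card {z \<in> assignments N Q Nq. Tstat N Q H Nq Y F z \<le> t}) / real (card (assignments N Q Nq))"

definition chi2_cdf :: "nat \<Rightarrow> real \<Rightarrow> real" where
  "chi2_cdf H t = (if t \<le> 0 then 0 else
     integral {0..t} (\<lambda>x. x powr (real H / 2 - 1) * exp (- x / 2)
                          / (2 powr (real H / 2) * Gamma (real H / 2))))"

definition rho_min :: "real mat \<Rightarrow> real" where
  "rho_min A = Min {k. eigenvalue A k}"

end

(* Write gammahat - gamma as a sum over the units and whiten it by a matrix B with B V B^T = I, so
   that T becomes the squared norm |W|^2 of a standardized combinatorial sum W with values in R^H
   whose summands have norm at most delta, where delta^2 is of order H M^2 / (Smin N).

   The chi-square law is compared with |W|^2 by Stein's method. For radial test functions the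
   multivariate normal Stein equation is the ordinary differential equation
   4 x p' + 2 (H - x) p = h - E h, whose solution p is bounded explicitly; the exchangeable pair
   swaps the treatments of two uniformly chosen units. The third-order error is governed by the
   probability that |W| lies in a shell of width eps, which is at most the chi-square probability
   of that shell plus twice the distance kappa to be bounded. The choice eps = const H N delta^3
   makes the resulting inequality for kappa contractive, and gives
   kappa <= const H^2 N delta^3, that is, const H^(7/2) (M^2 / Smin)^(3/2) / sqrt N. *)

theory Submission
  imports Defs "HOL-Real_Asymp.Real_Asymp" "HOL-Combinatorics.Permutations"
begin

section \<open>Stein equation for the chi-square distribution\<close>

text \<open>The obstacle is the origin. In x = |w|^2 the operator has leading coefficient 4 x, so
  the equation controls only \<open>x * sol' x\<close>, and the third-order error carries a factor 1
  / |W|. On |w| \<le> \<epsilon> the test function is constant, because its radius r is at least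
  \<epsilon>; there the solution is a multiple of one explicit power series whose derivatives are
  bounded in every dimension. Farther out, the mean of 1 / |W| is estimated over dyadic scales,
  which rests on P(|W| \<le> s) = O(s^2) for at least two degrees of freedom. In dimension one the
  Cauchy-Schwarz inequality is an equality, and the singular term cancels. The equation is of first
  order with integrating factor 4 x times the density. The solution is therefore a quotient of
  one-dimensional integrals, and its bounds are tail comparisons whose constants are free of H. The
  kinks of the test function preclude a third-order Taylor term. The increment of the second-order
  form along a segment takes its place, and the increment of the ramp inside it produces the shell.
  The conditional covariance of a swap fluctuates; a martingale variance bound for random
  permutations controls this without fourth moments.\<close>

definition chi2_norm :: "nat \<Rightarrow> real" where
  "chi2_norm d = 2 powr (real d / 2) * Gamma (real d / 2)"

definition chi2_density :: "nat \<Rightarrow> real \<Rightarrow> real" where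
  "chi2_density d x = x powr (real d / 2 - 1) * exp (- x / 2) / chi2_norm d"

text \<open>This is 4 x times the density, the integrating factor of the Stein operator: the density
  times 4 x p' + 2 (d - x) p is the derivative of kernel times p. The exponent d / 2 removes the
  singularity that the density may have at 0.\<close>

definition chi2_kernel :: "nat \<Rightarrow> real \<Rightarrow> real" where
  "chi2_kernel d x = 4 * x powr (real d / 2) * exp (- x / 2) / chi2_norm d"

text \<open>Comparing coefficients in 4 x p' + 2 (d - x) p = 1 gives 2 d c_0 = 1 and (2 (k + 1) + d)
  c_(k+1) = c_k. These are the coefficients of the solution that is regular at 0.\<close>

primrec stein_coeff :: "nat \<Rightarrow> nat \<Rightarrow> real" where
  "stein_coeff d 0 = 1 / (2 * real d)"
| "stein_coeff d (Suc k) = stein_coeff d k / (2 * real (Suc k) + real d)"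

definition stein0 :: "nat \<Rightarrow> real \<Rightarrow> real" where
  "stein0 d x = (\<Sum>k. stein_coeff d k * x ^ k)"
definition stein1 :: "nat \<Rightarrow> real \<Rightarrow> real" where
  "stein1 d x = (\<Sum>k. diffs (stein_coeff d) k * x ^ k)"
definition stein2 :: "nat \<Rightarrow> real \<Rightarrow> real" where
  "stein2 d x = (\<Sum>k. diffs (diffs (stein_coeff d)) k * x ^ k)"

lemma chi2_norm_pos: "d \<ge> 1 \<Longrightarrow> chi2_norm d > 0"
  unfolding chi2_norm_def by (intro mult_pos_pos Gamma_real_pos) auto

lemma chi2_density_kernel: "x > 0 \<Longrightarrow> chi2_density d x = chi2_kernel d x / (4 * x)"
  by (simp add: chi2_density_def chi2_kernel_def powr_diff)

lemma chi2_kernel_pos: "d \<ge> 1 \<Longrightarrow> x > 0 \<Longrightarrow> chi2_kernel d x > 0"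
  unfolding chi2_kernel_def by (intro divide_pos_pos mult_pos_pos chi2_norm_pos) auto

lemma chi2_kernel_nonneg: "d \<ge> 1 \<Longrightarrow> x \<ge> 0 \<Longrightarrow> chi2_kernel d x \<ge> 0"
  using chi2_kernel_pos[of d x] by (cases "x = 0") (auto simp: chi2_kernel_def)

lemma chi2_density_pos: "d \<ge> 1 \<Longrightarrow> x > 0 \<Longrightarrow> chi2_density d x > 0"
  by (simp add: chi2_density_kernel chi2_kernel_pos)

lemma chi2_kernel_0 [simp]: "chi2_kernel d 0 = 0"
  by (simp add: chi2_kernel_def)

lemma DERIV_chi2_kernel:
  assumes "x > 0"
  shows "(chi2_kernel d has_real_derivative 2 * (real d - x) * chi2_density d x) (at x)"
proof -
  define c where "c = 4 / chi2_norm d"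
  have "((\<lambda>x. c * (x powr (real d / 2) * exp (- x / 2))) has_real_derivative
      c * ((real d / 2 * x powr (real d / 2 - 1)) * exp (- x / 2) + x powr (real d / 2) * (exp (- x / 2) * (- 1 / 2)))) (at x)"
    using assms by (auto intro!: derivative_eq_intros simp: algebra_simps)
  moreover have "x powr (real d / 2) = x * x powr (real d / 2 - 1)"
    using assms by (simp add: powr_diff)
  ultimately show ?thesis
    unfolding chi2_kernel_def chi2_density_def by (simp add: c_def algebra_simps diff_divide_distrib)
qed

lemma continuous_on_chi2_kernel:
  assumes "d \<ge> 1"
  shows "continuous_on {0..} (chi2_kernel d)"
proof -
  have "chi2_norm d \<noteq> 0" using chi2_norm_pos[OF assms] by simp
  then show ?thesis unfolding chi2_kernel_def
    using assms by (intro continuous_intros continuous_on_powr') auto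
qed

lemma continuous_on_chi2_density:
  assumes "d \<ge> 1"
  shows "continuous_on {0<..} (chi2_density d)"
proof -
  have "chi2_norm d \<noteq> 0" using chi2_norm_pos[OF assms] by simp
  then show ?thesis unfolding chi2_density_def
    using assms by (intro continuous_intros) auto
qed

section \<open>Power series solution for the constant right-hand side 1\<close>

lemma stein_coeff_nonneg: "stein_coeff d k \<ge> 0"
  by (induction k) auto

lemma stein_coeff_le: "stein_coeff d k \<le> (1 / 2) ^ k * inverse (fact k)"
proof (induction k)
  case 0
  then show ?case by (cases d) (auto simp: divide_simps)
next
  case (Suc k)
  have "stein_coeff d (Suc k) \<le> stein_coeff d k / (2 * real (Suc k))"
    unfolding stein_coeff.simps
    by (intro divide_left_mono stein_coeff_nonneg) auto
  also have "\<dots> \<le> ((1 / 2) ^ k * inverse (fact k)) / (2 * real (Suc k))"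
    by (intro divide_right_mono Suc) auto
  also have "\<dots> = (1 / 2) ^ Suc k * inverse (fact (Suc k))"
    by (simp add: field_simps)
  finally show ?case .
qed

text \<open>The factor k + 1 produced by differentiation is absorbed by the denominator 2 (k + 1) +
  d, so each derivative gains a factor 1 / 2. Hence \<open>stein1\<close> and \<open>stein2\<close>
  inherit every upper bound on \<open>stein0\<close>, uniformly in d.\<close>

lemma diffs_stein_coeff_le: "0 \<le> diffs (stein_coeff d) k \<and> diffs (stein_coeff d) k \<le> stein_coeff d k / 2"
proof -
  have "real (Suc k) * stein_coeff d k / (2 * real (Suc k) + real d) \<le> real (Suc k) * stein_coeff d k / (2 * real (Suc k))"
    using stein_coeff_nonneg[of d k] by (intro divide_left_mono) auto
  also have "\<dots> = stein_coeff d k / 2" by (simp add: field_simps)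
  finally show ?thesis
    using stein_coeff_nonneg[of d k] by (simp add: diffs_def)
qed

lemma diffs_diffs_stein_coeff_le:
  "0 \<le> diffs (diffs (stein_coeff d)) k \<and> diffs (diffs (stein_coeff d)) k \<le> stein_coeff d k / 4"
proof -
  have "diffs (diffs (stein_coeff d)) k = real (Suc k) * diffs (stein_coeff d) (Suc k)"
    by (simp add: diffs_def)
  moreover have "\<dots> \<le> real (Suc k) * (stein_coeff d (Suc k) / 2)"
    using diffs_stein_coeff_le[of d "Suc k"] by (intro mult_left_mono) auto
  moreover have "real (Suc k) * (stein_coeff d (Suc k) / 2) = diffs (stein_coeff d) k / 2"
    by (simp add: diffs_def)
  moreover have "0 \<le> real (Suc k) * diffs (stein_coeff d) (Suc k)"
    using diffs_stein_coeff_le[of d "Suc k"] by simp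
  ultimately show ?thesis using diffs_stein_coeff_le[of d k] by linarith
qed

lemma summable_stein_coeff: "summable (\<lambda>k. stein_coeff d k * y ^ k)"
proof (rule summable_comparison_test[OF _ summable_exp])
  show "\<exists>N. \<forall>n\<ge>N. norm (stein_coeff d n * y ^ n) \<le> inverse (fact n) * (\<bar>y\<bar> / 2) ^ n"
  proof (intro exI allI impI)
    fix n
    have "stein_coeff d n * \<bar>y\<bar> ^ n \<le> ((1 / 2) ^ n * inverse (fact n)) * \<bar>y\<bar> ^ n"
      by (intro mult_right_mono stein_coeff_le) auto
    then show "norm (stein_coeff d n * y ^ n) \<le> inverse (fact n) * (\<bar>y\<bar> / 2) ^ n"
      using stein_coeff_nonneg[of d n] by (simp add: abs_mult power_abs power_divide field_simps)
  qed
qed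

lemma summable_diffs_stein_coeff:
  "summable (\<lambda>k. diffs (stein_coeff d) k * y ^ k)"
  "summable (\<lambda>k. diffs (diffs (stein_coeff d)) k * y ^ k)"
proof -
  have *: "summable (\<lambda>k. c k * y ^ k)" if "\<And>k. 0 \<le> c k \<and> c k \<le> stein_coeff d k" for c
  proof (rule summable_comparison_test[OF _ summable_stein_coeff[of d "\<bar>y\<bar>"]])
    show "\<exists>N. \<forall>n\<ge>N. norm (c n * y ^ n) \<le> stein_coeff d n * \<bar>y\<bar> ^ n"
      using that by (auto simp: abs_mult power_abs intro!: mult_right_mono)
  qed
  show "summable (\<lambda>k. diffs (stein_coeff d) k * y ^ k)"
    by (rule *) (use diffs_stein_coeff_le stein_coeff_nonneg in \<open>smt (verit) field_sum_of_halves\<close>)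
  show "summable (\<lambda>k. diffs (diffs (stein_coeff d)) k * y ^ k)"
  proof (rule *)
    fix k show "0 \<le> diffs (diffs (stein_coeff d)) k \<and> diffs (diffs (stein_coeff d)) k \<le> stein_coeff d k"
      using diffs_diffs_stein_coeff_le[of d k] stein_coeff_nonneg[of d k] by auto
  qed
qed

lemma DERIV_stein0: "(stein0 d has_real_derivative stein1 d x) (at x)"
  unfolding stein0_def stein1_def
  by (rule termdiffs_strong_converges_everywhere) (rule summable_stein_coeff)

lemma DERIV_stein1: "(stein1 d has_real_derivative stein2 d x) (at x)"
  unfolding stein1_def stein2_def
  by (rule termdiffs_strong_converges_everywhere) (rule summable_diffs_stein_coeff)

lemma stein0_nonneg: "x \<ge> 0 \<Longrightarrow> stein0 d x \<ge> 0"
  unfolding stein0_def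
  by (intro suminf_nonneg summable_stein_coeff) (auto simp: stein_coeff_nonneg)

lemma stein1_bounds:
  assumes "x \<ge> 0" shows "0 \<le> stein1 d x" "stein1 d x \<le> stein0 d x / 2"
proof -
  show "0 \<le> stein1 d x" unfolding stein1_def
    by (intro suminf_nonneg summable_diffs_stein_coeff) (use assms diffs_stein_coeff_le in auto)
  have "stein1 d x \<le> (\<Sum>k. stein_coeff d k * x ^ k / 2)" unfolding stein1_def
  proof (intro suminf_le summable_diffs_stein_coeff summable_divide summable_stein_coeff)
    fix n show "diffs (stein_coeff d) n * x ^ n \<le> stein_coeff d n * x ^ n / 2"
      using mult_right_mono[of "diffs (stein_coeff d) n" "stein_coeff d n / 2" "x ^ n"]
        diffs_stein_coeff_le[of d n] assms by auto
  qed
  also have "\<dots> = stein0 d x / 2" unfolding stein0_def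
    by (rule suminf_divide) (rule summable_stein_coeff)
  finally show "stein1 d x \<le> stein0 d x / 2" .
qed

lemma stein2_bounds:
  assumes "x \<ge> 0" shows "0 \<le> stein2 d x" "stein2 d x \<le> stein0 d x / 4"
proof -
  show "0 \<le> stein2 d x" unfolding stein2_def
    by (intro suminf_nonneg summable_diffs_stein_coeff) (use assms diffs_diffs_stein_coeff_le in auto)
  have "stein2 d x \<le> (\<Sum>k. stein_coeff d k * x ^ k / 4)" unfolding stein2_def
  proof (intro suminf_le summable_diffs_stein_coeff summable_divide summable_stein_coeff)
    fix n show "diffs (diffs (stein_coeff d)) n * x ^ n \<le> stein_coeff d n * x ^ n / 4"
      using mult_right_mono[of "diffs (diffs (stein_coeff d)) n" "stein_coeff d n / 4" "x ^ n"]
        diffs_diffs_stein_coeff_le[of d n] assms by auto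
  qed
  also have "\<dots> = stein0 d x / 4" unfolding stein0_def
    by (rule suminf_divide) (rule summable_stein_coeff)
  finally show "stein2 d x \<le> stein0 d x / 4" .
qed

text \<open>Every denominator in the recurrence is at least 2, so the coefficients are dominated by
  2^-(k+1), whose sum is 1. The bound does not see d.\<close>

lemma stein0_le_1:
  assumes "d \<ge> 1" "0 \<le> x" "x \<le> 1" shows "stein0 d x \<le> 1"
proof -
  have le: "stein_coeff d k \<le> (1/2) ^ Suc k" for k
  proof (induction k)
    case 0 show ?case using assms(1) by (auto simp: divide_simps)
  next
    case (Suc k)
    have "stein_coeff d (Suc k) \<le> stein_coeff d k / 2"
      unfolding stein_coeff.simps by (intro divide_left_mono stein_coeff_nonneg) auto
    also have "\<dots> \<le> (1/2) ^ Suc k / 2" using Suc by (rule divide_right_mono) simp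
    finally show ?case by (simp del: stein_coeff.simps)
  qed
  have "stein0 d x \<le> (\<Sum>k. (1/2::real) ^ Suc k)" unfolding stein0_def
  proof (intro suminf_le summable_stein_coeff)
    fix n
    have "stein_coeff d n * x ^ n \<le> stein_coeff d n * 1"
      using assms by (intro mult_left_mono stein_coeff_nonneg power_le_one) auto
    then show "stein_coeff d n * x ^ n \<le> (1/2) ^ Suc n" using le[of n] by simp
  next
    show "summable (\<lambda>n. (1/2::real) ^ Suc n)"
      by (subst summable_Suc_iff) (auto intro: summable_geometric)
  qed
  also have "\<dots> = 1" using power_half_series by (simp add: sums_iff)
  finally show ?thesis .
qed

lemma stein0_ode:
  assumes "d \<ge> 1"
  shows "4 * x * stein1 d x + 2 * (real d - x) * stein0 d x = 1"
proof -
  have split: "stein0 d x = stein_coeff d 0 + (\<Sum>k. stein_coeff d (Suc k) * x ^ Suc k)"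
    unfolding stein0_def using suminf_split_head[OF summable_stein_coeff[of d x]] by simp
  have sS: "summable (\<lambda>k. stein_coeff d (Suc k) * x ^ Suc k)"
    using summable_stein_coeff[of d x] by (subst summable_Suc_iff)
  \<comment> \<open>The recurrence times x^(k+1), arranged so that the two series on the right are
    \<open>stein0\<close> and its tail without the constant term.\<close>
  have eq: "4 * x * (diffs (stein_coeff d) k * x ^ k) =
      2 * x * (stein_coeff d k * x ^ k) - 2 * real d * (stein_coeff d (Suc k) * x ^ Suc k)" for k
  proof -
    have "(4 * real (Suc k) + 2 * real d) * stein_coeff d (Suc k) = 2 * stein_coeff d k"
      by (simp add: field_simps)
    then have "(4 * real (Suc k)) * stein_coeff d (Suc k) = 2 * stein_coeff d k - 2 * real d * stein_coeff d (Suc k)"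
      by (simp add: algebra_simps del: stein_coeff.simps)
    then have "((4 * real (Suc k)) * stein_coeff d (Suc k)) * x ^ Suc k = (2 * stein_coeff d k - 2 * real d * stein_coeff d (Suc k)) * x ^ Suc k"
      by simp
    then show ?thesis by (simp add: diffs_def algebra_simps)
  qed
  have "4 * x * stein1 d x = (\<Sum>k. 4 * x * (diffs (stein_coeff d) k * x ^ k))"
    unfolding stein1_def by (rule suminf_mult[symmetric]) (rule summable_diffs_stein_coeff)
  also have "\<dots> = (\<Sum>k. 2 * x * (stein_coeff d k * x ^ k) - 2 * real d * (stein_coeff d (Suc k) * x ^ Suc k))"
    by (simp only: eq)
  also have "\<dots> = (\<Sum>k. 2 * x * (stein_coeff d k * x ^ k)) - (\<Sum>k. 2 * real d * (stein_coeff d (Suc k) * x ^ Suc k))"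
    by (rule suminf_diff[symmetric]) (intro summable_mult summable_stein_coeff sS)+
  also have "(\<Sum>k. 2 * x * (stein_coeff d k * x ^ k)) = 2 * x * stein0 d x"
    unfolding stein0_def by (rule suminf_mult) (rule summable_stein_coeff)
  also have "(\<Sum>k. 2 * real d * (stein_coeff d (Suc k) * x ^ Suc k)) = 2 * real d * (stein0 d x - stein_coeff d 0)"
    unfolding split by (subst suminf_mult[OF sS]) simp
  finally show ?thesis using assms by (simp add: algebra_simps)
qed

lemma DERIV_kernel_stein0:
  assumes "d \<ge> 1" "x > 0"
  shows "((\<lambda>x. chi2_kernel d x * stein0 d x) has_real_derivative chi2_density d x) (at x)"
proof -
  have "chi2_kernel d x = 4 * x * chi2_density d x"
    using chi2_density_kernel[OF assms(2), of d] assms(2) by simp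
  then have "2 * (real d - x) * chi2_density d x * stein0 d x + stein1 d x * chi2_kernel d x
     = chi2_density d x * (4 * x * stein1 d x + 2 * (real d - x) * stein0 d x)"
    by (simp add: algebra_simps)
  also have "\<dots> = chi2_density d x" using stein0_ode[OF assms(1)] by simp
  finally have "2 * (real d - x) * chi2_density d x * stein0 d x + stein1 d x * chi2_kernel d x = chi2_density d x" .
  with DERIV_mult[OF DERIV_chi2_kernel[OF assms(2), of d] DERIV_stein0[of d x]]
  show ?thesis by simp
qed

lemma continuous_stein0: "continuous_on A (stein0 d)"
  by (rule continuous_at_imp_continuous_on) (use DERIV_stein0 DERIV_isCont in blast)

text \<open>Both sides vanish at 0 and have the density as derivative for x > 0. The interior form
  of the fundamental theorem is used because the density is unbounded at 0 when d = 1. From here on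
  \<open>stein0\<close> is the quotient of distribution function and kernel.\<close>

lemma chi2_cdf_kernel:
  assumes "d \<ge> 1" "x \<ge> 0"
  shows "chi2_cdf d x = chi2_kernel d x * stein0 d x"
proof (cases "x = 0")
  case True then show ?thesis by (simp add: chi2_cdf_def)
next
  case False
  with assms have x: "x > 0" by simp
  have "(chi2_density d has_integral (chi2_kernel d x * stein0 d x - chi2_kernel d 0 * stein0 d 0)) {0..x}"
  proof (rule fundamental_theorem_of_calculus_interior)
    show "continuous_on {0..x} (\<lambda>x. chi2_kernel d x * stein0 d x)"
      by (intro continuous_intros continuous_on_subset[OF continuous_on_chi2_kernel[OF assms(1)]] continuous_stein0) auto
    fix y assume "y \<in> {0<..<x}"
    then show "((\<lambda>x. chi2_kernel d x * stein0 d x) has_vector_derivative chi2_density d y) (at y)"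
      using DERIV_kernel_stein0[OF assms(1), of y]
      by (simp add: has_real_derivative_iff_has_vector_derivative)
  qed (use assms in auto)
  then have "integral {0..x} (chi2_density d) = chi2_kernel d x * stein0 d x"
    by (simp add: integral_unique)
  then show ?thesis using x by (simp add: chi2_cdf_def chi2_density_def[abs_def] chi2_norm_def)
qed

lemma chi2_cdf_nonpos: "x \<le> 0 \<Longrightarrow> chi2_cdf d x = 0"
  by (simp add: chi2_cdf_def)

lemma chi2_cdf_nonneg: "d \<ge> 1 \<Longrightarrow> chi2_cdf d x \<ge> 0"
  by (cases "x \<ge> 0") (auto simp: chi2_cdf_kernel chi2_cdf_nonpos chi2_kernel_nonneg stein0_nonneg)

lemma DERIV_chi2_cdf:
  assumes "d \<ge> 1" "x > 0"
  shows "(chi2_cdf d has_real_derivative chi2_density d x) (at x)"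
proof (rule DERIV_cong_ev[THEN iffD1, OF refl _ refl DERIV_kernel_stein0[OF assms]])
  show "\<forall>\<^sub>F x in nhds x. chi2_kernel d x * stein0 d x = chi2_cdf d x"
    using eventually_nhds_in_open[of "{0<..}" x] assms
    by (auto elim!: eventually_mono simp: chi2_cdf_kernel)
qed

lemma chi2_cdf_mono:
  assumes "d \<ge> 1" "x \<le> y"
  shows "chi2_cdf d x \<le> chi2_cdf d y"
proof (cases "x > 0")
  case True
  then show ?thesis
    using assms chi2_density_pos[OF assms(1)] DERIV_chi2_cdf[OF assms(1)]
    by (intro DERIV_nonneg_imp_nondecreasing[OF assms(2)]) (smt (verit))
next
  case False then show ?thesis using chi2_cdf_nonneg[OF assms(1)] by (simp add: chi2_cdf_nonpos)
qed

text \<open>The substitution x = 2 y turns the density into the integrand of Gamma (d / 2) divided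
  by its integral, so the limit is the convergence of that improper integral.\<close>

lemma chi2_cdf_tendsto_1:
  assumes "d \<ge> 1"
  shows "(chi2_cdf d \<longlongrightarrow> 1) at_top"
proof (rule tendstoI)
  fix e :: real assume e: "e > 0"
  define a where "a = real d / 2"
  have a: "a > 0" using assms by (simp add: a_def)
  have G: "Gamma a > 0" using a by (rule Gamma_real_pos)
  define g where "g = (\<lambda>t::real. t powr (a - 1) / exp t)"
  have "(g has_integral Gamma a) {0..}" unfolding g_def by (rule Gamma_integral_real[OF a])
  then have "\<forall>e>0. \<exists>B>0. \<forall>l u. ball 0 B \<subseteq> cbox l u \<longrightarrow>
      (\<exists>z. ((\<lambda>x. if x \<in> {0..} then g x else 0) has_integral z) (cbox l u) \<and> norm (z - Gamma a) < e)"
    by (subst (asm) has_integral') 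
  moreover have "e * Gamma a > 0" using e G by simp
  ultimately obtain B where B: "B > 0" and BB: "\<And>l u. ball 0 B \<subseteq> cbox l u \<Longrightarrow>
      (\<exists>z. ((\<lambda>x. if x \<in> {0..} then g x else 0) has_integral z) (cbox l u) \<and> norm (z - Gamma a) < e * Gamma a)"
    by meson
  have "dist (chi2_cdf d x) 1 < e" if x: "x \<ge> 2 * B" for x
  proof -
    define y where "y = x / 2"
    have y: "y \<ge> B" "y > 0" "x = 2 * y" using x B by (auto simp: y_def)
    have "(g has_integral (Gamma a * chi2_cdf d (2 * y) - Gamma a * chi2_cdf d (2 * 0))) {0..y}"
    proof (rule fundamental_theorem_of_calculus_interior)
      have "continuous_on {0..2 * y} (\<lambda>x. chi2_kernel d x * stein0 d x)"
        by (intro continuous_intros continuous_on_subset[OF continuous_on_chi2_kernel[OF assms(1)]] continuous_stein0) auto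
      then have c: "continuous_on {0..2 * y} (chi2_cdf d)"
        by (rule continuous_on_cong[THEN iffD1, OF refl, rotated]) (simp add: chi2_cdf_kernel[OF assms])
      have "continuous_on {0..y} (\<lambda>y. chi2_cdf d (2 * y))"
        by (rule continuous_on_compose2[OF c]) (auto intro!: continuous_intros)
      then show "continuous_on {0..y} (\<lambda>y. Gamma a * chi2_cdf d (2 * y))"
        by (rule continuous_on_mult_left)
      fix v assume v: "v \<in> {0<..<y}"
      have "((\<lambda>y. Gamma a * chi2_cdf d (2 * y)) has_real_derivative Gamma a * (chi2_density d (2 * v) * 2)) (at v)"
      proof (rule DERIV_cmult)
        have "((\<lambda>y::real. 2 * y) has_real_derivative 2) (at v)"
          by (auto intro!: derivative_eq_intros)
        then show "((\<lambda>y. chi2_cdf d (2 * y)) has_real_derivative chi2_density d (2 * v) * 2) (at v)"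
          by (rule DERIV_chain2[rotated]) (rule DERIV_chi2_cdf, use assms v in auto)
      qed
      also have "Gamma a * (chi2_density d (2 * v) * 2) = g v"
      proof -
        define u w where "u = (2::real) powr (a - 1)" and "w = v powr (a - 1)"
        have "2 powr a = 2 powr (1 + (a - 1))" by simp
        also have "\<dots> = 2 * u" unfolding powr_add u_def by simp
        finally have 2: "2 powr a = 2 * u" .
        have 3: "(2 * v) powr (a - 1) = u * w" using v by (simp add: powr_mult u_def w_def)
        have "chi2_density d (2 * v) = u * w * exp (- v) / (2 * u * Gamma a)"
          unfolding chi2_density_def chi2_norm_def a_def[symmetric] 2 3 by simp
        moreover have "u > 0" by (simp add: u_def)
        moreover have "g v = w * exp (- v)"
          unfolding g_def w_def exp_minus by (rule divide_inverse)
        ultimately show ?thesis using G by simp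
      qed
      finally show "((\<lambda>y. Gamma a * chi2_cdf d (2 * y)) has_vector_derivative g v) (at v)"
        by (simp add: has_real_derivative_iff_has_vector_derivative)
    qed (use y in auto)
    then have 1: "(g has_integral Gamma a * chi2_cdf d x) {0..y}" by (simp add: y chi2_cdf_nonpos)
    \<comment> \<open>The integrand is extended by 0 to [-y, y], because the improper integral is
      tested on boxes containing a ball around 0.\<close>
    have 2: "((\<lambda>x. if x \<in> {0..} then g x else 0) has_integral Gamma a * chi2_cdf d x) (cbox (-y) y)"
    proof (rule has_integral_eq)
      show "((\<lambda>x. if x \<in> {0..y} then g x else 0) has_integral Gamma a * chi2_cdf d x) (cbox (-y) y)"
        by (subst has_integral_restrict) (use 1 y(2) in auto)
      show "(if z \<in> {0..y} then g z else 0) = (if z \<in> {0..} then g z else 0)" if "z \<in> cbox (-y) y" for z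
        using that by auto
    qed
    have "ball 0 B \<subseteq> cbox (-y) y"
    proof
      fix u :: real assume "u \<in> ball 0 B"
      then have "\<bar>u\<bar> < B" by simp
      then show "u \<in> cbox (-y) y" using y(1) unfolding cbox_interval atLeastAtMost_iff by linarith
    qed
    from BB[OF this] 2 have "norm (Gamma a * chi2_cdf d x - Gamma a) < e * Gamma a"
      using has_integral_unique by (metis (no_types, lifting))
    then have "Gamma a * \<bar>chi2_cdf d x - 1\<bar> < Gamma a * e"
    proof -
      have "\<bar>Gamma a * (chi2_cdf d x - 1)\<bar> < Gamma a * e"
        using \<open>norm (Gamma a * chi2_cdf d x - Gamma a) < e * Gamma a\<close>
        by (simp add: right_diff_distrib mult.commute)
      then show ?thesis using G by (simp add: abs_mult)
    qed
    then show ?thesis using G by (simp add: dist_real_def)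
  qed
  then show "\<forall>\<^sub>F x in at_top. dist (chi2_cdf d x) 1 < e"
    by (rule eventually_at_top_linorderI)
qed

lemma chi2_cdf_le_1:
  assumes "d \<ge> 1" shows "chi2_cdf d x \<le> 1"
  by (rule tendsto_lowerbound[OF chi2_cdf_tendsto_1[OF assms]])
     (auto intro!: eventually_at_top_linorderI[of x] chi2_cdf_mono assms)

lemma chi2_kernel_tendsto_0: "(chi2_kernel d \<longlongrightarrow> 0) at_top"
proof -
  have "((\<lambda>x::real. x powr (real d / 2) * exp (- x / 2)) \<longlongrightarrow> 0) at_top"
    by real_asymp
  from tendsto_mult_right[OF this, of "4 / chi2_norm d"]
  show ?thesis unfolding chi2_kernel_def by (simp add: field_simps)
qed

section \<open>Comparison of the two tails with the kernel\<close>

text \<open>In the equation of \<open>stein0\<close> the term 4 x \<open>stein1\<close> is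
  nonnegative; dropping it and multiplying by the kernel gives the bound. It handles the drift 2 (d
  - x) p below the mean d.\<close>

lemma chi2_cdf_kernel_low:
  assumes "d \<ge> 1" "x \<ge> 0"
  shows "2 * (real d - x) * chi2_cdf d x \<le> chi2_kernel d x"
proof -
  have "2 * (real d - x) * stein0 d x \<le> 1"
    using stein0_ode[OF assms(1), of x] stein1_bounds(1)[OF assms(2), of d] assms(2)
    by (smt (verit) mult_nonneg_nonneg)
  then have "chi2_kernel d x * (2 * (real d - x) * stein0 d x) \<le> chi2_kernel d x * 1"
    using chi2_kernel_nonneg[OF assms] by (intro mult_left_mono) auto
  then show ?thesis by (simp add: chi2_cdf_kernel[OF assms] algebra_simps)
qed

text \<open>A Mills ratio argument: K(x) / (2 (x - d)) minus the upper tail has derivative - K(x) /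
  (2 (x - d)^2) and tends to 0 at infinity, so it is nonnegative.\<close>

lemma chi2_cdf_kernel_high:
  assumes "d \<ge> 1" "x \<ge> real d"
  shows "2 * (x - real d) * (1 - chi2_cdf d x) \<le> chi2_kernel d x"
proof (cases "x = real d")
  case True then show ?thesis using chi2_kernel_nonneg[of d x] assms by simp
next
  case False
  with assms have x: "x > real d" by simp
  define g where "g = (\<lambda>x. chi2_kernel d x / (2 * (x - real d)) - (1 - chi2_cdf d x))"
  have lim: "(g \<longlongrightarrow> 0 - (1 - 1)) at_top" unfolding g_def
  proof (intro tendsto_intros chi2_cdf_tendsto_1 assms)
    have "((\<lambda>x. chi2_kernel d x * (1 / (2 * (x - real d)))) \<longlongrightarrow> 0 * 0) at_top"
      by (intro tendsto_mult chi2_kernel_tendsto_0) real_asymp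
    then show "((\<lambda>x. chi2_kernel d x / (2 * (x - real d))) \<longlongrightarrow> 0) at_top" by simp
  qed
  have mono: "g y \<le> g x" if "y \<ge> x" for y
  proof (rule DERIV_nonpos_imp_nonincreasing[OF that])
    fix u assume u: "x \<le> u" "u \<le> y"
    have u0: "u > real d" "u > 0" using u x by auto
    have "(g has_real_derivative ((2 * (real d - u) * chi2_density d u) * (2 * (u - real d)) - chi2_kernel d u * 2)
        / ((2 * (u - real d)) * (2 * (u - real d))) - (0 - chi2_density d u)) (at u)"
      unfolding g_def
      by (intro derivative_intros DERIV_divide DERIV_chi2_kernel DERIV_chi2_cdf assms u0) (use u0 in \<open>auto intro!: derivative_eq_intros\<close>)
    also have "((2 * (real d - u) * chi2_density d u) * (2 * (u - real d)) - chi2_kernel d u * 2)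
        / ((2 * (u - real d)) * (2 * (u - real d))) - (0 - chi2_density d u) =
        - (chi2_kernel d u / (2 * (u - real d)^2))"
    proof -
      define w where "w = u - real d"
      have "w \<noteq> 0" "u = real d + w" using u0 by (auto simp: w_def)
      then show ?thesis by (simp add: field_simps power2_eq_square)
    qed
    finally have "(g has_real_derivative - (chi2_kernel d u / (2 * (u - real d)^2))) (at u)" .
    moreover have "- (chi2_kernel d u / (2 * (u - real d)^2)) \<le> 0"
      using chi2_kernel_nonneg[OF assms(1), of u] u0 by simp
    ultimately show "\<exists>y. (g has_real_derivative y) (at u) \<and> y \<le> 0" by blast
  qed
  have "0 \<le> g x"
    using tendsto_upperbound[OF lim eventually_at_top_linorderI[of x "\<lambda>y. g y \<le> g x"]] mono by simp
  then show ?thesis using x by (simp add: g_def field_simps)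
qed

lemma stein0_mono:
  assumes "0 \<le> x" "x \<le> y" shows "stein0 d x \<le> stein0 d y"
  by (rule DERIV_nonneg_imp_nondecreasing[OF assms(2)])
     (use DERIV_stein0 stein1_bounds(1) assms(1) in \<open>meson order_trans\<close>)

lemma stein1_mono:
  assumes "0 \<le> x" "x \<le> y" shows "stein1 d x \<le> stein1 d y"
  by (rule DERIV_nonneg_imp_nondecreasing[OF assms(2)])
     (use DERIV_stein1 stein2_bounds(1) assms(1) in \<open>meson order_trans\<close>)

text \<open>At x = d - 1 the equation gives \<open>stein0\<close> \<le> 1/2, and at x = d it gives
  \<open>stein1\<close> = 1 / (4 d). Since \<open>stein1\<close> increases, \<open>stein0\<close>
  grows by at most 1/4 over the last unit interval.\<close>

lemma stein0_le_1_below: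
  assumes "d \<ge> 1" "0 \<le> x" "x \<le> real d" shows "stein0 d x \<le> 1"
proof -
  have d: "real d - 1 \<ge> 0" using assms(1) by simp
  have "4 * (real d - 1) * stein1 d (real d - 1) + 2 * stein0 d (real d - 1) = 1"
    using stein0_ode[OF assms(1), of "real d - 1"] by simp
  moreover have "4 * (real d - 1) * stein1 d (real d - 1) \<ge> 0"
    using stein1_bounds(1)[OF d, of d] d by simp
  ultimately have 1: "stein0 d (real d - 1) \<le> 1 / 2" by linarith
  have "stein1 d (real d) = 1 / (4 * real d)"
    using stein0_ode[OF assms(1), of "real d"] assms(1) by (simp add: field_simps)
  then have s1: "stein1 d y \<le> 1 / 4" if "0 \<le> y" "y \<le> real d" for y
  proof -
    have "1 / (4 * real d) \<le> 1 / 4" using assms(1) by (simp add: field_simps)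
    then show ?thesis using stein1_mono[OF that, of d] \<open>stein1 d (real d) = _\<close> by linarith
  qed
  obtain z where z: "real d - 1 < z" "z < real d"
      "stein0 d (real d) - stein0 d (real d - 1) = (real d - (real d - 1)) * stein1 d z"
    using MVT2[of "real d - 1" "real d" "stein0 d" "stein1 d"] DERIV_stein0 by auto
  then have "stein0 d (real d) \<le> 1" using s1[of z] 1 d by auto
  then show ?thesis using stein0_mono[OF assms(2,3), of d] by linarith
qed

lemma chi2_cdf_le_kernel:
  assumes "d \<ge> 1" "0 \<le> x" "x \<le> real d" shows "chi2_cdf d x \<le> chi2_kernel d x"
  using mult_left_mono[OF stein0_le_1_below[OF assms] chi2_kernel_nonneg[OF assms(1,2)]]
  by (simp add: chi2_cdf_kernel[OF assms(1,2)])

lemma chi2_kernel_antimono: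
  assumes "d \<ge> 1" "real d \<le> x" "x \<le> y" shows "chi2_kernel d y \<le> chi2_kernel d x"
proof (rule DERIV_nonpos_imp_nonincreasing[OF assms(3)])
  fix u assume u: "x \<le> u" "u \<le> y"
  then have u0: "u > 0" using assms by linarith
  have "2 * (real d - u) * chi2_density d u \<le> 0"
    using less_imp_le[OF chi2_density_pos[OF assms(1) u0]] order_trans[OF assms(2) u(1)]
    by (simp add: mult_nonpos_nonneg)
  then show "\<exists>y. (chi2_kernel d has_real_derivative y) (at u) \<and> y \<le> 0"
    using DERIV_chi2_kernel[OF u0] by blast
qed

text \<open>The Mills bound degenerates at x = d. For x in [d, d + 1] the mass up to d + 1 is at
  most K(x) / 4, because the density is K(z) / (4 z) with z \<ge> 1 and K decreases, and the tail
  beyond d + 1 is at most K(d + 1) / 2.\<close>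

lemma chi2_cdf_compl_le_kernel:
  assumes "d \<ge> 1" "real d \<le> x" shows "1 - chi2_cdf d x \<le> chi2_kernel d x"
proof -
  have x: "x > 0" using assms by linarith
  have K: "chi2_kernel d x \<ge> 0" using x chi2_kernel_nonneg assms by simp
  show ?thesis
  proof (cases "x < real d + 1")
    case False
    then have "1 * (1 - chi2_cdf d x) \<le> 2 * (x - real d) * (1 - chi2_cdf d x)"
      using chi2_cdf_le_1[OF assms(1), of x] by (intro mult_right_mono) auto
    also have "\<dots> \<le> chi2_kernel d x" by (rule chi2_cdf_kernel_high[OF assms])
    finally show ?thesis by simp
  next
    case True
    obtain z where z: "x < z" "z < real d + 1"
      "chi2_cdf d (real d + 1) - chi2_cdf d x = (real d + 1 - x) * chi2_density d z"
      using MVT2[of x "real d + 1" "chi2_cdf d" "chi2_density d"] DERIV_chi2_cdf[OF assms(1)] x True by auto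
    have "chi2_density d z = chi2_kernel d z / (4 * z)"
      using z x by (intro chi2_density_kernel) auto
    also have "\<dots> \<le> chi2_kernel d x / 4"
      using chi2_kernel_antimono[of d x z] z assms K
        by (intro frac_le) auto
    finally have "(real d + 1 - x) * chi2_density d z \<le> 1 * (chi2_kernel d x / 4)"
      using chi2_density_pos[OF assms(1), of z] z x assms by (intro mult_mono) auto
    moreover have "2 * (1 - chi2_cdf d (real d + 1)) \<le> chi2_kernel d (real d + 1)"
      using chi2_cdf_kernel_high[OF assms(1), of "real d + 1"] by simp
    moreover have "chi2_kernel d (real d + 1) \<le> chi2_kernel d x"
      using chi2_kernel_antimono[OF assms, of "real d + 1"] True by simp
    ultimately show ?thesis using z(3) K by argo
  qed
qed

section \<open>Size of the kernel and anti-concentration\<close>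

text \<open>Kernel times \<open>stein0\<close> is a distribution function, hence at most 1, while
  \<open>stein0\<close> increases from its value 1 / (2 d) at 0.\<close>

lemma chi2_kernel_le:
  assumes "d \<ge> 1" "0 \<le> x" shows "chi2_kernel d x \<le> 2 * real d"
proof -
  have "stein0 d 0 = 1 / (2 * real d)" unfolding stein0_def by (simp add: powser_zero)
  then have "1 / (2 * real d) \<le> stein0 d x"
    using stein0_mono[of 0 x d] assms by simp
  then have "1 \<le> 2 * real d * stein0 d x"
    using assms(1) by (simp add: pos_divide_le_eq mult.commute)
  then have "chi2_kernel d x * 1 \<le> chi2_kernel d x * (2 * real d * stein0 d x)"
    by (intro mult_left_mono chi2_kernel_nonneg assms)
  also have "\<dots> = 2 * real d * chi2_cdf d x" by (simp add: chi2_cdf_kernel[OF assms])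
  also have "\<dots> \<le> 2 * real d * 1" by (intro mult_left_mono chi2_cdf_le_1 assms) auto
  finally show ?thesis by simp
qed

text \<open>The kernel bound at x = 1, with exp (-1/2) \<ge> 1/2, bounds the normalizing constant
  from below without any estimate of Gamma.\<close>

lemma inverse_chi2_norm_le:
  assumes "d \<ge> 1" shows "1 / chi2_norm d \<le> real d"
proof -
  have "exp (1/2 :: real) \<le> 2" using exp_bound_half[of "1/2::real"] by simp
  then have "exp (-(1/2::real)) \<ge> 1/2" by (simp add: exp_minus field_simps)
  then have "4 * (1/2) / chi2_norm d \<le> 4 * exp (- (1/2)) / chi2_norm d"
    using chi2_norm_pos[OF assms] by (intro divide_right_mono) auto
  also have "\<dots> = chi2_kernel d 1" by (simp add: chi2_kernel_def)
  also have "\<dots> \<le> 2 * real d" by (rule chi2_kernel_le) (use assms in auto)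
  finally show ?thesis by simp
qed

text \<open>The square root of a chi-square variable has density 2 z times the chi-square density at
  z^2, and this is at most 2 d: for z \<ge> 1 it is K(z^2) / (2 z), and for z < 1 the power z^(d -
  1) is at most 1, so that the bound on the normalizing constant applies.\<close>

lemma chi2_shell:
  assumes "d \<ge> 1" "0 \<le> r" "r \<le> s"
  shows "chi2_cdf d (s\<^sup>2) - chi2_cdf d (r\<^sup>2) \<le> 2 * real d * (s - r)"
proof (cases "r = s")
  case True then show ?thesis by simp
next
  case False
  have cont: "continuous_on {r..s} (\<lambda>u. chi2_cdf d (u\<^sup>2))"
  proof -
    have "continuous_on {0..} (\<lambda>x. chi2_kernel d x * stein0 d x)"
      by (intro continuous_intros continuous_on_chi2_kernel continuous_stein0 assms)
    then have "continuous_on {0..} (chi2_cdf d)"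
      by (rule continuous_on_cong[THEN iffD1, OF refl, rotated]) (simp add: chi2_cdf_kernel[OF assms(1)])
    then show ?thesis
      by (rule continuous_on_compose2) (auto intro!: continuous_intros)
  qed
  have der: "((\<lambda>u. chi2_cdf d (u\<^sup>2)) has_real_derivative chi2_density d (u\<^sup>2) * (2 * u)) (at u)"
    if "r < u" "u < s" for u
    using that assms
    by (intro DERIV_chain2[OF DERIV_chi2_cdf]) (auto intro!: derivative_eq_intros)
  obtain l z where z: "r < z" "z < s" "((\<lambda>u. chi2_cdf d (u\<^sup>2)) has_real_derivative l) (at z)"
      "chi2_cdf d (s\<^sup>2) - chi2_cdf d (r\<^sup>2) = (s - r) * l"
  proof -
    have "r < s" using False assms by simp
    moreover have "(\<lambda>u. chi2_cdf d (u\<^sup>2)) differentiable (at u)" if "r < u" "u < s" for u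
      using der[OF that] real_differentiable_def by blast
    ultimately show ?thesis using MVT[OF _ cont] that by blast
  qed
  have zp: "z > 0" using z assms by simp
  have l: "l = chi2_density d (z\<^sup>2) * (2 * z)"
    using DERIV_unique z(3) der[OF z(1,2)] by blast
  have "l \<le> 2 * real d"
  proof (cases "z \<ge> 1")
    case True
    have "l = chi2_kernel d (z\<^sup>2) / (2 * z)"
      unfolding l using zp by (simp add: chi2_density_kernel power2_eq_square field_simps)
    also have "\<dots> \<le> 2 * real d / 1"
      using True by (intro frac_le chi2_kernel_le assms) auto
    finally show ?thesis by simp
  next
    case False
    have "z\<^sup>2 = z powr 2" using zp by (simp add: powr_numeral)
    then have "(z\<^sup>2) powr (real d / 2 - 1) = z powr (2 * (real d / 2 - 1))"
      by (simp only: powr_powr)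
    also have "2 * (real d / 2 - 1) = real d - 2" by simp
    finally have "(z\<^sup>2) powr (real d / 2 - 1) * z = z powr (real d - 2) * z powr 1" using zp by simp
    also have "\<dots> = z powr (real d - 1)" unfolding powr_add[symmetric] by simp
    finally have e: "(z\<^sup>2) powr (real d / 2 - 1) * z = z powr (real d - 1)" .
    have "z powr (real d - 1) \<le> 1 powr (real d - 1)"
      using False zp assms by (intro powr_mono2) auto
    then have "z powr (real d - 1) * exp (- z\<^sup>2 / 2) \<le> 1 * 1"
      by (intro mult_mono) auto
    have "l = 2 * (z powr (real d - 1) * exp (- z\<^sup>2 / 2)) / chi2_norm d"
      unfolding l chi2_density_def e[symmetric] by simp
    also have "\<dots> \<le> 2 * 1 / chi2_norm d"
      using \<open>z powr (real d - 1) * exp (- z\<^sup>2 / 2) \<le> 1 * 1\<close> chi2_norm_pos[OF assms(1)]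
      by (intro divide_right_mono mult_left_mono) auto
    also have "\<dots> \<le> 2 * real d" using inverse_chi2_norm_le[OF assms(1)] by simp
    finally show ?thesis .
  qed
  then show ?thesis using z(4) mult_left_mono[of l "2 * real d" "s - r"] assms by (simp add: mult.commute)
qed

text \<open>For d \<ge> 2 the exponent d / 2 - 1 is nonnegative, so the density stays bounded at 0;
  for d = 1 the distribution function grows like sqrt x. At x = s^2 this gives the mass of a ball of
  radius s, of order s^2.\<close>

lemma chi2_cdf_le_linear:
  assumes "d \<ge> 2" "0 \<le> x" shows "chi2_cdf d x \<le> real d * x"
proof (cases "x = 0")
  case True then show ?thesis by (simp add: chi2_cdf_nonpos)
next
  case False
  have d: "d \<ge> 1" using assms by simp
  have cont: "continuous_on {0..x} (chi2_cdf d)"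
  proof -
    have "continuous_on {0..x} (\<lambda>x. chi2_kernel d x * stein0 d x)"
      by (intro continuous_intros continuous_on_subset[OF continuous_on_chi2_kernel] continuous_stein0 d) auto
    then show ?thesis
      by (rule continuous_on_cong[THEN iffD1, OF refl, rotated]) (simp add: chi2_cdf_kernel[OF d])
  qed
  obtain l z where z: "0 < z" "z < x" "(chi2_cdf d has_real_derivative l) (at z)"
      "chi2_cdf d x - chi2_cdf d 0 = (x - 0) * l"
  proof -
    have "0 < x" using False assms by simp
    moreover have "chi2_cdf d differentiable (at u)" if "0 < u" "u < x" for u
      using DERIV_chi2_cdf[OF d that(1)] real_differentiable_def by blast
    ultimately show ?thesis using MVT[OF _ cont] that by blast
  qed
  have l: "l = chi2_density d z" using DERIV_unique z(3) DERIV_chi2_cdf[OF d z(1)] by blast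
  have "l \<le> real d"
  proof (cases "z \<ge> 1")
    case True
    have "l = chi2_kernel d z / (4 * z)" unfolding l using z by (simp add: chi2_density_kernel)
    also have "\<dots> \<le> 2 * real d / 4" using True by (intro frac_le chi2_kernel_le d) auto
    finally show ?thesis by simp
  next
    case False
    have "z powr (real d / 2 - 1) \<le> 1 powr (real d / 2 - 1)"
      using False z assms by (intro powr_mono2) auto
    then have "z powr (real d / 2 - 1) * exp (- z / 2) \<le> 1 * 1"
      using z by (intro mult_mono) auto
    then have "l \<le> 1 / chi2_norm d"
      unfolding l chi2_density_def using chi2_norm_pos[OF d] by (intro divide_right_mono) auto
    then show ?thesis using inverse_chi2_norm_le[OF d] by simp
  qed
  then show ?thesis using z(4) mult_left_mono[of l "real d" x] assms
    by (simp add: chi2_cdf_nonpos mult.commute)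
qed

section \<open>The Stein solution for a smoothed indicator\<close>

locale stein_solution =
  fixes d :: nat and r \<epsilon> :: real
  assumes d: "d \<ge> 1" and eps: "0 < \<epsilon>" "\<epsilon> \<le> 1" and r: "\<epsilon> \<le> r"
begin

definition lo :: real where "lo = r\<^sup>2"
definition hi :: real where "hi = (r + \<epsilon>)\<^sup>2"

text \<open>The indicator of |w| \<le> r, smoothed linearly in |w|^2 over the shell from r to r +
  \<epsilon>. The locale assumption \<epsilon> \<le> r makes it 1 for x \<le> \<epsilon>^2, and
  \<epsilon> \<le> 1 places that range in [0, 1], where the series bounds hold.\<close>

definition ramp :: "real \<Rightarrow> real" where
  "ramp x = max 0 (min 1 ((hi - x) / (hi - lo)))"
text \<open>The integrand vanishes up to \<open>lo\<close>, so the lower limit lo / 2 is as good as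
  0 and avoids the singularity of the density.\<close>

definition tailint :: "real \<Rightarrow> real" where
  "tailint x = integral {lo / 2..x} (\<lambda>u. (1 - ramp u) * chi2_density d u)"
text \<open>The mean of the ramp under the chi-square law: the mass up to \<open>hi\<close>, beyond
  which the ramp vanishes, minus the mass removed by 1 - ramp.\<close>

definition rmean :: real where
  "rmean = chi2_cdf d hi - tailint hi"
text \<open>At 0 the quotient below is 0 / 0 = 0, and the Stein equation holds there by the power series.\<close>
definition sol :: "real \<Rightarrow> real" where
  "sol x = (1 - rmean) * stein0 d x - tailint x / chi2_kernel d x"
text \<open>The Stein equation solved for the derivative; \<open>DERIV_sol\<close> confirms it for x
  > 0. At x = 0 division by zero yields the value 0, which is harmless because it always meets a
  vanishing factor.\<close>

definition sol' :: "real \<Rightarrow> real" where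
  "sol' x = (ramp x - rmean - 2 * (real d - x) * sol x) / (4 * x)"

lemma lo_pos: "0 < lo" and lo_hi: "lo < hi" and hi_lo: "hi - lo = 2 * r * \<epsilon> + \<epsilon>\<^sup>2"
proof -
  have "0 < r * \<epsilon>" "0 < \<epsilon> * \<epsilon>" using eps r by simp_all
  then show "0 < lo" "lo < hi" "hi - lo = 2 * r * \<epsilon> + \<epsilon>\<^sup>2"
    using eps r by (auto simp: lo_def hi_def power2_eq_square algebra_simps intro: add_pos_pos)
qed

lemma ramp_bounds: "0 \<le> ramp x" "ramp x \<le> 1"
  by (auto simp: ramp_def)

lemma ramp_low: "x \<le> lo \<Longrightarrow> ramp x = 1"
  using lo_hi by (auto simp: ramp_def min_def field_simps)

lemma ramp_high: "x \<ge> hi \<Longrightarrow> ramp x = 0"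
  using lo_hi by (auto simp: ramp_def max_def min_def divide_le_0_iff field_simps)

lemma ramp_lipschitz: "\<bar>ramp x - ramp y\<bar> \<le> \<bar>x - y\<bar> / (hi - lo)"
proof -
  have "\<bar>ramp x - ramp y\<bar> \<le> \<bar>(hi - x) / (hi - lo) - (hi - y) / (hi - lo)\<bar>"
    unfolding ramp_def by (auto simp: max_def min_def)
  also have "\<dots> = \<bar>x - y\<bar> / (hi - lo)"
    using lo_hi by (simp add: diff_divide_distrib[symmetric] abs_minus_commute)
  finally show ?thesis .
qed

lemma continuous_ramp: "continuous_on A ramp"
  unfolding ramp_def using lo_hi by (intro continuous_intros) auto

lemma tailint_low: "x \<le> lo \<Longrightarrow> tailint x = 0"
proof -
  assume x: "x \<le> lo"
  have "tailint x = integral {lo / 2..x} (\<lambda>u. 0)"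
    unfolding tailint_def by (rule integral_cong) (use x in \<open>auto simp: ramp_low\<close>)
  then show ?thesis by simp
qed

lemma DERIV_tailint:
  assumes "x > 0"
  shows "(tailint has_real_derivative (1 - ramp x) * chi2_density d x) (at x)"
proof (cases "x < lo")
  case True
  have "((\<lambda>_. 0) has_real_derivative 0) (at x)" by simp
  then have "(tailint has_real_derivative 0) (at x)"
    by (rule DERIV_cong_ev[THEN iffD1, OF refl _ refl, rotated])
       (use eventually_nhds_in_open[of "{..<lo}" x] True in \<open>auto elim!: eventually_mono simp: tailint_low\<close>)
  then show ?thesis using True by (simp add: ramp_low)
next
  case False
  have "continuous_on {lo / 2..x + 1} (\<lambda>u. (1 - ramp u) * chi2_density d u)"
    by (intro continuous_intros continuous_ramp continuous_on_subset[OF continuous_on_chi2_density[OF d]])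
       (use lo_pos in auto)
  then have "(tailint has_real_derivative (1 - ramp x) * chi2_density d x) (at x within {lo / 2..x + 1})"
    unfolding tailint_def by (rule integral_has_real_derivative) (use False lo_pos in auto)
  moreover have "at x within {lo / 2..x + 1} = at x"
    by (rule at_within_interior) (use False lo_pos in auto)
  ultimately show ?thesis by simp
qed

text \<open>The integral of ramp times density over [0, x], encoded as a difference so that no
  further integral with a singular endpoint arises.\<close>

definition headint :: "real \<Rightarrow> real" where "headint x = chi2_cdf d x - tailint x"

lemma DERIV_headint: "x > 0 \<Longrightarrow> (headint has_real_derivative ramp x * chi2_density d x) (at x)"
  unfolding headint_def[abs_def]
  using DERIV_diff[OF DERIV_chi2_cdf[OF d] DERIV_tailint, of x] by (simp add: algebra_simps)

lemma tailint_nonneg: "0 \<le> tailint x"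
proof (cases "x \<le> lo")
  case False
  have "tailint lo \<le> tailint x"
  proof (rule DERIV_nonneg_imp_nondecreasing[where a = lo and b = x])
    fix u assume u: "lo \<le> u" "u \<le> x"
    then have "u > 0" using lo_pos by linarith
    then show "\<exists>y. (tailint has_real_derivative y) (at u) \<and> 0 \<le> y"
      using DERIV_tailint[of u] chi2_density_pos[OF d, of u] ramp_bounds(2)[of u]
      by (intro exI[of _ "(1 - ramp u) * chi2_density d u"]) auto
  qed (use False in auto)
  then show ?thesis by (simp add: tailint_low)
qed (simp add: tailint_low)

lemma headint_mono:
  assumes "0 < x" "x \<le> y" shows "headint x \<le> headint y"
proof (rule DERIV_nonneg_imp_nondecreasing[OF assms(2)])
  fix u assume u: "x \<le> u" "u \<le> y"
  then have "u > 0" using assms by linarith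
  then show "\<exists>y. (headint has_real_derivative y) (at u) \<and> 0 \<le> y"
    using DERIV_headint[of u] chi2_density_pos[OF d, of u] ramp_bounds(1)[of u]
    by (intro exI[of _ "ramp u * chi2_density d u"]) auto
qed

lemma headint_high:
  assumes "hi \<le> x" shows "headint x = rmean"
proof -
  have h: "0 < hi" using lo_pos lo_hi by linarith
  have "headint x \<le> headint hi"
  proof (rule DERIV_nonpos_imp_nonincreasing[OF assms])
    fix u assume u: "hi \<le> u" "u \<le> x"
    then have "u > 0" using h by linarith
    then show "\<exists>y. (headint has_real_derivative y) (at u) \<and> y \<le> 0"
      using DERIV_headint[of u] ramp_high[OF u(1)] by auto
  qed
  then show ?thesis using headint_mono[OF h assms] by (simp add: rmean_def headint_def)
qed

lemma headint_le_rmean: "x > 0 \<Longrightarrow> headint x \<le> rmean"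
  using headint_mono[of x "max x hi"] headint_high[of "max x hi"] by simp

lemma headint_nonneg: "x > 0 \<Longrightarrow> 0 \<le> headint x"
proof -
  assume x: "x > 0"
  have "headint (min x lo) = chi2_cdf d (min x lo)" by (simp add: headint_def tailint_low)
  then have "0 \<le> headint (min x lo)" using chi2_cdf_nonneg[OF d] by simp
  also have "\<dots> \<le> headint x" using x lo_pos by (intro headint_mono) auto
  finally show ?thesis .
qed

lemma rmean_lower: "chi2_cdf d lo \<le> rmean"
  using headint_le_rmean[OF lo_pos] by (simp add: headint_def tailint_low)

lemma rmean_upper: "rmean \<le> chi2_cdf d hi"
  using tailint_nonneg[of hi] lo_pos lo_hi by (simp add: rmean_def)

lemma rmean_bounds: "0 \<le> rmean" "rmean \<le> 1"
  using rmean_lower rmean_upper chi2_cdf_nonneg[OF d, of lo] chi2_cdf_le_1[OF d, of hi] by linarith+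

text \<open>The left side is the integral of ramp times density beyond x, and the ramp is at most
  1.\<close>

lemma rmean_minus_headint_le:
  assumes "x > 0" shows "rmean - headint x \<le> 1 - chi2_cdf d x"
proof (cases "x \<le> hi")
  case True
  define g where "g = (\<lambda>x. headint x - chi2_cdf d x)"
  have "g hi \<le> g x"
  proof (rule DERIV_nonpos_imp_nonincreasing[OF True])
    fix u assume u: "x \<le> u" "u \<le> hi"
    then have u0: "u > 0" using assms by linarith
    have "(g has_real_derivative ramp u * chi2_density d u - chi2_density d u) (at u)"
      unfolding g_def by (intro DERIV_diff DERIV_headint DERIV_chi2_cdf d u0)
    moreover have "ramp u * chi2_density d u \<le> 1 * chi2_density d u"
      using ramp_bounds chi2_density_pos[OF d u0] by (intro mult_right_mono) auto
    ultimately show "\<exists>y. (g has_real_derivative y) (at u) \<and> y \<le> 0" by force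
  qed
  then show ?thesis using headint_high[of hi] chi2_cdf_le_1[OF d, of hi] by (simp add: g_def)
next
  case False
  then show ?thesis using headint_high[of x] chi2_cdf_le_1[OF d, of x] by simp
qed

lemma sol_kernel:
  assumes "x > 0"
  shows "sol x * chi2_kernel d x = headint x - rmean * chi2_cdf d x"
  using chi2_kernel_pos[OF d assms] assms
  by (simp add: sol_def headint_def chi2_cdf_kernel[OF d] field_simps)

text \<open>Write F for the distribution function. Kernel times solution is headint - rmean F, a
  difference of two numbers in [0, F]; it is also rmean (1 - F) - (rmean - headint), a difference of
  two numbers in [0, 1 - F].\<close>

lemma sol_kernel_bounds:
  assumes "x > 0"
  shows "\<bar>sol x\<bar> * chi2_kernel d x \<le> chi2_cdf d x"
    and "\<bar>sol x\<bar> * chi2_kernel d x \<le> 1 - chi2_cdf d x"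
proof -
  have e: "\<bar>sol x\<bar> * chi2_kernel d x = \<bar>headint x - rmean * chi2_cdf d x\<bar>"
    using sol_kernel[OF assms] chi2_kernel_pos[OF d assms] by (metis abs_mult abs_of_pos)
  have F: "0 \<le> chi2_cdf d x" "chi2_cdf d x \<le> 1" using chi2_cdf_nonneg chi2_cdf_le_1 d by auto
  have 1: "0 \<le> rmean * chi2_cdf d x" "rmean * chi2_cdf d x \<le> 1 * chi2_cdf d x"
    using F rmean_bounds by (simp, intro mult_right_mono) auto
  have 2: "headint x \<le> chi2_cdf d x" using tailint_nonneg[of x] by (simp add: headint_def)
  show "\<bar>sol x\<bar> * chi2_kernel d x \<le> chi2_cdf d x"
    unfolding e using 1 2 headint_nonneg[OF assms] by linarith
  have 3: "headint x - rmean * chi2_cdf d x = rmean * (1 - chi2_cdf d x) - (rmean - headint x)"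
    by (simp add: algebra_simps)
  have 4: "0 \<le> rmean * (1 - chi2_cdf d x)" "rmean * (1 - chi2_cdf d x) \<le> 1 * (1 - chi2_cdf d x)"
    using F rmean_bounds by (simp, intro mult_right_mono) auto
  show "\<bar>sol x\<bar> * chi2_kernel d x \<le> 1 - chi2_cdf d x"
    unfolding e 3 abs_le_iff using 4 rmean_minus_headint_le[OF assms] headint_le_rmean[OF assms] by argo
qed

lemma sol_low: "x \<le> lo \<Longrightarrow> sol x = (1 - rmean) * stein0 d x"
  by (simp add: sol_def tailint_low)

text \<open>Below the mean d the first of the two kernel bounds is used, above it the second; on
  each side the relevant tail is at most the kernel. The constant 1 serves all dimensions.\<close>

lemma sol_le_1:
  assumes "x \<ge> 0" shows "\<bar>sol x\<bar> \<le> 1"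
proof (cases "x = 0")
  case True
  have "(1 - rmean) * stein0 d 0 \<le> 1 * 1"
    using rmean_bounds stein0_le_1[OF d, of 0] stein0_nonneg[of 0 d] by (intro mult_mono) auto
  then show ?thesis using True sol_low[of 0] lo_pos rmean_bounds stein0_nonneg[of 0 d] by simp
next
  case False
  with assms have x: "x > 0" by simp
  have K: "chi2_kernel d x > 0" using chi2_kernel_pos[OF d x] .
  have "\<bar>sol x\<bar> * chi2_kernel d x \<le> 1 * chi2_kernel d x"
    using sol_kernel_bounds[OF x] chi2_cdf_le_kernel[OF d, of x] chi2_cdf_compl_le_kernel[OF d, of x] x
    by (cases "x \<le> real d") auto
  then show ?thesis using K by (simp only: mult_le_cancel_right_pos)
qed

lemma sol_drift_le_1:
  assumes "x > 0" shows "\<bar>2 * (real d - x) * sol x\<bar> \<le> 1"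
proof -
  have K: "chi2_kernel d x > 0" using chi2_kernel_pos[OF d assms] .
  have "\<bar>2 * (real d - x) * sol x\<bar> * chi2_kernel d x = 2 * \<bar>real d - x\<bar> * (\<bar>sol x\<bar> * chi2_kernel d x)"
    by (simp only: abs_mult abs_numeral mult.assoc)
  also have "\<dots> \<le> 1 * chi2_kernel d x"
  proof (cases "x \<le> real d")
    case True
    have "2 * \<bar>real d - x\<bar> * (\<bar>sol x\<bar> * chi2_kernel d x) \<le> 2 * \<bar>real d - x\<bar> * chi2_cdf d x"
      by (intro mult_left_mono sol_kernel_bounds assms) auto
    also have "\<dots> \<le> chi2_kernel d x" using chi2_cdf_kernel_low[OF d, of x] True assms by simp
    finally show ?thesis by simp
  next
    case False
    have "2 * \<bar>real d - x\<bar> * (\<bar>sol x\<bar> * chi2_kernel d x) \<le> 2 * \<bar>real d - x\<bar> * (1 - chi2_cdf d x)"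
      by (intro mult_left_mono sol_kernel_bounds assms) auto
    also have "\<dots> \<le> chi2_kernel d x" using chi2_cdf_kernel_high[OF d, of x] False by simp
    finally show ?thesis by simp
  qed
  finally show ?thesis using K by (simp only: mult_le_cancel_right_pos)
qed

lemma sol_ode: "x > 0 \<Longrightarrow> 4 * x * sol' x = ramp x - rmean - 2 * (real d - x) * sol x"
  by (simp add: sol'_def)

lemma sol'_le:
  assumes "x > 0" shows "\<bar>4 * x * sol' x\<bar> \<le> 2"
  using sol_drift_le_1[OF assms] ramp_bounds[of x] rmean_bounds unfolding sol_ode[OF assms] by linarith

lemma DERIV_sol:
  assumes "x > 0" shows "(sol has_real_derivative sol' x) (at x)"
proof -
  define K where "K = chi2_kernel d x"
  have K: "K > 0" using chi2_kernel_pos[OF d assms] by (simp add: K_def)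
  have D: "chi2_density d x = K / (4 * x)" using chi2_density_kernel[OF assms] by (simp add: K_def)
  have "(sol has_real_derivative (1 - rmean) * stein1 d x -
      ((1 - ramp x) * chi2_density d x * K - tailint x * (2 * (real d - x) * chi2_density d x)) / (K * K)) (at x)"
    unfolding sol_def[abs_def] K_def
    by (intro derivative_intros DERIV_cmult DERIV_stein0 DERIV_divide DERIV_tailint DERIV_chi2_kernel assms)
       (use K K_def in auto)
  also have "(1 - rmean) * stein1 d x -
      ((1 - ramp x) * chi2_density d x * K - tailint x * (2 * (real d - x) * chi2_density d x)) / (K * K) = sol' x"
  proof -
    have m: "4 * x * stein1 d x = 1 - 2 * (real d - x) * stein0 d x"
      using stein0_ode[OF d, of x] by linarith
    define J where "J = tailint x / K"
    have J: "tailint x = J * K" using K by (simp add: J_def)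
    have "((1 - ramp x) * chi2_density d x * K - tailint x * (2 * (real d - x) * chi2_density d x)) / (K * K)
        = ((1 - ramp x) - 2 * (real d - x) * J) / (4 * x)"
      unfolding D J using K assms by (simp add: field_simps)
    moreover have "stein1 d x = (1 - 2 * (real d - x) * stein0 d x) / (4 * x)"
      using m assms by (simp add: field_simps)
    moreover have "sol x = (1 - rmean) * stein0 d x - J" by (simp add: sol_def J_def K_def)
    moreover have "(1 - rmean) * ((1 - 2 * (real d - x) * stein0 d x) / (4 * x)) - ((1 - ramp x) - 2 * (real d - x) * J) / (4 * x)
      = (ramp x - rmean - 2 * (real d - x) * ((1 - rmean) * stein0 d x - J)) / (4 * x)"
      unfolding times_divide_eq_right diff_divide_distrib[symmetric]
      by (rule arg_cong[where f = "\<lambda>u. u / (4 * x)"]) (simp add: algebra_simps)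
    ultimately show ?thesis unfolding sol'_def by presburger
  qed
  finally show ?thesis .
qed

lemma sol'_low:
  assumes "0 < x" "x \<le> lo" shows "sol' x = (1 - rmean) * stein1 d x"
proof -
  have "4 * x * sol' x = (1 - rmean) * (1 - 2 * (real d - x) * stein0 d x)"
    unfolding sol_ode[OF assms(1)] sol_low[OF assms(2)] ramp_low[OF assms(2)] by (simp add: algebra_simps)
  also have "1 - 2 * (real d - x) * stein0 d x = 4 * x * stein1 d x"
    using stein0_ode[OF d, of x] by linarith
  finally show ?thesis using assms by simp
qed

lemma stein12_le_1:
  assumes "0 \<le> x" "x \<le> 1"
  shows "\<bar>(1 - rmean) * stein0 d x\<bar> \<le> 1" "\<bar>(1 - rmean) * stein1 d x\<bar> \<le> 1" "\<bar>(1 - rmean) * stein2 d x\<bar> \<le> 1"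
proof -
  have *: "\<bar>(1 - rmean) * y\<bar> \<le> 1" if "0 \<le> y" "y \<le> 1" for y
    using mult_mono[of "1 - rmean" 1 y 1] that rmean_bounds by simp
  note s = stein0_le_1[OF d assms] stein1_bounds[OF assms(1), of d] stein2_bounds[OF assms(1), of d] stein0_nonneg[OF assms(1), of d]
  show "\<bar>(1 - rmean) * stein0 d x\<bar> \<le> 1" "\<bar>(1 - rmean) * stein1 d x\<bar> \<le> 1" "\<bar>(1 - rmean) * stein2 d x\<bar> \<le> 1"
    by (rule *; use s in linarith)+
qed

lemma sol_equation:
  assumes "x \<ge> 0"
  shows "ramp x - rmean = 4 * (x * sol' x) + 2 * (real d - x) * sol x"
proof (cases "x = 0")
  case True
  then show ?thesis using stein0_ode[OF d, of 0] lo_pos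
    by (simp add: sol_low ramp_low) 
next
  case False
  then show ?thesis using sol_ode[of x] assms by simp
qed

subsection \<open>Remainder of the second-order expansion\<close>

text \<open>Let \<phi>' = \<open>sol\<close>. The function w to \<phi>(|w|^2) has gradient 2
  sol(|w|^2) w, and this is its Hessian form in direction D, with x = |w|^2, y = <w, D> and e =
  |D|^2. The trace of that Hessian minus <w, gradient> is the Stein operator.\<close>

definition hess :: "real \<Rightarrow> real \<Rightarrow> real \<Rightarrow> real" where
  "hess x y e = 2 * sol x * e + 4 * sol' x * y\<^sup>2"

text \<open>With G the gradient above, this is <D, G(w + D) - G(w)> minus the Hessian form at w: x +
  2 y + e is |w + D|^2, and y + e is <w + D, D>.\<close>

definition remainder :: "real \<Rightarrow> real \<Rightarrow> real \<Rightarrow> real" where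
  "remainder x y e = 2 * sol (x + 2 * y + e) * (y + e) - 2 * sol x * y - hess x y e"

text \<open>Here a = |w|, b = |D| and y = <w, D>; the two recurring expressions are |w + u D|^2 and
  <w + u D, D>. Cauchy-Schwarz enters as the hypothesis on y, so the whole analysis is carried out
  with scalars.\<close>

lemma segment_bounds:
  fixes a b u y :: real
  assumes "0 \<le> a" "0 \<le> b" "\<bar>y\<bar> \<le> a * b" "0 \<le> u" "u \<le> 1"
  shows "(a - u * b)\<^sup>2 \<le> a\<^sup>2 + 2 * u * y + u\<^sup>2 * b\<^sup>2"
    and "a\<^sup>2 + 2 * u * y + u\<^sup>2 * b\<^sup>2 \<le> (a + u * b)\<^sup>2"
    and "\<bar>y + u * b\<^sup>2\<bar> \<le> b * (a + b)"
    and "\<bar>a\<^sup>2 + 2 * u * y + u\<^sup>2 * b\<^sup>2 - a\<^sup>2\<bar> \<le> 2 * a * b + b\<^sup>2"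
    and "(y + u * b\<^sup>2)\<^sup>2 \<le> (a\<^sup>2 + 2 * u * y + u\<^sup>2 * b\<^sup>2) * b\<^sup>2"
    and "\<bar>(y + u * b\<^sup>2)\<^sup>2 - y\<^sup>2\<bar> \<le> b\<^sup>2 * (2 * a * b + b\<^sup>2)"
proof -
  have y: "- (a * b) \<le> y" "y \<le> a * b" using assms(3) by auto
  have uy: "u * y \<le> u * (a * b)" "u * (- (a * b)) \<le> u * y"
    by (intro mult_left_mono y assms(4))+
  show "(a - u * b)\<^sup>2 \<le> a\<^sup>2 + 2 * u * y + u\<^sup>2 * b\<^sup>2" "a\<^sup>2 + 2 * u * y + u\<^sup>2 * b\<^sup>2 \<le> (a + u * b)\<^sup>2"
    using uy by (simp_all add: power2_sum power2_diff power_mult_distrib algebra_simps)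
  have ub: "u * b\<^sup>2 \<le> 1 * b\<^sup>2" "0 \<le> u * b\<^sup>2"
    by (intro mult_right_mono mult_nonneg_nonneg zero_le_power2 assms)+
  show "\<bar>y + u * b\<^sup>2\<bar> \<le> b * (a + b)"
    using ub assms(3) by (simp add: power2_eq_square algebra_simps)
  have "\<bar>u * y\<bar> \<le> 1 * (a * b)" unfolding abs_mult using assms by (intro mult_mono) auto
  moreover have "u\<^sup>2 * b\<^sup>2 \<le> 1 * b\<^sup>2" "0 \<le> u\<^sup>2 * b\<^sup>2"
    by (intro mult_right_mono mult_nonneg_nonneg zero_le_power2 power_le_one assms)+
  ultimately show "\<bar>a\<^sup>2 + 2 * u * y + u\<^sup>2 * b\<^sup>2 - a\<^sup>2\<bar> \<le> 2 * a * b + b\<^sup>2"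
    using abs_triangle_ineq[of "2 * (u * y)" "u\<^sup>2 * b\<^sup>2"] by (simp add: abs_mult mult.assoc)
  have y2: "y\<^sup>2 \<le> a\<^sup>2 * b\<^sup>2" using assms(3) abs_le_square_iff[of y "a * b"] assms by (simp add: power_mult_distrib)
  then show "(y + u * b\<^sup>2)\<^sup>2 \<le> (a\<^sup>2 + 2 * u * y + u\<^sup>2 * b\<^sup>2) * b\<^sup>2"
    by (simp add: power2_sum power_mult_distrib algebra_simps)
  have "(y + u * b\<^sup>2)\<^sup>2 - y\<^sup>2 = (u * b\<^sup>2) * (2 * y + u * b\<^sup>2)"
    by (simp add: power2_sum power_mult_distrib algebra_simps power2_eq_square)
  moreover have "\<bar>2 * y + u * b\<^sup>2\<bar> \<le> 2 * a * b + b\<^sup>2" using ub y by (simp add: abs_le_iff)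
  ultimately show "\<bar>(y + u * b\<^sup>2)\<^sup>2 - y\<^sup>2\<bar> \<le> b\<^sup>2 * (2 * a * b + b\<^sup>2)"
    using ub by (auto simp: abs_mult intro!: mult_mono)
qed

text \<open>The whole segment stays in the ball of radius \<epsilon>, where the ramp is 1 and the
  solution is a multiple of \<open>stein0\<close>. Two mean value steps express the remainder
  through the third derivative \<open>f3\<close>, which is at most 12 b^3 + 8 b^3.\<close>

lemma remainder_near:
  assumes "0 \<le> a" "0 \<le> b" "\<bar>y\<bar> \<le> a * b" "a \<le> \<epsilon> / 2" "b \<le> \<epsilon> / 4"
  shows "\<bar>remainder (a\<^sup>2) y (b\<^sup>2)\<bar> \<le> 20 * b ^ 3"
proof -
  define c where "c = 1 - rmean"
  define X where "X = (\<lambda>u. a\<^sup>2 + 2 * u * y + u\<^sup>2 * b\<^sup>2)"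
  define Y where "Y = (\<lambda>u. y + u * b\<^sup>2)"
  have X: "0 \<le> X u" "X u \<le> \<epsilon>\<^sup>2" if "0 \<le> u" "u \<le> 1" for u
  proof -
    have "(a - u * b)\<^sup>2 \<le> X u" unfolding X_def by (rule segment_bounds) (use assms that in auto)
    then show "0 \<le> X u" using order_trans[OF zero_le_power2] by blast
    have "X u \<le> (a + u * b)\<^sup>2" unfolding X_def by (rule segment_bounds) (use assms that in auto)
    also have "u * b \<le> 1 * b" using assms that by (intro mult_right_mono) auto
    then have "(a + u * b)\<^sup>2 \<le> \<epsilon>\<^sup>2" using assms that eps by (intro power_mono) auto
    finally show "X u \<le> \<epsilon>\<^sup>2" .
  qed
  have elo: "\<epsilon>\<^sup>2 \<le> lo" unfolding lo_def using eps r by (intro power_mono) auto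
  have e1: "\<epsilon>\<^sup>2 \<le> 1" using eps by (intro power_le_one) auto
  have dX: "(X has_real_derivative 2 * Y u) (at u)" for u
    unfolding X_def Y_def by (auto intro!: derivative_eq_intros simp: algebra_simps)
  have dY: "(Y has_real_derivative b\<^sup>2) (at u)" for u
    unfolding Y_def by (auto intro!: derivative_eq_intros)
  define f1 where "f1 = (\<lambda>u. 2 * (c * stein0 d (X u)) * Y u)"
  define f2 where "f2 = (\<lambda>u. 2 * (c * stein0 d (X u)) * b\<^sup>2 + 4 * (c * stein1 d (X u)) * (Y u)\<^sup>2)"
  define f3 where "f3 = (\<lambda>u. 12 * (c * stein1 d (X u)) * Y u * b\<^sup>2 + 8 * (c * stein2 d (X u)) * (Y u)^3)"
  have d0: "((\<lambda>u. stein0 d (X u)) has_real_derivative stein1 d (X u) * (2 * Y u)) (at u)" for u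
    by (rule DERIV_chain2[OF DERIV_stein0 dX])
  have d1: "((\<lambda>u. stein1 d (X u)) has_real_derivative stein2 d (X u) * (2 * Y u)) (at u)" for u
    by (rule DERIV_chain2[OF DERIV_stein1 dX])
  have D1: "(f1 has_real_derivative f2 u) (at u)" for u
    unfolding f1_def f2_def
    by (rule derivative_eq_intros d0 dY refl)+ (simp add: power2_eq_square algebra_simps)
  have D2: "(f2 has_real_derivative f3 u) (at u)" for u
    unfolding f2_def f3_def
    by (rule derivative_eq_intros d0 d1 dY refl)+ (simp add: power2_eq_square power3_eq_cube algebra_simps)
  obtain u where u: "0 < u" "u < 1" "f1 1 - f1 0 = f2 u"
    using MVT2[of 0 1 f1 f2] D1 by auto
  obtain v where v: "0 < v" "v < u" "f2 u - f2 0 = u * f3 v"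
    using MVT2[of 0 u f2 f3] D2 u by auto
  have solX: "sol (X u) = c * stein0 d (X u)" if "0 \<le> u" "u \<le> 1" for u
    using sol_low[of "X u"] X[OF that] elo by (simp add: c_def)
  have X1: "X 1 = a\<^sup>2 + 2 * y + b\<^sup>2" "X 0 = a\<^sup>2" by (simp_all add: X_def)
  have Y1: "Y 1 = y + b\<^sup>2" "Y 0 = y" by (simp_all add: Y_def)
  \<comment> \<open>For a = 0 the value of \<open>sol'\<close> is the conventional 0, but then y = 0
    as well.\<close>
  have "4 * sol' (X 0) * (Y 0)\<^sup>2 = 4 * (c * stein1 d (X 0)) * (Y 0)\<^sup>2"
  proof (cases "a = 0")
    case True then show ?thesis using assms(3) by (simp add: Y_def)
  next
    case False
    then have "X 0 > 0" by (simp add: X_def)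
    then show ?thesis using sol'_low[of "X 0"] X[of 0] elo by (simp add: c_def)
  qed
  then have "hess (a\<^sup>2) y (b\<^sup>2) = f2 0"
    unfolding hess_def f2_def using solX[of 0] by (simp add: X1 Y1)
  moreover have "2 * sol (a\<^sup>2 + 2 * y + b\<^sup>2) * (y + b\<^sup>2) = f1 1" "2 * sol (a\<^sup>2) * y = f1 0"
    unfolding f1_def using solX[of 1] solX[of 0] by (simp_all add: X1 Y1)
  ultimately have "remainder (a\<^sup>2) y (b\<^sup>2) = u * f3 v"
    unfolding remainder_def using u v by simp
  moreover have "\<bar>u * f3 v\<bar> \<le> 1 * (20 * b ^ 3)"
    unfolding abs_mult
  proof (intro mult_mono)
    have v1: "0 \<le> v" "v \<le> 1" using u v by auto
    have "\<bar>Y v\<bar> \<le> b * (a + b)" unfolding Y_def by (rule segment_bounds) (use assms v1 in auto)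
    also have "\<dots> \<le> b * 1" using assms eps by (intro mult_left_mono) auto
    finally have Yb: "\<bar>Y v\<bar> \<le> b" by simp
    have s: "\<bar>c * stein1 d (X v)\<bar> \<le> 1" "\<bar>c * stein2 d (X v)\<bar> \<le> 1"
      using stein12_le_1[of "X v"] X[OF v1] e1 by (auto simp: c_def)
    have "\<bar>f3 v\<bar> \<le> \<bar>12 * (c * stein1 d (X v)) * Y v * b\<^sup>2\<bar> + \<bar>8 * (c * stein2 d (X v)) * (Y v)^3\<bar>"
      unfolding f3_def by (rule abs_triangle_ineq)
    also have "\<dots> = 12 * \<bar>c * stein1 d (X v)\<bar> * \<bar>Y v\<bar> * b\<^sup>2 + 8 * \<bar>c * stein2 d (X v)\<bar> * \<bar>Y v\<bar>^3"
      by (simp add: abs_mult power_abs)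
    also have "\<dots> \<le> 12 * 1 * b * b\<^sup>2 + 8 * 1 * b ^ 3"
      using s Yb assms by (intro add_mono mult_mono power_mono) auto
    finally show "\<bar>f3 v\<bar> \<le> 20 * b ^ 3" by (simp add: power2_eq_square power3_eq_cube)
  qed (use u in auto)
  ultimately show ?thesis by simp
qed

text \<open>The ramp is constant on each side of its shell, and b \<le> \<epsilon>/4 keeps a segment
  that starts outside the enlarged shell from reaching it. Inside, the Lipschitz constant 1 / (hi -
  lo) is at most 1 / (2 r \<epsilon>).\<close>

lemma ramp_increment:
  assumes "0 \<le> b" "b \<le> \<epsilon> / 4" "\<epsilon> / 2 < a" "(a - b)\<^sup>2 \<le> X" "X \<le> (a + b)\<^sup>2" "\<bar>X - a\<^sup>2\<bar> \<le> 5 / 2 * (a * b)"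
  shows "\<bar>ramp X - ramp (a\<^sup>2)\<bar> \<le> 3 * b / \<epsilon> * of_bool (r - \<epsilon> / 4 \<le> a \<and> a \<le> r + 5 * \<epsilon> / 4)"
proof -
  consider "a < r - \<epsilon> / 4" | "a > r + 5 * \<epsilon> / 4" | "r - \<epsilon> / 4 \<le> a" "a \<le> r + 5 * \<epsilon> / 4" by linarith
  then show ?thesis
  proof cases
    case 1
    have "(a + b)\<^sup>2 \<le> lo" "a\<^sup>2 \<le> lo" unfolding lo_def using 1 assms eps by (auto intro!: power_mono)
    then show ?thesis using assms(1,5) eps by (simp add: ramp_low)
  next
    case 2
    have "(a - b)\<^sup>2 \<ge> hi" "a\<^sup>2 \<ge> hi" unfolding hi_def using 2 assms eps r by (auto intro!: power_mono)
    then show ?thesis using assms(1,4) eps by (simp add: ramp_high)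
  next
    case 3
    have r0: "r > 0" using eps r by linarith
    have "\<bar>ramp X - ramp (a\<^sup>2)\<bar> \<le> \<bar>X - a\<^sup>2\<bar> / (hi - lo)" by (rule ramp_lipschitz)
    also have "\<dots> \<le> (6 * (r * b)) / (2 * r * \<epsilon>)"
    proof (rule frac_le)
      \<comment> \<open>Since \<epsilon> \<le> r, the radius a is at most 9/4 r; moreover 5/2 * 9/4
        \<le> 6.\<close>
      have "5 / 2 * (a * b) \<le> 5 / 2 * ((9 / 4 * r) * b)"
        using 3 r assms by (intro mult_left_mono mult_right_mono) auto
      also have "\<dots> \<le> 6 * (r * b)" using r0 assms(1) by simp
      finally show "\<bar>X - a\<^sup>2\<bar> \<le> 6 * (r * b)" using assms(6) by linarith
      show "0 < 2 * r * \<epsilon>" using r0 eps by simp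
      show "2 * r * \<epsilon> \<le> hi - lo" unfolding hi_lo using eps by simp
      show "0 \<le> 6 * (r * b)" using r0 assms(1) by simp
    qed
    also have "\<dots> = 3 * b / \<epsilon>" using r0 by simp
    finally show ?thesis using 3 by simp
  qed
qed

text \<open>One mean value step leaves the increment of the Hessian form between two points of the
  segment. The equation replaces 4 v \<open>sol' v\<close> by ramp - mean - drift, so the only rough
  ingredient is the increment of the ramp. In dimension one y^2 / x equals b^2 all along the segment
  and no division by x survives; in higher dimension that division costs the term of order d /
  a.\<close>

lemma remainder_far:
  assumes "0 \<le> b" "\<bar>y\<bar> \<le> a * b" "\<epsilon> / 2 < a" "b \<le> \<epsilon> / 4" "d = 1 \<Longrightarrow> y\<^sup>2 = a\<^sup>2 * b\<^sup>2"
  shows "\<bar>remainder (a\<^sup>2) y (b\<^sup>2)\<bar> \<le> b ^ 3 * (3 / \<epsilon> * of_bool (r - \<epsilon> / 4 \<le> a \<and> a \<le> r + 5 * \<epsilon> / 4)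
     + 15 / 2 * a + of_bool (d \<ge> 2) * (60 * real d / a))"
proof -
  \<comment> \<open>By b \<le> a / 2 the squared radius stays above x / 4 on the segment, so the
    weights 1 / v are at most 4 / x.\<close>
  have a: "a > 0" "b \<le> a / 2" using assms eps by auto
  define X where "X = (\<lambda>u. a\<^sup>2 + 2 * u * y + u\<^sup>2 * b\<^sup>2)"
  define Y where "Y = (\<lambda>u. y + u * b\<^sup>2)"
  have X: "a\<^sup>2 / 4 \<le> X u" "(a - b)\<^sup>2 \<le> X u" "X u \<le> (a + b)\<^sup>2" if "0 \<le> u" "u \<le> 1" for u
  proof -
    have ub: "u * b \<le> 1 * b" "0 \<le> u * b" by (intro mult_right_mono mult_nonneg_nonneg assms that)+
    have 1: "(a - u * b)\<^sup>2 \<le> X u" unfolding X_def by (rule segment_bounds) (use assms a that in auto)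
    have "(a / 2)\<^sup>2 \<le> (a - u * b)\<^sup>2" "(a - b)\<^sup>2 \<le> (a - u * b)\<^sup>2" using a ub by (auto intro!: power_mono)
    then show "a\<^sup>2 / 4 \<le> X u" "(a - b)\<^sup>2 \<le> X u" using 1 by (auto simp: power_divide)
    have "X u \<le> (a + u * b)\<^sup>2" unfolding X_def by (rule segment_bounds) (use assms a that in auto)
    also have "\<dots> \<le> (a + b)\<^sup>2" using a ub assms by (intro power_mono) auto
    finally show "X u \<le> (a + b)\<^sup>2" .
  qed
  have a4: "a\<^sup>2 / 4 > 0" using a by simp
  have Xp: "0 < X u" if "0 \<le> u" "u \<le> 1" for u using X(1)[OF that] a4 by linarith
  have dX: "(X has_real_derivative 2 * Y u) (at u)" for u
    unfolding X_def Y_def by (auto intro!: derivative_eq_intros simp: algebra_simps)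
  have dY: "(Y has_real_derivative b\<^sup>2) (at u)" for u
    unfolding Y_def by (auto intro!: derivative_eq_intros)
  have D1: "((\<lambda>u. 2 * sol (X u) * Y u) has_real_derivative hess (X u) (Y u) (b\<^sup>2)) (at u)" if "0 \<le> u" "u \<le> 1" for u
  proof -
    have "((\<lambda>u. sol (X u)) has_real_derivative sol' (X u) * (2 * Y u)) (at u)"
      by (rule DERIV_chain2[OF DERIV_sol[OF Xp[OF that]] dX])
    then show ?thesis unfolding hess_def
      by (auto intro!: derivative_eq_intros dY simp: power2_eq_square algebra_simps)
  qed
  obtain u where u: "0 < u" "u < 1"
      "2 * sol (X 1) * Y 1 - 2 * sol (X 0) * Y 0 = (1 - 0) * hess (X u) (Y u) (b\<^sup>2)"
    using MVT2[of 0 1 "\<lambda>u. 2 * sol (X u) * Y u" "\<lambda>u. hess (X u) (Y u) (b\<^sup>2)"] D1 by auto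
  have rem: "remainder (a\<^sup>2) y (b\<^sup>2) = hess (X u) (Y u) (b\<^sup>2) - hess (a\<^sup>2) y (b\<^sup>2)"
    using u(3) by (simp add: remainder_def X_def Y_def)
  have u01: "0 \<le> u" "u \<le> 1" using u by auto
  define x z w where "x = a\<^sup>2" and "z = X u" and "w = Y u"
  have x0: "x > 0" "z > 0" using a Xp[OF u01] by (auto simp: x_def z_def)
  have z4: "x / 4 \<le> z" using X(1)[OF u01] by (simp add: x_def z_def)
  have bb: "b\<^sup>2 \<le> 1 / 2 * (a * b)"
    using mult_right_mono[OF a(2) assms(1)] by (simp add: power2_eq_square)
  have zx: "\<bar>z - x\<bar> \<le> 5 / 2 * (a * b)"
    using segment_bounds(4)[of a b y u] assms a u01 bb unfolding z_def X_def x_def by auto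
  have wz: "w\<^sup>2 \<le> z * b\<^sup>2"
    unfolding w_def Y_def z_def X_def by (rule segment_bounds) (use assms a u01 in auto)
  have ab: "0 \<le> a * b" using a assms by simp
  have wy: "\<bar>w\<^sup>2 - y\<^sup>2\<bar> \<le> b\<^sup>2 * (5 / 2 * (a * b))"
  proof -
    have "\<bar>w\<^sup>2 - y\<^sup>2\<bar> \<le> b\<^sup>2 * (2 * a * b + b\<^sup>2)"
      unfolding w_def Y_def by (rule segment_bounds) (use assms a u01 in auto)
    also have "\<dots> \<le> b\<^sup>2 * (5 / 2 * (a * b))" using bb by (intro mult_left_mono) auto
    finally show ?thesis .
  qed
  define R where "R = 3 * b / \<epsilon> * of_bool (r - \<epsilon> / 4 \<le> a \<and> a \<le> r + 5 * \<epsilon> / 4)"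
  have R: "\<bar>ramp z - ramp x\<bar> \<le> R" unfolding R_def x_def
    by (rule ramp_increment) (use assms a X[OF u01] zx in \<open>auto simp: z_def x_def\<close>)
  have R0: "0 \<le> R" using R by linarith
  have H: "hess v s (b\<^sup>2) = 2 * sol v * b\<^sup>2 + (ramp v - rmean - 2 * (real d - v) * sol v) * (s\<^sup>2 / v)" if "v > 0" for v s
    using that unfolding hess_def sol_ode[OF that, symmetric] by simp
  have goal: "b ^ 3 * (3 / \<epsilon> * of_bool (r - \<epsilon> / 4 \<le> a \<and> a \<le> r + 5 * \<epsilon> / 4)
     + 15 / 2 * a + of_bool (d \<ge> 2) * (60 * real d / a)) =
     b\<^sup>2 * R + 15 / 2 * a * b ^ 3 + of_bool (d \<ge> 2) * (60 * real d * b ^ 3 / a)"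
    by (simp add: R_def power2_eq_square power3_eq_cube algebra_simps)
  have x4: "v \<in> {x / 4..} \<Longrightarrow> v > 0" for v using x0 by auto
  have lip: "\<bar>f z - f x\<bar> \<le> B * \<bar>z - x\<bar>"
    if "\<And>v. v \<ge> x / 4 \<Longrightarrow> (f has_real_derivative f' v) (at v)" "\<And>v. v \<ge> x / 4 \<Longrightarrow> \<bar>f' v\<bar> \<le> B" for f f' B
    using field_differentiable_bound[of "{x / 4..}" f f' B z x] that z4 x0
    by (auto simp: has_field_derivative_at_within)
  have s': "\<bar>v * sol' v\<bar> \<le> 1 / 2" if "v > 0" for v
    using sol'_le[OF that] by (simp add: abs_mult)
  show ?thesis
  proof (cases "d = 1")
    case True
    then have "y\<^sup>2 = x * b\<^sup>2" using assms(5) by (simp add: x_def)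
    then have y2: "y\<^sup>2 / x = b\<^sup>2" using x0 by simp
    have "w\<^sup>2 = z * b\<^sup>2" using assms(5)[OF True]
      by (simp add: w_def Y_def z_def X_def power2_sum power_mult_distrib algebra_simps power2_eq_square)
    then have w2: "w\<^sup>2 / z = b\<^sup>2" using x0 by simp
    have "real d = 1" using True by simp
    \<comment> \<open>For d = 1 the form at v is b^2 times ramp v - rmean + 2 v sol v: the term 2
      sol of the Hessian cancels the part of the drift that would be singular after division by
      v.\<close>
    have e: "remainder (a\<^sup>2) y (b\<^sup>2) = b\<^sup>2 * ((ramp z - ramp x) + 2 * (z * sol z - x * sol x))"
      unfolding rem unfolding z_def[symmetric] w_def[symmetric] x_def[symmetric] H[OF x0(1)] H[OF x0(2)] y2 w2
      using \<open>real d = 1\<close> by (simp add: algebra_simps)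
    have "\<bar>z * sol z - x * sol x\<bar> \<le> 3 / 2 * \<bar>z - x\<bar>"
    proof (rule lip[where f' = "\<lambda>v. sol v + v * sol' v"])
      fix v assume v: "v \<ge> x / 4"
      then have v0: "v > 0" using x0 by linarith
      show "((\<lambda>v. v * sol v) has_real_derivative sol v + v * sol' v) (at v)"
        by (auto intro!: derivative_eq_intros DERIV_sol v0)
      show "\<bar>sol v + v * sol' v\<bar> \<le> 3 / 2"
        using sol_le_1[of v] s'[OF v0] v0 by linarith
    qed
    then have "\<bar>(ramp z - ramp x) + 2 * (z * sol z - x * sol x)\<bar> \<le> R + 15 / 2 * (a * b)"
      using R zx abs_triangle_ineq[of "ramp z - ramp x" "2 * (z * sol z - x * sol x)"]
      by (simp only: abs_mult abs_numeral) argo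
    then have "\<bar>remainder (a\<^sup>2) y (b\<^sup>2)\<bar> \<le> b\<^sup>2 * (R + 15 / 2 * (a * b))"
      unfolding e abs_mult by (simp add: mult_left_mono)
    also have "\<dots> = b\<^sup>2 * R + 15 / 2 * a * b ^ 3"
      by (simp add: power2_eq_square power3_eq_cube algebra_simps)
    finally show ?thesis unfolding goal using True by simp
  next
    case False
    then have d2: "d \<ge> 2" using d by simp
    have drift: "\<bar>2 * (real d - z) * sol z - 2 * (real d - x) * sol x\<bar> \<le> (3 + 4 * real d / x) * \<bar>z - x\<bar>"
    proof (rule lip[where f' = "\<lambda>v. 2 * (real d - v) * sol' v - 2 * sol v"])
      fix v assume v: "v \<ge> x / 4"
      then have v0: "v > 0" using x0 by linarith
      show "((\<lambda>v. 2 * (real d - v) * sol v) has_real_derivative 2 * (real d - v) * sol' v - 2 * sol v) (at v)"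
        by (auto intro!: derivative_eq_intros DERIV_sol v0)
      have "\<bar>sol' v\<bar> \<le> 1 / (2 * v)" using s'[OF v0] v0 by (simp add: abs_mult field_simps)
      also have "\<dots> \<le> 2 / x" using v v0 x0 by (simp add: field_simps)
      finally have "\<bar>2 * real d * sol' v\<bar> \<le> 4 * real d / x"
        using mult_left_mono[of "\<bar>sol' v\<bar>" "2 / x" "2 * real d"] by (simp add: abs_mult)
      moreover have "2 * (real d - v) * sol' v - 2 * sol v = 2 * real d * sol' v - 2 * (v * sol' v) - 2 * sol v"
        by (simp add: algebra_simps)
      ultimately show "\<bar>2 * (real d - v) * sol' v - 2 * sol v\<bar> \<le> 3 + 4 * real d / x"
        using sol_le_1[of v] s'[OF v0] v0 by linarith
    qed
    have ps: "\<bar>sol z - sol x\<bar> \<le> 2 / x * \<bar>z - x\<bar>"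
    proof (rule lip[where f' = sol'])
      fix v assume v: "v \<ge> x / 4"
      then have v0: "v > 0" using x0 by linarith
      show "(sol has_real_derivative sol' v) (at v)" by (rule DERIV_sol[OF v0])
      have "\<bar>sol' v\<bar> \<le> 1 / (2 * v)" using s'[OF v0] v0 by (simp add: abs_mult field_simps)
      also have "\<dots> \<le> 2 / x" using v v0 x0 by (simp add: field_simps)
      finally show "\<bar>sol' v\<bar> \<le> 2 / x" .
    qed
    define q where "q = (\<lambda>v. ramp v - rmean - 2 * (real d - v) * sol v)"
    have q2: "\<bar>q x\<bar> \<le> 2" using sol'_le[OF x0(1)] by (simp add: q_def sol_ode x0)
    have abs3: "\<bar>A + B * B' + C * C'\<bar> \<le> \<bar>A\<bar> + \<bar>B\<bar> * \<bar>B'\<bar> + \<bar>C\<bar> * \<bar>C'\<bar>" for A B B' C C' :: real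
      unfolding abs_mult[symmetric] by linarith
    \<comment> \<open>Increment of a product: \<open>q v\<close> is 4 v \<open>sol' v\<close>, and
      the accompanying ratio is the squared inner product over v.\<close>
    have e: "remainder (a\<^sup>2) y (b\<^sup>2) = 2 * b\<^sup>2 * (sol z - sol x) + (q z - q x) * (w\<^sup>2 / z) + q x * (w\<^sup>2 / z - y\<^sup>2 / x)"
      unfolding rem unfolding z_def[symmetric] w_def[symmetric] x_def[symmetric] H[OF x0(1)] H[OF x0(2)] q_def
      by (simp add: algebra_simps)
    have e2: "\<bar>2 * b\<^sup>2 * (sol z - sol x)\<bar> = 2 * b\<^sup>2 * \<bar>sol z - sol x\<bar>"
      by (simp only: abs_mult abs_numeral abs_power2)
    have "\<bar>remainder (a\<^sup>2) y (b\<^sup>2)\<bar> \<le> 2 * b\<^sup>2 * \<bar>sol z - sol x\<bar> + \<bar>q z - q x\<bar> * \<bar>w\<^sup>2 / z\<bar> + \<bar>q x\<bar> * \<bar>w\<^sup>2 / z - y\<^sup>2 / x\<bar>"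
      unfolding e e2[symmetric] by (rule abs3)
    also have "\<dots> \<le> 10 * b ^ 3 / a + (R + (15 / 2 * (a * b) + 10 * real d * b / a)) * b\<^sup>2 + 2 * (20 * b ^ 3 / a)"
    proof (intro add_mono mult_mono)
      have "2 * b\<^sup>2 * \<bar>sol z - sol x\<bar> \<le> 2 * b\<^sup>2 * (2 / x * (5 / 2 * (a * b)))"
        using ps zx x0 by (intro mult_left_mono order_trans[OF ps] mult_left_mono) auto
      also have "\<dots> = 10 * b ^ 3 / a"
        using a by (simp add: x_def power2_eq_square power3_eq_cube)
      finally show "2 * b\<^sup>2 * \<bar>sol z - sol x\<bar> \<le> 10 * b ^ 3 / a" .
      have "\<bar>q z - q x\<bar> \<le> R + (3 + 4 * real d / x) * \<bar>z - x\<bar>"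
        unfolding q_def using R drift by linarith
      also have "(3 + 4 * real d / x) * \<bar>z - x\<bar> \<le> (3 + 4 * real d / x) * (5 / 2 * (a * b))"
        using zx x0 by (intro mult_left_mono) auto
      also have "\<dots> = 15 / 2 * (a * b) + 10 * real d * b / a"
        using a by (simp add: x_def power2_eq_square algebra_simps)
      finally show "\<bar>q z - q x\<bar> \<le> R + (15 / 2 * (a * b) + 10 * real d * b / a)" by simp
      show "\<bar>w\<^sup>2 / z\<bar> \<le> b\<^sup>2" using wz x0 by (simp add: pos_divide_le_eq mult.commute)
      show "\<bar>q x\<bar> \<le> 2" by (rule q2)
      have "w\<^sup>2 / z - y\<^sup>2 / x = (w\<^sup>2 - y\<^sup>2) / z + y\<^sup>2 * (x - z) / (x * z)"
        using x0 by (simp add: field_simps)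
      moreover have "\<bar>(w\<^sup>2 - y\<^sup>2) / z\<bar> \<le> (b\<^sup>2 * (5 / 2 * (a * b))) / (x / 4)"
        unfolding abs_divide using wy z4 x0 ab by (intro frac_le) auto
      moreover have "\<bar>y\<^sup>2 * (x - z) / (x * z)\<bar> \<le> ((x * b\<^sup>2) * (5 / 2 * (a * b))) / (x * (x / 4))"
        unfolding abs_divide
      proof (rule frac_le)
        have "y\<^sup>2 \<le> x * b\<^sup>2" using assms(2) abs_le_square_iff[of y "a * b"] ab by (simp add: x_def power_mult_distrib)
        then show "\<bar>y\<^sup>2 * (x - z)\<bar> \<le> (x * b\<^sup>2) * (5 / 2 * (a * b))"
          unfolding abs_mult abs_minus_commute[of x z] using zx x0 by (intro mult_mono) auto
        show "x * (x / 4) \<le> \<bar>x * z\<bar>" using z4 x0 by simp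
      qed (use x0 ab in auto)
      moreover have "(b\<^sup>2 * (5 / 2 * (a * b))) / (x / 4) = 10 * b ^ 3 / a"
        using a by (simp add: x_def power2_eq_square power3_eq_cube)
      moreover have "((x * b\<^sup>2) * (5 / 2 * (a * b))) / (x * (x / 4)) = 10 * b ^ 3 / a"
        using a by (simp add: x_def power2_eq_square power3_eq_cube)
      ultimately show "\<bar>w\<^sup>2 / z - y\<^sup>2 / x\<bar> \<le> 20 * b ^ 3 / a" 
        using abs_triangle_ineq[of "(w\<^sup>2 - y\<^sup>2) / z" "y\<^sup>2 * (x - z) / (x * z)"] by linarith
    qed (use R0 ab a assms in auto)
    also have "\<dots> = b\<^sup>2 * R + 15 / 2 * a * b ^ 3 + (50 + 10 * real d) * (b ^ 3 / a)"
      using a by (simp add: field_simps power2_eq_square power3_eq_cube)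
    \<comment> \<open>The 50 collects 10 from the increment of \<open>sol\<close> and 40 from the
      increment of the ratio; 10 d comes from the drift.\<close>
    also have "(50 + 10 * real d) * (b ^ 3 / a) \<le> (60 * real d) * (b ^ 3 / a)"
      using d2 a assms by (intro mult_right_mono) auto
    finally show ?thesis unfolding goal using d2 by simp
  qed
qed

text \<open>A common majorant of both remainder bounds, per b^3: 20 serves the ball of radius
  \<epsilon>/2, the other terms its complement. The term in 1 / a is cut off below \<epsilon>/2 and
  absent for d = 1, where 1 / |W| has no finite mean in the limit.\<close>

definition excess :: "real \<Rightarrow> real" where
  "excess a = 3 / \<epsilon> * of_bool (r - \<epsilon> / 4 \<le> a \<and> a \<le> r + 5 * \<epsilon> / 4) + 20 + 15 / 2 * a
     + of_bool (d \<ge> 2 \<and> \<epsilon> / 2 < a) * (60 * real d / a)"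

lemma excess_nonneg: "0 \<le> a \<Longrightarrow> 0 \<le> excess a"
  unfolding excess_def using eps by (intro add_nonneg_nonneg mult_nonneg_nonneg) auto

lemma remainder_bound:
  assumes "0 \<le> a" "0 \<le> b" "\<bar>y\<bar> \<le> a * b" "b \<le> \<epsilon> / 4" "d = 1 \<Longrightarrow> y\<^sup>2 = a\<^sup>2 * b\<^sup>2"
  shows "\<bar>remainder (a\<^sup>2) y (b\<^sup>2)\<bar> \<le> b ^ 3 * excess a"
proof (cases "a \<le> \<epsilon> / 2")
  case True
  have "\<bar>remainder (a\<^sup>2) y (b\<^sup>2)\<bar> \<le> b ^ 3 * 20"
    using remainder_near[OF assms(1-3) True assms(4)] by simp
  also have "\<dots> \<le> b ^ 3 * excess a"
    unfolding excess_def using assms eps by (intro mult_left_mono) auto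
  finally show ?thesis .
next
  case False
  then have a: "\<epsilon> / 2 < a" by simp
  have "\<bar>remainder (a\<^sup>2) y (b\<^sup>2)\<bar> \<le> b ^ 3 * (3 / \<epsilon> * of_bool (r - \<epsilon> / 4 \<le> a \<and> a \<le> r + 5 * \<epsilon> / 4)
     + 15 / 2 * a + of_bool (d \<ge> 2) * (60 * real d / a))"
    by (rule remainder_far[OF assms(2,3) a assms(4,5)])
  also have "\<dots> \<le> b ^ 3 * excess a"
    unfolding excess_def using assms a by (intro mult_left_mono) auto
  finally show ?thesis .
qed

end

section \<open>Uniform random permutations\<close>

abbreviation swp :: "'a \<Rightarrow> 'a \<Rightarrow> 'a \<Rightarrow> 'a" where
  "swp \<equiv> Transposition.transpose"

definition perms :: "nat \<Rightarrow> (nat \<Rightarrow> nat) set" where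
  "perms n = {\<pi>. \<pi> permutes {..<n}}"

definition pavg :: "nat \<Rightarrow> ((nat \<Rightarrow> nat) \<Rightarrow> real) \<Rightarrow> real" where
  "pavg n f = (\<Sum>\<pi>\<in>perms n. f \<pi>) / fact n"

lemma finite_perms [simp]: "finite (perms n)"
  by (simp add: perms_def finite_permutations)

lemma card_perms [simp]: "card (perms n) = fact n"
  unfolding perms_def by (rule card_permutations) auto

lemma perms_less: "\<pi> \<in> perms n \<Longrightarrow> i < n \<Longrightarrow> \<pi> i < n"
  using permutes_in_image[of \<pi> "{..<n}" i] by (simp add: perms_def)

lemma sum_perms_swap:
  assumes "i < n" "j < n"
  shows "(\<Sum>\<pi>\<in>perms n. f (\<pi> \<circ> swp i j)) = (\<Sum>\<pi>\<in>perms n. f \<pi>)"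
  unfolding perms_def
  by (rule sum_permutations_compose_right[symmetric]) (use assms in \<open>auto intro: permutes_swap_id\<close>)

lemma sum_perms_image:
  assumes "\<pi> \<in> perms n"
  shows "(\<Sum>i<n. g (\<pi> i)) = (\<Sum>i<n. g i)"
  using sum.permute[of \<pi> "{..<n}" g] assms by (simp add: perms_def o_def)

lemma pavg_const [simp]: "pavg n (\<lambda>_. c) = c"
  by (simp add: pavg_def)

lemma pavg_add: "pavg n (\<lambda>\<pi>. f \<pi> + g \<pi>) = pavg n f + pavg n g"
  by (simp add: pavg_def sum.distrib add_divide_distrib)

lemma pavg_diff: "pavg n (\<lambda>\<pi>. f \<pi> - g \<pi>) = pavg n f - pavg n g"
  by (simp add: pavg_def sum_subtractf diff_divide_distrib)

lemma pavg_cmult: "pavg n (\<lambda>\<pi>. c * f \<pi>) = c * pavg n f"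
  by (simp add: pavg_def sum_distrib_left)

lemma pavg_sum: "pavg n (\<lambda>\<pi>. \<Sum>k\<in>A. f k \<pi>) = (\<Sum>k\<in>A. pavg n (f k))"
  unfolding pavg_def by (subst sum.swap) (simp add: sum_divide_distrib)

lemma pavg_mono: "(\<And>\<pi>. \<pi> \<in> perms n \<Longrightarrow> f \<pi> \<le> g \<pi>) \<Longrightarrow> pavg n f \<le> pavg n g"
  unfolding pavg_def by (intro divide_right_mono sum_mono) auto

lemma pavg_cong: "(\<And>\<pi>. \<pi> \<in> perms n \<Longrightarrow> f \<pi> = g \<pi>) \<Longrightarrow> pavg n f = pavg n g"
  unfolding pavg_def by (simp cong: sum.cong)

lemma pavg_abs: "\<bar>pavg n f\<bar> \<le> pavg n (\<lambda>\<pi>. \<bar>f \<pi>\<bar>)"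
  by (simp add: pavg_def divide_right_mono sum_abs)

lemma pavg_le_sqrt: "pavg n f \<le> sqrt (pavg n (\<lambda>\<pi>. (f \<pi>)\<^sup>2))"
proof (rule real_le_rsqrt)
  have "(\<Sum>\<pi>\<in>perms n. f \<pi>)\<^sup>2 \<le> (\<Sum>\<pi>\<in>perms n. (f \<pi>)\<^sup>2) * card (perms n)"
    by (rule sum_squared_le_sum_of_squares)
  then have "(\<Sum>\<pi>\<in>perms n. f \<pi>)\<^sup>2 / (fact n)\<^sup>2 \<le> ((\<Sum>\<pi>\<in>perms n. (f \<pi>)\<^sup>2) * fact n) / (fact n)\<^sup>2"
    by (intro divide_right_mono) auto
  then show "(pavg n f)\<^sup>2 \<le> pavg n (\<lambda>\<pi>. (f \<pi>)\<^sup>2)"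
    by (simp add: pavg_def power_divide power2_eq_square)
qed

lemma sum_square_le_card_sum:
  fixes g :: "'a \<Rightarrow> 'b \<Rightarrow> real"
  assumes "finite A" "\<And>q. q \<in> A \<Longrightarrow> (\<Sum>k\<in>I. (g q k)\<^sup>2) \<le> B"
  shows "(\<Sum>k\<in>I. (\<Sum>q\<in>A. g q k)\<^sup>2) \<le> (real (card A))\<^sup>2 * B"
proof -
  have "(\<Sum>k\<in>I. (\<Sum>q\<in>A. g q k)\<^sup>2) \<le> (\<Sum>k\<in>I. (\<Sum>q\<in>A. (g q k)\<^sup>2) * card A)"
    by (intro sum_mono sum_squared_le_sum_of_squares assms)
  also have "\<dots> = (\<Sum>q\<in>A. \<Sum>k\<in>I. (g q k)\<^sup>2) * card A"
    by (subst sum.swap) (simp add: sum_distrib_right)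
  also have "\<dots> \<le> (\<Sum>q\<in>A. B) * card A"
    by (intro mult_right_mono sum_mono assms) auto
  finally show ?thesis by (simp add: power2_eq_square mult_ac)
qed

lemma sum_square_mean_split:
  fixes f :: "'a \<Rightarrow> real" and c m :: real
  assumes "finite A" "A \<noteq> {}" "m = (\<Sum>q\<in>A. f q) / card A"
  shows "(\<Sum>q\<in>A. (f q - c)\<^sup>2) = (\<Sum>q\<in>A. (f q - m)\<^sup>2) + card A * (m - c)\<^sup>2"
proof -
  have s: "(\<Sum>q\<in>A. f q) = card A * m" using assms by simp
  have "(\<Sum>q\<in>A. (f q - c)\<^sup>2) = (\<Sum>q\<in>A. (f q - m)\<^sup>2 + (2 * (m - c) * f q + (c\<^sup>2 - m\<^sup>2)))"
    by (intro sum.cong) (auto simp: power2_eq_square algebra_simps)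
  also have "\<dots> = (\<Sum>q\<in>A. (f q - m)\<^sup>2) + (2 * (m - c) * (card A * m) + card A * (c\<^sup>2 - m\<^sup>2))"
    by (simp add: sum.distrib sum_distrib_left[symmetric] s)
  also have "2 * (m - c) * (card A * m) + card A * (c\<^sup>2 - m\<^sup>2) = card A * (m - c)\<^sup>2"
    by (simp add: power2_eq_square algebra_simps)
  finally show ?thesis .
qed

text \<open>Revealing the image of one point at a time gives a martingale whose increments are bounded by
  twice the effect of a transposition.\<close>

lemma permutation_variance:
  fixes f :: "('a \<Rightarrow> 'a) \<Rightarrow> 'b \<Rightarrow> real"
  assumes "finite S"
    and "\<And>\<pi> x y. \<pi> permutes S \<Longrightarrow> x \<in> S \<Longrightarrow> y \<in> S \<Longrightarrow> (\<Sum>k\<in>I. (f (swp x y \<circ> \<pi>) k - f \<pi> k)\<^sup>2) \<le> c"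
  shows "(\<Sum>\<pi> | \<pi> permutes S. \<Sum>k\<in>I. (f \<pi> k - (\<Sum>\<pi> | \<pi> permutes S. f \<pi> k) / fact (card S))\<^sup>2)
      \<le> fact (card S) * (4 * real (card S) * c)"
  using assms
proof (induction S arbitrary: f rule: finite_induct)
  case empty
  have "{p. p permutes ({}::'a set)} = {id}" by (auto simp: permutes_empty)
  then show ?case by simp
next
  case (insert a S)
  define P where "P = {\<pi>. \<pi> permutes S}"
  define s where "s = card S"
  have fP: "finite P" and cP: "card P = fact s" and Pne: "P \<noteq> {}"
    using insert(1) card_permutations[of S s] by (auto simp: P_def s_def finite_permutations intro: permutes_id)
  define F where "F = (\<lambda>b q. f (swp a b \<circ> q))"
  define m where "m = (\<lambda>b k. (\<Sum>q\<in>P. F b q k) / fact s)"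
  define M where "M = (\<lambda>k. (\<Sum>b\<in>insert a S. m b k) / (real s + 1))"
  have cI: "card (insert a S) = Suc s" using insert by (simp add: s_def)
  \<comment> \<open>A permutation of \<open>insert a S\<close> is \<open>swp a b\<close> after a
    permutation of S, with b the image of a. Hence \<open>F b\<close> ranges over the permutations
    with prescribed image of a.\<close>
  have split: "(\<Sum>\<pi> | \<pi> permutes insert a S. g \<pi>) = (\<Sum>b\<in>insert a S. \<Sum>q\<in>P. g (swp a b \<circ> q))" for g :: "('a \<Rightarrow> 'a) \<Rightarrow> real"
    unfolding P_def by (rule sum_over_permutations_insert) (use insert in auto)
  have M: "(\<Sum>\<pi> | \<pi> permutes insert a S. f \<pi> k) / fact (card (insert a S)) = M k" for k
    unfolding split cI by (simp add: M_def m_def F_def sum_divide_distrib[symmetric] add.commute mult.commute)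
  have IH: "(\<Sum>q\<in>P. \<Sum>k\<in>I. (F b q k - m b k)\<^sup>2) \<le> fact s * (4 * real s * c)" if b: "b \<in> insert a S" for b
    unfolding P_def m_def s_def
  proof (rule insert(3))
    fix \<pi> x y assume p: "\<pi> permutes S" "x \<in> S" "y \<in> S"
    let ?t = "swp a b"
    have xy: "?t x \<in> insert a S" "?t y \<in> insert a S" using p b by (auto simp: Transposition.transpose_def)
    \<comment> \<open>Conjugating a transposition gives a transposition, so the induction hypothesis
      applies within each fibre with the same c.\<close>
    have "?t \<circ> (swp x y \<circ> \<pi>) = swp (?t x) (?t y) \<circ> (?t \<circ> \<pi>)"
      by (auto simp: fun_eq_iff Transposition.transpose_def)
    moreover have "?t \<circ> \<pi> permutes insert a S"
      by (rule permutes_compose[OF permutes_subset[OF p(1)] permutes_swap_id]) (use b in auto)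
    ultimately show "(\<Sum>k\<in>I. (F b (swp x y \<circ> \<pi>) k - F b \<pi> k)\<^sup>2) \<le> c"
      unfolding F_def using insert(4)[OF _ xy, of "?t \<circ> \<pi>"] by presburger
  qed
  \<comment> \<open>Both \<open>F b q\<close> and \<open>F b' q\<close> are one transposition away
    from \<open>f q\<close>; the squared triangle inequality gives 2 c + 2 c.\<close>
  have diff: "(\<Sum>k\<in>I. (m b k - m b' k)\<^sup>2) \<le> 4 * c" if b: "b \<in> insert a S" "b' \<in> insert a S" for b b'
  proof -
    have "(\<Sum>k\<in>I. (\<Sum>q\<in>P. F b q k - F b' q k)\<^sup>2) \<le> (real (card P))\<^sup>2 * (4 * c)"
    proof (rule sum_square_le_card_sum[OF fP])
      fix q assume "q \<in> P"
      then have q: "q permutes insert a S" using permutes_subset[of q S "insert a S"] by (auto simp: P_def)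
      have "(\<Sum>k\<in>I. (F b q k - F b' q k)\<^sup>2) \<le> (\<Sum>k\<in>I. 2 * (F b q k - f q k)\<^sup>2 + 2 * (F b' q k - f q k)\<^sup>2)"
      proof (rule sum_mono)
        fix k
        have "0 \<le> ((F b q k - f q k) + (F b' q k - f q k))\<^sup>2" by simp
        then show "(F b q k - F b' q k)\<^sup>2 \<le> 2 * (F b q k - f q k)\<^sup>2 + 2 * (F b' q k - f q k)\<^sup>2"
          by (simp add: power2_eq_square algebra_simps)
      qed
      also have "\<dots> = 2 * (\<Sum>k\<in>I. (F b q k - f q k)\<^sup>2) + 2 * (\<Sum>k\<in>I. (F b' q k - f q k)\<^sup>2)"
        by (simp add: sum.distrib sum_distrib_left)
      also have "\<dots> \<le> 2 * c + 2 * c"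
        unfolding F_def
        by (intro add_mono mult_left_mono insert(4)[OF q insertI1 b(1)] insert(4)[OF q insertI1 b(2)]) auto
      finally show "(\<Sum>k\<in>I. (F b q k - F b' q k)\<^sup>2) \<le> 4 * c" by simp
    qed
    then have "(\<Sum>k\<in>I. (\<Sum>q\<in>P. F b q k - F b' q k)\<^sup>2) / (fact s)\<^sup>2 \<le> 4 * c"
      by (simp add: cP pos_divide_le_eq mult.commute)
    moreover have "m b k - m b' k = (\<Sum>q\<in>P. F b q k - F b' q k) / fact s" for k
      by (simp only: m_def sum_subtractf diff_divide_distrib)
    ultimately show ?thesis by (simp only: power_divide sum_divide_distrib[symmetric])
  qed
  have between: "(\<Sum>k\<in>I. (m b k - M k)\<^sup>2) \<le> 4 * c" if b: "b \<in> insert a S" for b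
  proof -
    have e: "m b k - M k = (\<Sum>b'\<in>insert a S. m b k - m b' k) / (real s + 1)" for k
      unfolding sum_subtractf M_def diff_divide_distrib by (simp add: cI add.commute)
    have "(\<Sum>k\<in>I. (\<Sum>b'\<in>insert a S. m b k - m b' k)\<^sup>2) \<le> (real (card (insert a S)))\<^sup>2 * (4 * c)"
      by (rule sum_square_le_card_sum) (use insert diff b in auto)
    then have "(\<Sum>k\<in>I. (\<Sum>b'\<in>insert a S. m b k - m b' k)\<^sup>2) / (real s + 1)\<^sup>2 \<le> 4 * c"
      by (simp only: cI) (simp add: pos_divide_le_eq mult.commute add.commute)
    then show ?thesis by (simp only: e power_divide sum_divide_distrib[symmetric])
  qed
  have "(\<Sum>q\<in>P. \<Sum>k\<in>I. (F b q k - M k)\<^sup>2) \<le> fact s * (4 * (real s + 1) * c)" if b: "b \<in> insert a S" for b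
  proof -
    \<comment> \<open>Total variance: 4 s c within the fibre plus 4 c for the offset of the fibre
      mean.\<close>
    have "(\<Sum>q\<in>P. \<Sum>k\<in>I. (F b q k - M k)\<^sup>2) = (\<Sum>k\<in>I. \<Sum>q\<in>P. (F b q k - M k)\<^sup>2)" by (rule sum.swap)
    also have "\<dots> = (\<Sum>k\<in>I. (\<Sum>q\<in>P. (F b q k - m b k)\<^sup>2) + fact s * (m b k - M k)\<^sup>2)"
      by (intro sum.cong refl) (subst sum_square_mean_split[OF fP Pne, of "m b _"], auto simp: m_def cP)
    also have "\<dots> = (\<Sum>q\<in>P. \<Sum>k\<in>I. (F b q k - m b k)\<^sup>2) + fact s * (\<Sum>k\<in>I. (m b k - M k)\<^sup>2)"
      by (simp add: sum.distrib sum_distrib_left) (rule sum.swap)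
    also have "\<dots> \<le> fact s * (4 * real s * c) + fact s * (4 * c)"
      by (intro add_mono IH b mult_left_mono between) auto
    finally show ?thesis by (simp add: algebra_simps)
  qed
  then have "(\<Sum>b\<in>insert a S. \<Sum>q\<in>P. \<Sum>k\<in>I. (F b q k - M k)\<^sup>2) \<le> (\<Sum>b\<in>insert a S. fact s * (4 * (real s + 1) * c))"
    by (rule sum_mono)
  also have "\<dots> = fact (card (insert a S)) * (4 * real (card (insert a S)) * c)"
    unfolding cI by (simp add: cI algebra_simps)
  finally show ?case unfolding M unfolding split F_def .
qed

lemma L2_set_sum_le:
  assumes "finite A" shows "L2_set (\<lambda>k. \<Sum>j\<in>A. g j k) I \<le> (\<Sum>j\<in>A. L2_set (g j) I)"
  using assms
proof (induction A rule: finite_induct)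
  case empty then show ?case by (simp add: L2_set_def)
next
  case (insert j A)
  have "L2_set (\<lambda>k. g j k + (\<Sum>j\<in>A. g j k)) I \<le> L2_set (g j) I + L2_set (\<lambda>k. \<Sum>j\<in>A. g j k) I"
    by (rule L2_set_triangle_ineq)
  then show ?case using insert by simp
qed

lemma L2_set_square: "(L2_set f A)\<^sup>2 = (\<Sum>k\<in>A. (f k)\<^sup>2)"
  by (simp add: L2_set_def sum_nonneg)

lemma L2_set_minus: "L2_set (\<lambda>k. - f k) A = L2_set f A"
  by (simp add: L2_set_def)

text \<open>The Frobenius norm of the rank one matrix u u^T.\<close>

lemma L2_set_outer: "L2_set (\<lambda>(h, k). u h * u k) (A \<times> A) = (\<Sum>h\<in>A. (u h)\<^sup>2)" if "finite A" for u :: "nat \<Rightarrow> real"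
proof -
  have "(\<Sum>p\<in>A \<times> A. ((case p of (h, k) \<Rightarrow> u h * u k))\<^sup>2) = (\<Sum>h\<in>A. (u h)\<^sup>2)\<^sup>2"
    by (simp add: sum.cartesian_product' power_mult_distrib power2_eq_square sum_product case_prod_unfold mult_ac)
  then show ?thesis by (simp add: L2_set_def sum_nonneg)
qed

lemma inner_le_L2_set: "\<bar>\<Sum>h\<in>A. f h * g h\<bar> \<le> L2_set f A * L2_set g A"
  by (rule order_trans[OF sum_abs]) (use L2_set_mult_ineq[of f g A] in \<open>simp add: abs_mult\<close>)

section \<open>Chi-square approximation for permutation statistics\<close>

text \<open>The statistic is the random vector with coordinates the sums of a i (\<pi> i). Only sums
  over the unit i are centered; sums over the slot k stay free, because deviations of different
  treatment levels do not cancel within a unit.\<close>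

locale perm_array =
  fixes n d :: nat and a :: "nat \<Rightarrow> nat \<Rightarrow> nat \<Rightarrow> real" and \<delta> :: real
  assumes n: "n \<ge> 1" and d: "d \<ge> 1"
    and column: "\<And>k h. k < n \<Longrightarrow> h < d \<Longrightarrow> (\<Sum>i<n. a i k h) = 0"
    and bound: "\<And>i k. i < n \<Longrightarrow> k < n \<Longrightarrow> L2_set (a i k) {..<d} \<le> \<delta>"
    and covariance: "\<And>h k. h < d \<Longrightarrow> k < d \<Longrightarrow>
      pavg n (\<lambda>\<pi>. (\<Sum>i<n. a i (\<pi> i) h) * (\<Sum>i<n. a i (\<pi> i) k)) = of_bool (h = k)"
begin

definition W :: "(nat \<Rightarrow> nat) \<Rightarrow> nat \<Rightarrow> real" where
  "W \<pi> h = (\<Sum>i<n. a i (\<pi> i) h)"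
definition D :: "(nat \<Rightarrow> nat) \<Rightarrow> nat \<Rightarrow> nat \<Rightarrow> nat \<Rightarrow> real" where
  "D \<pi> i j h = a i (\<pi> j) h + a j (\<pi> i) h - a i (\<pi> i) h - a j (\<pi> j) h"
definition T :: "(nat \<Rightarrow> nat) \<Rightarrow> real" where
  "T \<pi> = (\<Sum>h<d. (W \<pi> h)\<^sup>2)"

lemma delta_nonneg: "\<delta> \<ge> 0"
  using bound[of 0 0] n L2_set_nonneg[of "a 0 0" "{..<d}"] by linarith

lemma W_swap:
  assumes "i < n" "j < n"
  shows "W (\<pi> \<circ> swp i j) h = W \<pi> h + D \<pi> i j h"
proof (cases "i = j")
  case True then show ?thesis by (simp add: D_def)
next
  case False
  define g where "g = (\<lambda>k. a k ((\<pi> \<circ> swp i j) k) h - a k (\<pi> k) h)"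
  have "sum g {..<n} = sum g {i, j}"
    by (rule sum.mono_neutral_right) (use assms in \<open>auto simp: g_def\<close>)
  also have "\<dots> = D \<pi> i j h" using False by (simp add: g_def D_def)
  finally show ?thesis by (simp add: W_def g_def sum_subtractf)
qed

lemma D_swap: "D (\<pi> \<circ> swp i j) i j h = - D \<pi> i j h"
  by (simp add: D_def)

text \<open>The linear regression property of the exchangeable pair: averaged over all n^2 pairs, a
  swap moves W by exactly - (2 / n) W. Centering in one index suffices, since the two cross sums are
  transposes of each other.\<close>

lemma sum_D:
  assumes "\<pi> \<in> perms n" "h < d"
  shows "(\<Sum>i<n. \<Sum>j<n. D \<pi> i j h) = - 2 * real n * W \<pi> h"
proof -
  have 1: "(\<Sum>i<n. \<Sum>j<n. a j (\<pi> i) h) = 0"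
    using column perms_less[OF assms(1)] assms(2) by simp
  then have 2: "(\<Sum>i<n. \<Sum>j<n. a i (\<pi> j) h) = 0" by (subst sum.swap)
  have "(\<Sum>i<n. \<Sum>j<n. D \<pi> i j h) = (\<Sum>i<n. \<Sum>j<n. a i (\<pi> j) h) + (\<Sum>i<n. \<Sum>j<n. a j (\<pi> i) h)
      - (\<Sum>i<n. \<Sum>j<n. a i (\<pi> i) h) - (\<Sum>i<n. \<Sum>j<n. a j (\<pi> j) h)"
    by (simp add: D_def sum.distrib sum_subtractf)
  then show ?thesis using 1 2 by (simp add: W_def sum_distrib_left[symmetric])
qed

text \<open>The pair consisting of a permutation and its swapped version is exchangeable, and the increment
  changes sign when the two are interchanged.\<close>

lemma stein_swap:
  "pavg n (\<lambda>\<pi>. \<Sum>i<n. \<Sum>j<n. \<Sum>h<d. D \<pi> i j h * (G (\<pi> \<circ> swp i j) h - G \<pi> h))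
    = 4 * real n * pavg n (\<lambda>\<pi>. \<Sum>h<d. W \<pi> h * G \<pi> h)"
proof -
  let ?P = "perms n"
  have 1: "(\<Sum>\<pi>\<in>?P. \<Sum>h<d. D \<pi> i j h * G (\<pi> \<circ> swp i j) h) = - (\<Sum>\<pi>\<in>?P. \<Sum>h<d. D \<pi> i j h * G \<pi> h)"
    if "i < n" "j < n" for i j
  proof -
    have "(\<Sum>\<pi>\<in>?P. \<Sum>h<d. D \<pi> i j h * G (\<pi> \<circ> swp i j) h) =
        (\<Sum>\<pi>\<in>?P. (\<lambda>\<pi>. \<Sum>h<d. - (D \<pi> i j h * G \<pi> h)) (\<pi> \<circ> swp i j))"
      by (simp add: D_swap)
    also have "\<dots> = (\<Sum>\<pi>\<in>?P. \<Sum>h<d. - (D \<pi> i j h * G \<pi> h))"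
      by (rule sum_perms_swap[OF that])
    finally show ?thesis by (simp add: sum_negf)
  qed
  have "(\<Sum>\<pi>\<in>?P. \<Sum>i<n. \<Sum>j<n. \<Sum>h<d. D \<pi> i j h * (G (\<pi> \<circ> swp i j) h - G \<pi> h)) =
      (\<Sum>i<n. \<Sum>j<n. (\<Sum>\<pi>\<in>?P. \<Sum>h<d. D \<pi> i j h * (G (\<pi> \<circ> swp i j) h - G \<pi> h)))"
    by (subst sum.swap, intro sum.cong refl sum.swap)
  also have "\<dots> = (\<Sum>i<n. \<Sum>j<n. - 2 * (\<Sum>\<pi>\<in>?P. \<Sum>h<d. D \<pi> i j h * G \<pi> h))"
    by (intro sum.cong refl) (simp add: right_diff_distrib sum_subtractf 1)
  also have "\<dots> = - 2 * (\<Sum>\<pi>\<in>?P. \<Sum>i<n. \<Sum>j<n. \<Sum>h<d. D \<pi> i j h * G \<pi> h)"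
    unfolding sum_distrib_left[symmetric]
    by (rule arg_cong[where f = "\<lambda>x. - 2 * x"], subst (2) sum.swap, intro sum.cong refl sum.swap)
  also have "(\<Sum>\<pi>\<in>?P. \<Sum>i<n. \<Sum>j<n. \<Sum>h<d. D \<pi> i j h * G \<pi> h)
      = (\<Sum>\<pi>\<in>?P. \<Sum>h<d. (\<Sum>i<n. \<Sum>j<n. D \<pi> i j h) * G \<pi> h)"
  proof (rule sum.cong[OF refl])
    fix \<pi>
    have "(\<Sum>i<n. \<Sum>j<n. \<Sum>h<d. D \<pi> i j h * G \<pi> h) = (\<Sum>i<n. \<Sum>h<d. \<Sum>j<n. D \<pi> i j h * G \<pi> h)"
      by (intro sum.cong refl sum.swap)
    also have "\<dots> = (\<Sum>h<d. \<Sum>i<n. \<Sum>j<n. D \<pi> i j h * G \<pi> h)" by (rule sum.swap)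
    finally show "(\<Sum>i<n. \<Sum>j<n. \<Sum>h<d. D \<pi> i j h * G \<pi> h) = (\<Sum>h<d. (\<Sum>i<n. \<Sum>j<n. D \<pi> i j h) * G \<pi> h)"
      by (simp add: sum_distrib_right)
  qed
  also have "\<dots> = (\<Sum>\<pi>\<in>?P. \<Sum>h<d. - 2 * real n * (W \<pi> h * G \<pi> h))"
    by (intro sum.cong refl) (simp add: sum_D)
  also have "- 2 * \<dots> = 4 * real n * (\<Sum>\<pi>\<in>?P. \<Sum>h<d. W \<pi> h * G \<pi> h)"
    unfolding sum_distrib_left[symmetric] by simp
  finally show ?thesis unfolding pavg_def by (simp only: times_divide_eq_right)
qed

lemma L2_D:
  assumes "\<pi> \<in> perms n" "i < n" "j < n"
  shows "L2_set (D \<pi> i j) {..<d} \<le> 4 * \<delta>"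
proof -
  have p: "\<pi> i < n" "\<pi> j < n" using perms_less assms by auto
  have "L2_set (D \<pi> i j) {..<d} = L2_set (\<lambda>h. (a i (\<pi> j) h + a j (\<pi> i) h) + (- a i (\<pi> i) h + - a j (\<pi> j) h)) {..<d}"
    by (intro arg_cong[where f = "\<lambda>f. L2_set f {..<d}"]) (auto simp: D_def)
  also have "\<dots> \<le> L2_set (\<lambda>h. a i (\<pi> j) h + a j (\<pi> i) h) {..<d} + L2_set (\<lambda>h. - a i (\<pi> i) h + - a j (\<pi> j) h) {..<d}"
    by (rule L2_set_triangle_ineq)
  also have "\<dots> \<le> (L2_set (a i (\<pi> j)) {..<d} + L2_set (a j (\<pi> i)) {..<d})
      + (L2_set (\<lambda>h. - a i (\<pi> i) h) {..<d} + L2_set (\<lambda>h. - a j (\<pi> j) h) {..<d})"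
    by (intro add_mono L2_set_triangle_ineq)
  also have "\<dots> \<le> (\<delta> + \<delta>) + (\<delta> + \<delta>)"
    unfolding L2_set_minus by (intro add_mono bound assms p)
  finally show ?thesis by simp
qed

lemma sum_square_D:
  assumes "\<pi> \<in> perms n" "i < n" "j < n"
  shows "(\<Sum>h<d. (D \<pi> i j h)\<^sup>2) \<le> 16 * \<delta>\<^sup>2"
  unfolding L2_set_square[symmetric]
  using power_mono[OF L2_D[OF assms], of 2] by (simp add: power_mult_distrib)

lemma W_covariance: "h < d \<Longrightarrow> k < d \<Longrightarrow> pavg n (\<lambda>\<pi>. W \<pi> h * W \<pi> k) = of_bool (h = k)"
  unfolding W_def by (rule covariance)

definition DD :: "(nat \<Rightarrow> nat) \<Rightarrow> nat \<times> nat \<Rightarrow> real" where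
  "DD \<pi> = (\<lambda>(h, k). \<Sum>i<n. \<Sum>j<n. D \<pi> i j h * D \<pi> i j k)"

text \<open>The exchange identity, tested with the linear field that has coordinate k of W in slot
  h, converts the covariance of W into the mean outer product of the increments.\<close>

lemma pavg_DD:
  assumes "h < d" "k < d"
  shows "pavg n (\<lambda>\<pi>. DD \<pi> (h, k)) = 4 * real n * of_bool (h = k)"
proof -
  have "pavg n (\<lambda>\<pi>. DD \<pi> (h, k)) =
    pavg n (\<lambda>\<pi>. \<Sum>i<n. \<Sum>j<n. \<Sum>h'<d. D \<pi> i j h' * (of_bool (h' = h) * W (\<pi> \<circ> swp i j) k - of_bool (h' = h) * W \<pi> k))"
  proof (rule pavg_cong)
    fix \<pi>
    have "(\<Sum>h'<d. D \<pi> i j h' * (of_bool (h' = h) * W (\<pi> \<circ> swp i j) k - of_bool (h' = h) * W \<pi> k)) = D \<pi> i j h * D \<pi> i j k"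
      if "i < n" "j < n" for i j
    proof -
      have "(\<Sum>h'<d. D \<pi> i j h' * (of_bool (h' = h) * W (\<pi> \<circ> swp i j) k - of_bool (h' = h) * W \<pi> k))
          = (\<Sum>h'<d. if h' = h then D \<pi> i j h * D \<pi> i j k else 0)"
        by (intro sum.cong) (auto simp: W_swap that)
      then show ?thesis using assms by simp
    qed
    then show "DD \<pi> (h, k) = (\<Sum>i<n. \<Sum>j<n. \<Sum>h'<d. D \<pi> i j h' * (of_bool (h' = h) * W (\<pi> \<circ> swp i j) k - of_bool (h' = h) * W \<pi> k))"
      by (simp add: DD_def)
  qed
  also have "\<dots> = 4 * real n * pavg n (\<lambda>\<pi>. \<Sum>h'<d. W \<pi> h' * (of_bool (h' = h) * W \<pi> k))"
    by (rule stein_swap)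
  also have "(\<lambda>\<pi>. \<Sum>h'<d. W \<pi> h' * (of_bool (h' = h) * W \<pi> k)) = (\<lambda>\<pi>. W \<pi> h * W \<pi> k)"
  proof
    fix \<pi>
    have "(\<Sum>h'<d. W \<pi> h' * (of_bool (h' = h) * W \<pi> k)) = (\<Sum>h'<d. if h' = h then W \<pi> h * W \<pi> k else 0)"
      by (intro sum.cong) auto
    then show "(\<Sum>h'<d. W \<pi> h' * (of_bool (h' = h) * W \<pi> k)) = W \<pi> h * W \<pi> k" using assms by simp
  qed
  finally show ?thesis using W_covariance[OF assms] by simp
qed

text \<open>The identity minus the normalized sum of outer products of the increments. By
  \<open>pavg_DD\<close> it has mean zero, so only its fluctuation has to be controlled.\<close>

definition defect :: "(nat \<Rightarrow> nat) \<Rightarrow> nat \<times> nat \<Rightarrow> real" where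
  "defect \<pi> = (\<lambda>(h, k). of_bool (h = k) - DD \<pi> (h, k) / (4 * real n))"
definition defect_norm :: "(nat \<Rightarrow> nat) \<Rightarrow> real" where
  "defect_norm \<pi> = L2_set (defect \<pi>) ({..<d} \<times> {..<d})"

text \<open>Exchanging two values changes the permutation at no more than two positions, and
  therefore no more than 4 n ordered pairs. Each outer product moves by at most 16 \<delta>^2 + 16
  \<delta>^2 in Frobenius norm. This feeds \<open>permutation_variance\<close>.\<close>

lemma DD_transpose:
  assumes "\<pi> \<in> perms n" "x < n" "y < n"
  shows "(\<Sum>p\<in>{..<d} \<times> {..<d}. (DD (swp x y \<circ> \<pi>) p - DD \<pi> p)\<^sup>2) \<le> (128 * real n * \<delta>\<^sup>2)\<^sup>2"
proof -
  define \<pi>' where "\<pi>' = swp x y \<circ> \<pi>"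
  have p': "\<pi>' \<in> perms n" using assms by (auto simp: perms_def \<pi>'_def intro!: permutes_compose permutes_swap_id)
  define B where "B = {i. i < n \<and> (\<pi> i = x \<or> \<pi> i = y)}"
  have inj: "inj \<pi>" using assms(1) permutes_inj by (auto simp: perms_def)
  have "card B = card (\<pi> ` B)" by (rule card_image[symmetric]) (use inj in \<open>auto intro: inj_on_subset\<close>)
  also have "\<dots> \<le> card {x, y}" by (rule card_mono) (auto simp: B_def)
  also have "\<dots> \<le> 2" by (simp add: card_insert_if)
  finally have cB: "card B \<le> 2" .
  define E where "E = (\<lambda>i j (h, k). D \<pi>' i j h * D \<pi>' i j k - D \<pi> i j h * D \<pi> i j k)"
  let ?I = "{..<d} \<times> {..<d}"
  have Ebound: "L2_set (E i j) ?I \<le> 32 * \<delta>\<^sup>2 * of_bool (i \<in> B) + 32 * \<delta>\<^sup>2 * of_bool (j \<in> B)" if ij: "i < n" "j < n" for i j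
  proof (cases "i \<in> B \<or> j \<in> B")
    case False
    then have "\<pi>' i = \<pi> i" "\<pi>' j = \<pi> j" using ij by (auto simp: B_def \<pi>'_def Transposition.transpose_def)
    then have "D \<pi>' i j = D \<pi> i j" by (simp add: D_def[abs_def])
    then show ?thesis using False by (simp add: E_def L2_set_def)
  next
    case True
    have "L2_set (E i j) ?I = L2_set (\<lambda>p. (case p of (h, k) \<Rightarrow> D \<pi>' i j h * D \<pi>' i j k) + - (case p of (h, k) \<Rightarrow> D \<pi> i j h * D \<pi> i j k)) ?I"
      by (intro arg_cong[where f = "\<lambda>f. L2_set f ?I"]) (auto simp: E_def)
    also have "\<dots> \<le> L2_set (\<lambda>(h, k). D \<pi>' i j h * D \<pi>' i j k) ?I + L2_set (\<lambda>p. - (case p of (h, k) \<Rightarrow> D \<pi> i j h * D \<pi> i j k)) ?I"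
      by (rule L2_set_triangle_ineq)
    also have "\<dots> \<le> 16 * \<delta>\<^sup>2 + 16 * \<delta>\<^sup>2"
      unfolding L2_set_minus L2_set_outer[OF finite_lessThan]
      by (intro add_mono sum_square_D assms p' ij)
    also have "\<dots> \<le> 32 * \<delta>\<^sup>2 * of_bool (i \<in> B) + 32 * \<delta>\<^sup>2 * of_bool (j \<in> B)"
      using True by auto
    finally show ?thesis .
  qed
  have sB: "(\<Sum>i<n. of_bool (i \<in> B)) = real (card B)"
    by (simp add: B_def of_bool_def sum.If_cases Int_def)
  have "L2_set (\<lambda>p. DD \<pi>' p - DD \<pi> p) ?I = L2_set (\<lambda>p. \<Sum>i<n. \<Sum>j<n. E i j p) ?I"
    by (intro arg_cong[where f = "\<lambda>f. L2_set f ?I"]) (auto simp: E_def DD_def sum_subtractf)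
  also have "\<dots> \<le> (\<Sum>i<n. L2_set (\<lambda>p. \<Sum>j<n. E i j p) ?I)" by (rule L2_set_sum_le) simp
  also have "\<dots> \<le> (\<Sum>i<n. \<Sum>j<n. L2_set (E i j) ?I)" by (intro sum_mono L2_set_sum_le) simp
  also have "\<dots> \<le> (\<Sum>i<n. \<Sum>j<n. 32 * \<delta>\<^sup>2 * of_bool (i \<in> B) + 32 * \<delta>\<^sup>2 * of_bool (j \<in> B))"
    by (intro sum_mono Ebound) auto
  also have "\<dots> = 64 * real n * \<delta>\<^sup>2 * real (card B)"
    by (simp add: sum.distrib sum_distrib_left[symmetric] sB del: of_bool_eq)
  also have "\<dots> \<le> 64 * real n * \<delta>\<^sup>2 * 2" using cB by (intro mult_left_mono) auto
  finally have "L2_set (\<lambda>p. DD \<pi>' p - DD \<pi> p) ?I \<le> 128 * real n * \<delta>\<^sup>2" by simp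
  then have "(L2_set (\<lambda>p. DD \<pi>' p - DD \<pi> p) ?I)\<^sup>2 \<le> (128 * real n * \<delta>\<^sup>2)\<^sup>2"
    by (intro power_mono) auto
  then show ?thesis unfolding L2_set_square \<pi>'_def .
qed

text \<open>The variance bound 4 n (128 n \<delta>^2)^2, divided by the squared normalization (4
  n)^2, has square root 64 sqrt n \<delta>^2.\<close>

lemma pavg_defect_norm: "pavg n defect_norm \<le> 64 * sqrt (real n) * \<delta>\<^sup>2"
proof -
  let ?I = "{..<d} \<times> {..<d}"
  have "(\<Sum>\<pi> | \<pi> permutes {..<n}. \<Sum>p\<in>?I. (DD \<pi> p - (\<Sum>\<pi> | \<pi> permutes {..<n}. DD \<pi> p) / fact (card {..<n}))\<^sup>2)
      \<le> fact (card {..<n}) * (4 * real (card {..<n}) * (128 * real n * \<delta>\<^sup>2)\<^sup>2)"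
    by (rule permutation_variance) (use DD_transpose in \<open>auto simp: perms_def\<close>)
  then have "(\<Sum>\<pi>\<in>perms n. \<Sum>p\<in>?I. (DD \<pi> p - pavg n (\<lambda>\<pi>. DD \<pi> p))\<^sup>2)
      \<le> fact n * (4 * real n * (128 * real n * \<delta>\<^sup>2)\<^sup>2)"
    by (simp add: perms_def[symmetric] pavg_def)
  moreover have "(\<Sum>p\<in>?I. (DD \<pi> p - pavg n (\<lambda>\<pi>. DD \<pi> p))\<^sup>2) = (4 * real n)\<^sup>2 * (defect_norm \<pi>)\<^sup>2" for \<pi>
    unfolding defect_norm_def L2_set_square sum_distrib_left
  proof (intro sum.cong refl)
    fix p assume p: "p \<in> ?I"
    obtain h k where hk: "p = (h, k)" by (cases p)
    have "DD \<pi> p - pavg n (\<lambda>\<pi>. DD \<pi> p) = - (4 * real n * defect \<pi> p)"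
      using p n by (simp add: hk pavg_DD defect_def field_simps)
    then show "(DD \<pi> p - pavg n (\<lambda>\<pi>. DD \<pi> p))\<^sup>2 = (4 * real n)\<^sup>2 * (defect \<pi> p)\<^sup>2"
      by (simp only: power2_minus power_mult_distrib)
  qed
  ultimately have "(4 * real n)\<^sup>2 * (\<Sum>\<pi>\<in>perms n. (defect_norm \<pi>)\<^sup>2) \<le> fact n * (4 * real n * (128 * real n * \<delta>\<^sup>2)\<^sup>2)"
    by (simp add: sum_distrib_left)
  then have "(4 * real n)\<^sup>2 * pavg n (\<lambda>\<pi>. (defect_norm \<pi>)\<^sup>2) \<le> 4 * real n * (128 * real n * \<delta>\<^sup>2)\<^sup>2"
    by (simp add: pavg_def pos_divide_le_eq mult.commute)
  also have "\<dots> = (4 * real n)\<^sup>2 * (64 * sqrt (real n) * \<delta>\<^sup>2)\<^sup>2"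
    by (simp add: power_mult_distrib power2_eq_square)
  finally have "pavg n (\<lambda>\<pi>. (defect_norm \<pi>)\<^sup>2) \<le> (64 * sqrt (real n) * \<delta>\<^sup>2)\<^sup>2"
    using n by simp
  then have "sqrt (pavg n (\<lambda>\<pi>. (defect_norm \<pi>)\<^sup>2)) \<le> 64 * sqrt (real n) * \<delta>\<^sup>2"
    by (simp add: real_le_lsqrt)
  then show ?thesis using pavg_le_sqrt[of n defect_norm] by linarith
qed

lemma pavg_T: "pavg n T = real d"
  unfolding T_def pavg_sum by (simp add: power2_eq_square W_covariance)

text \<open>The mean trace of the outer products is 4 n d, while each of the n^2 pairs contributes
  at most 16 \<delta>^2. Thus \<delta> cannot be small compared with sqrt (d / n), and lower-order
  errors can be absorbed into n \<delta>^3.\<close>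

lemma delta_lower: "real d \<le> 4 * real n * \<delta>\<^sup>2"
proof -
  have "4 * real n * real d = (\<Sum>h<d. pavg n (\<lambda>\<pi>. DD \<pi> (h, h)))" by (simp add: pavg_DD)
  also have "\<dots> = pavg n (\<lambda>\<pi>. \<Sum>h<d. DD \<pi> (h, h))" by (rule pavg_sum[symmetric])
  also have "\<dots> \<le> pavg n (\<lambda>\<pi>. real n * (real n * (16 * \<delta>\<^sup>2)))"
  proof (rule pavg_mono)
    fix \<pi> assume p: "\<pi> \<in> perms n"
    have "(\<Sum>h<d. DD \<pi> (h, h)) = (\<Sum>i<n. \<Sum>j<n. \<Sum>h<d. (D \<pi> i j h)\<^sup>2)"
      unfolding DD_def prod.case power2_eq_square
      by (subst sum.swap, intro sum.cong refl sum.swap)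
    also have "\<dots> \<le> (\<Sum>i<n. \<Sum>j<n. 16 * \<delta>\<^sup>2)" by (intro sum_mono sum_square_D p) auto
    finally show "(\<Sum>h<d. DD \<pi> (h, h)) \<le> real n * (real n * (16 * \<delta>\<^sup>2))" by simp
  qed
  finally have "4 * real n * real d \<le> 4 * real n * (4 * real n * \<delta>\<^sup>2)" by simp
  then show ?thesis using n by simp
qed

lemma T_L2: "T \<pi> = (L2_set (W \<pi>) {..<d})\<^sup>2"
  by (simp add: T_def L2_set_square)

lemma T_nonneg: "0 \<le> T \<pi>"
  by (simp add: T_L2)

lemma sqrt_T: "sqrt (T \<pi>) = L2_set (W \<pi>) {..<d}"
  by (simp add: T_L2)

lemma defect_trace: "\<bar>\<Sum>h<d. defect \<pi> (h, h)\<bar> \<le> sqrt (real d) * defect_norm \<pi>"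
proof -
  have "\<bar>\<Sum>h<d. 1 * defect \<pi> (h, h)\<bar> \<le> L2_set (\<lambda>h. 1) {..<d} * L2_set (\<lambda>h. defect \<pi> (h, h)) {..<d}"
    by (rule inner_le_L2_set)
  also have "L2_set (\<lambda>h. 1) {..<d} = sqrt (real d)" by (simp add: L2_set_def)
  also have "L2_set (\<lambda>h. defect \<pi> (h, h)) {..<d} \<le> defect_norm \<pi>"
  proof -
    have "(\<Sum>h<d. (defect \<pi> (h, h))\<^sup>2) = (\<Sum>p\<in>(\<lambda>h. (h, h)) ` {..<d}. (defect \<pi> p)\<^sup>2)"
      by (subst sum.reindex) (auto simp: inj_on_def)
    also have "\<dots> \<le> (\<Sum>p\<in>{..<d} \<times> {..<d}. (defect \<pi> p)\<^sup>2)"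
      by (rule sum_mono2) auto
    finally show ?thesis by (simp add: defect_norm_def L2_set_def)
  qed
  finally show ?thesis by (simp add: mult_left_mono)
qed

lemma defect_form: "\<bar>\<Sum>h<d. \<Sum>k<d. W \<pi> h * W \<pi> k * defect \<pi> (h, k)\<bar> \<le> T \<pi> * defect_norm \<pi>"
proof -
  have "(\<Sum>h<d. \<Sum>k<d. W \<pi> h * W \<pi> k * defect \<pi> (h, k)) =
     (\<Sum>p\<in>{..<d} \<times> {..<d}. (case p of (h, k) \<Rightarrow> W \<pi> h * W \<pi> k) * defect \<pi> p)"
    by (simp add: sum.cartesian_product case_prod_unfold)
  moreover have "L2_set (\<lambda>(h, k). W \<pi> h * W \<pi> k) ({..<d} \<times> {..<d}) = T \<pi>"
    unfolding T_def L2_set_outer[OF finite_lessThan] ..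
  ultimately show ?thesis
    using inner_le_L2_set[of "\<lambda>(h, k). W \<pi> h * W \<pi> k" "defect \<pi>" "{..<d} \<times> {..<d}"]
    by (simp only: defect_norm_def)
qed

text \<open>The exchange identity for the gradient field 2 sol(|w|^2) w. Its left side is a sum of
  Hessian forms plus remainders; summed over all pairs, the Hessian is traced against 4 n (I -
  defect). The part with I, together with the right side, is the Stein operator, so what is left is
  the defect and the remainder. The condition on \<epsilon> says |D| \<le> 4 \<delta> \<le>
  \<epsilon>/4.\<close>

lemma stein_expansion:
  assumes "stein_solution d r \<epsilon>" and \<epsilon>: "16 * \<delta> \<le> \<epsilon>"
  shows "\<bar>pavg n (\<lambda>\<pi>. stein_solution.ramp r \<epsilon> (T \<pi>)) - stein_solution.rmean d r \<epsilon>\<bar> \<le>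
     (2 * sqrt (real d) + 2) * pavg n defect_norm
     + 16 * real n * \<delta> ^ 3 * pavg n (\<lambda>\<pi>. stein_solution.excess d r \<epsilon> (sqrt (T \<pi>)))"
proof -
  interpret S: stein_solution d r \<epsilon> by (rule assms(1))
  define e where "e = (\<lambda>\<pi> i j. \<Sum>h<d. (D \<pi> i j h)\<^sup>2)"
  define y where "y = (\<lambda>\<pi> i j. \<Sum>h<d. W \<pi> h * D \<pi> i j h)"
  define R where "R = (\<lambda>\<pi>. \<Sum>i<n. \<Sum>j<n. S.remainder (T \<pi>) (y \<pi> i j) (e \<pi> i j))"
  define tr where "tr = (\<lambda>\<pi>. \<Sum>h<d. defect \<pi> (h, h))"
  define q where "q = (\<lambda>\<pi>. \<Sum>h<d. \<Sum>k<d. W \<pi> h * W \<pi> k * defect \<pi> (h, k))"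
  define G where "G = (\<lambda>\<pi> h. 2 * S.sol (T \<pi>) * W \<pi> h)"
  have n0: "real n > 0" using n by simp
  have DD: "DD \<pi> (h, k) = 4 * real n * (of_bool (h = k) - defect \<pi> (h, k))" for \<pi> h k
    using n0 by (simp add: defect_def)
  have sum_e: "(\<Sum>i<n. \<Sum>j<n. e \<pi> i j) = 4 * real n * (real d - tr \<pi>)" for \<pi>
  proof -
    have "(\<Sum>i<n. \<Sum>j<n. e \<pi> i j) = (\<Sum>h<d. DD \<pi> (h, h))"
      unfolding DD_def prod.case power2_eq_square e_def
      by (subst (2) sum.swap, intro sum.cong refl sum.swap)
    then show ?thesis by (simp add: DD tr_def sum_distrib_left[symmetric] sum_subtractf)
  qed
  have sum_y: "(\<Sum>i<n. \<Sum>j<n. (y \<pi> i j)\<^sup>2) = 4 * real n * (T \<pi> - q \<pi>)" for \<pi>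
  proof -
    have "(\<Sum>i<n. \<Sum>j<n. (y \<pi> i j)\<^sup>2) = (\<Sum>i<n. \<Sum>j<n. \<Sum>h<d. \<Sum>k<d. W \<pi> h * W \<pi> k * (D \<pi> i j h * D \<pi> i j k))"
      by (simp add: y_def power2_eq_square sum_product mult_ac)
    also have "\<dots> = (\<Sum>h<d. \<Sum>k<d. \<Sum>i<n. \<Sum>j<n. W \<pi> h * W \<pi> k * (D \<pi> i j h * D \<pi> i j k))"
    proof -
      have "(\<Sum>i<n. \<Sum>j<n. \<Sum>h<d. \<Sum>k<d. f i j h k) = (\<Sum>h<d. \<Sum>k<d. \<Sum>i<n. \<Sum>j<n. f i j h k)" for f :: "nat \<Rightarrow> nat \<Rightarrow> nat \<Rightarrow> nat \<Rightarrow> real"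
      proof -
        have rot: "(\<Sum>j<n. \<Sum>h<d. \<Sum>k<d. g j h k) = (\<Sum>h<d. \<Sum>k<d. \<Sum>j<n. g j h k)" for g :: "nat \<Rightarrow> nat \<Rightarrow> nat \<Rightarrow> real"
          by (subst sum.swap, intro sum.cong refl sum.swap)
        show ?thesis unfolding rot ..
      qed
      then show ?thesis .
    qed
    also have "\<dots> = (\<Sum>h<d. \<Sum>k<d. W \<pi> h * W \<pi> k * DD \<pi> (h, k))"
      by (simp add: DD_def sum_distrib_left)
    also have "\<dots> = (\<Sum>h<d. \<Sum>k<d. 4 * real n * (if h = k then W \<pi> h * W \<pi> k else 0) - 4 * real n * (W \<pi> h * W \<pi> k * defect \<pi> (h, k)))"
      by (intro sum.cong refl) (simp add: DD algebra_simps)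
    also have "\<dots> = 4 * real n * (\<Sum>h<d. \<Sum>k<d. if h = k then W \<pi> h * W \<pi> k else 0) - 4 * real n * q \<pi>"
      by (simp only: sum_subtractf sum_distrib_left[symmetric] q_def)
    also have "(\<Sum>h<d. \<Sum>k<d. if h = k then W \<pi> h * W \<pi> k else 0) = T \<pi>"
      by (simp add: T_def power2_eq_square)
    finally show ?thesis by (simp add: algebra_simps)
  qed
  have swap: "(\<Sum>h<d. D \<pi> i j h * (G (\<pi> \<circ> swp i j) h - G \<pi> h)) =
       S.hess (T \<pi>) (y \<pi> i j) (e \<pi> i j) + S.remainder (T \<pi>) (y \<pi> i j) (e \<pi> i j)"
    if "i < n" "j < n" for \<pi> i j
  proof -
    have T': "T (\<pi> \<circ> swp i j) = T \<pi> + 2 * y \<pi> i j + e \<pi> i j"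
      by (simp add: T_def W_swap that y_def e_def power2_sum sum.distrib sum_distrib_left mult.assoc)
    have "(\<Sum>h<d. D \<pi> i j h * (G (\<pi> \<circ> swp i j) h - G \<pi> h)) =
       (\<Sum>h<d. 2 * S.sol (T (\<pi> \<circ> swp i j)) * (W \<pi> h * D \<pi> i j h + (D \<pi> i j h)\<^sup>2) - 2 * S.sol (T \<pi>) * (W \<pi> h * D \<pi> i j h))"
      by (intro sum.cong refl) (simp add: G_def W_swap that power2_eq_square algebra_simps)
    also have "\<dots> = 2 * S.sol (T (\<pi> \<circ> swp i j)) * (y \<pi> i j + e \<pi> i j) - 2 * S.sol (T \<pi>) * y \<pi> i j"
      by (simp only: sum_subtractf sum_distrib_left[symmetric] sum.distrib y_def e_def)
    finally show ?thesis unfolding S.remainder_def T' by simp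
  qed
  have pw: "(\<Sum>i<n. \<Sum>j<n. \<Sum>h<d. D \<pi> i j h * (G (\<pi> \<circ> swp i j) h - G \<pi> h)) =
     4 * real n * (2 * S.sol (T \<pi>) * (real d - tr \<pi>) + 4 * S.sol' (T \<pi>) * (T \<pi> - q \<pi>)) + R \<pi>" for \<pi>
  proof -
    have "(\<Sum>i<n. \<Sum>j<n. \<Sum>h<d. D \<pi> i j h * (G (\<pi> \<circ> swp i j) h - G \<pi> h)) =
       (\<Sum>i<n. \<Sum>j<n. S.hess (T \<pi>) (y \<pi> i j) (e \<pi> i j)) + R \<pi>"
      by (simp add: swap R_def sum.distrib del: sum_subtractf)
    also have "(\<Sum>i<n. \<Sum>j<n. S.hess (T \<pi>) (y \<pi> i j) (e \<pi> i j)) =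
       2 * S.sol (T \<pi>) * (\<Sum>i<n. \<Sum>j<n. e \<pi> i j) + 4 * S.sol' (T \<pi>) * (\<Sum>i<n. \<Sum>j<n. (y \<pi> i j)\<^sup>2)"
      by (simp only: S.hess_def sum.distrib sum_distrib_left[symmetric])
    also have "\<dots> = 4 * real n * (2 * S.sol (T \<pi>) * (real d - tr \<pi>) + 4 * S.sol' (T \<pi>) * (T \<pi> - q \<pi>))"
      unfolding sum_e sum_y by (simp add: algebra_simps)
    finally show ?thesis .
  qed
  have WG: "(\<Sum>h<d. W \<pi> h * G \<pi> h) = 2 * S.sol (T \<pi>) * T \<pi>" for \<pi>
  proof -
    have "(\<Sum>h<d. W \<pi> h * G \<pi> h) = (\<Sum>h<d. 2 * S.sol (T \<pi>) * (W \<pi> h)\<^sup>2)"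
      by (intro sum.cong refl) (simp add: G_def power2_eq_square)
    then show ?thesis by (simp only: sum_distrib_left[symmetric] T_def[symmetric])
  qed
  have "4 * real n * pavg n (\<lambda>\<pi>. 2 * S.sol (T \<pi>) * T \<pi>) = 4 * real n * pavg n (\<lambda>\<pi>. \<Sum>h<d. W \<pi> h * G \<pi> h)"
    unfolding WG ..
  also have "\<dots> = pavg n (\<lambda>\<pi>. \<Sum>i<n. \<Sum>j<n. \<Sum>h<d. D \<pi> i j h * (G (\<pi> \<circ> swp i j) h - G \<pi> h))"
    by (rule stein_swap[symmetric])
  also have "\<dots> = 4 * real n * pavg n (\<lambda>\<pi>. 2 * S.sol (T \<pi>) * (real d - tr \<pi>) + 4 * S.sol' (T \<pi>) * (T \<pi> - q \<pi>)) + pavg n R"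
    unfolding pw pavg_add pavg_cmult ..
  finally have id: "pavg n (\<lambda>\<pi>. 2 * S.sol (T \<pi>) * T \<pi>) =
      pavg n (\<lambda>\<pi>. 2 * S.sol (T \<pi>) * (real d - tr \<pi>) + 4 * S.sol' (T \<pi>) * (T \<pi> - q \<pi>)) + pavg n R / (4 * real n)"
    using n0 by (simp add: field_simps)
  have "pavg n (\<lambda>\<pi>. S.ramp (T \<pi>)) - S.rmean = pavg n (\<lambda>\<pi>. S.ramp (T \<pi>) - S.rmean)"
    by (simp add: pavg_diff)
  also have "\<dots> = pavg n (\<lambda>\<pi>. (2 * S.sol (T \<pi>) * tr \<pi> + 4 * S.sol' (T \<pi>) * q \<pi>)
      + ((2 * S.sol (T \<pi>) * (real d - tr \<pi>) + 4 * S.sol' (T \<pi>) * (T \<pi> - q \<pi>)) - 2 * S.sol (T \<pi>) * T \<pi>))"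
    by (intro pavg_cong) (simp add: S.sol_equation[OF T_nonneg] algebra_simps)
  also have "\<dots> = pavg n (\<lambda>\<pi>. 2 * S.sol (T \<pi>) * tr \<pi> + 4 * S.sol' (T \<pi>) * q \<pi>) - pavg n R / (4 * real n)"
    unfolding pavg_add pavg_diff using id by (simp add: pavg_add)
  finally have main: "pavg n (\<lambda>\<pi>. S.ramp (T \<pi>)) - S.rmean = \<dots>" .
  \<comment> \<open>The trace of the defect meets |sol| \<le> 1. Its quadratic form at W carries a
    factor T, exactly what the bound on x \<open>sol' x\<close> requires.\<close>
  have first: "\<bar>pavg n (\<lambda>\<pi>. 2 * S.sol (T \<pi>) * tr \<pi> + 4 * S.sol' (T \<pi>) * q \<pi>)\<bar> \<le> (2 * sqrt (real d) + 2) * pavg n defect_norm"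
    unfolding pavg_cmult[symmetric]
  proof (intro order_trans[OF pavg_abs] pavg_mono)
    fix \<pi>
    have "\<bar>2 * S.sol (T \<pi>) * tr \<pi>\<bar> \<le> 2 * 1 * (sqrt (real d) * defect_norm \<pi>)"
      unfolding abs_mult using S.sol_le_1[OF T_nonneg] defect_trace by (intro mult_mono) (auto simp: tr_def)
    moreover have "\<bar>4 * S.sol' (T \<pi>) * q \<pi>\<bar> \<le> 2 * defect_norm \<pi>"
    proof (cases "T \<pi> = 0")
      case True
      then have "q \<pi> = 0" using defect_form[of \<pi>] by (simp add: q_def)
      then show ?thesis by (simp add: defect_norm_def)
    next
      case False
      then have T0: "T \<pi> > 0" using T_nonneg[of \<pi>] by linarith
      have "\<bar>4 * S.sol' (T \<pi>) * q \<pi>\<bar> \<le> \<bar>4 * S.sol' (T \<pi>)\<bar> * (T \<pi> * defect_norm \<pi>)"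
        unfolding abs_mult[of _ "q \<pi>"] using defect_form[of \<pi>] by (intro mult_left_mono) (auto simp: q_def)
      also have "\<dots> = \<bar>4 * T \<pi> * S.sol' (T \<pi>)\<bar> * defect_norm \<pi>" using T0 by (simp add: abs_mult)
      also have "\<dots> \<le> 2 * defect_norm \<pi>"
        by (intro mult_right_mono S.sol'_le T0) (simp add: defect_norm_def)
      finally show ?thesis .
    qed
    ultimately show "\<bar>2 * S.sol (T \<pi>) * tr \<pi> + 4 * S.sol' (T \<pi>) * q \<pi>\<bar> \<le> (2 * sqrt (real d) + 2) * defect_norm \<pi>"
      using abs_triangle_ineq[of "2 * S.sol (T \<pi>) * tr \<pi>" "4 * S.sol' (T \<pi>) * q \<pi>"]
      by (simp add: distrib_right)
  qed
  have rem: "\<bar>S.remainder (T \<pi>) (y \<pi> i j) (e \<pi> i j)\<bar> \<le> (4 * \<delta>) ^ 3 * S.excess (sqrt (T \<pi>))"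
    if p: "\<pi> \<in> perms n" "i < n" "j < n" for \<pi> i j
  proof -
    define b where "b = L2_set (D \<pi> i j) {..<d}"
    have b: "0 \<le> b" "b \<le> 4 * \<delta>" using L2_D[OF p] by (auto simp: b_def)
    have eb: "e \<pi> i j = b\<^sup>2" by (simp add: e_def b_def L2_set_square)
    have "\<bar>S.remainder ((sqrt (T \<pi>))\<^sup>2) (y \<pi> i j) (b\<^sup>2)\<bar> \<le> b ^ 3 * S.excess (sqrt (T \<pi>))"
    proof (rule S.remainder_bound)
      show "\<bar>y \<pi> i j\<bar> \<le> sqrt (T \<pi>) * b"
        unfolding y_def sqrt_T b_def by (rule inner_le_L2_set)
      show "(y \<pi> i j)\<^sup>2 = (sqrt (T \<pi>))\<^sup>2 * b\<^sup>2" if "d = 1"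
        unfolding sqrt_T L2_set_square b_def using that by (simp add: y_def power_mult_distrib)
    qed (use b \<epsilon> T_nonneg in auto)
    also have "\<dots> \<le> (4 * \<delta>) ^ 3 * S.excess (sqrt (T \<pi>))"
      using b T_nonneg by (intro mult_right_mono power_mono S.excess_nonneg) auto
    finally show ?thesis using T_nonneg by (simp add: eb)
  qed
  have "\<bar>pavg n R\<bar> \<le> pavg n (\<lambda>\<pi>. (real n)\<^sup>2 * (4 * \<delta>) ^ 3 * S.excess (sqrt (T \<pi>)))"
  proof (intro order_trans[OF pavg_abs] pavg_mono)
    fix \<pi> assume p: "\<pi> \<in> perms n"
    have "\<bar>R \<pi>\<bar> \<le> (\<Sum>i<n. \<bar>\<Sum>j<n. S.remainder (T \<pi>) (y \<pi> i j) (e \<pi> i j)\<bar>)"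
      unfolding R_def by (rule sum_abs)
    also have "\<dots> \<le> (\<Sum>i<n. \<Sum>j<n. \<bar>S.remainder (T \<pi>) (y \<pi> i j) (e \<pi> i j)\<bar>)"
      by (intro sum_mono sum_abs)
    also have "\<dots> \<le> (\<Sum>i<n. \<Sum>j<n. (4 * \<delta>) ^ 3 * S.excess (sqrt (T \<pi>)))"
      by (intro sum_mono rem p) auto
    finally show "\<bar>R \<pi>\<bar> \<le> (real n)\<^sup>2 * (4 * \<delta>) ^ 3 * S.excess (sqrt (T \<pi>))"
      by (simp add: power2_eq_square mult.assoc)
  qed
  \<comment> \<open>The n^2 pairs contribute (4 \<delta>)^3 each, and the identity was normalized by
    4 n.\<close>
  then have "\<bar>pavg n R\<bar> / (4 * real n) \<le> (real n)\<^sup>2 * (4 * \<delta>) ^ 3 * pavg n (\<lambda>\<pi>. S.excess (sqrt (T \<pi>))) / (4 * real n)"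
    unfolding pavg_cmult by (rule divide_right_mono) simp
  also have "\<dots> = 16 * real n * \<delta> ^ 3 * pavg n (\<lambda>\<pi>. S.excess (sqrt (T \<pi>)))"
    using n0 by (simp add: power2_eq_square power3_eq_cube)
  finally have "\<bar>pavg n R / (4 * real n)\<bar> \<le> 16 * real n * \<delta> ^ 3 * pavg n (\<lambda>\<pi>. S.excess (sqrt (T \<pi>)))"
    by (simp add: abs_divide)
  then show ?thesis using first unfolding main by linarith
qed

end

text \<open>For the least k with a \<le> 2^k \<epsilon> one has a \<ge> 2^k \<epsilon> / 2, so this
  single summand already dominates 1 / a. The purpose is to bound 1 / a by indicators, whose
  averages are probabilities of balls.\<close>

lemma inverse_le_dyadic:
  fixes a \<epsilon> :: real
  assumes "0 < \<epsilon>" "\<epsilon> / 2 < a" "1 \<le> 2 ^ K * \<epsilon>"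
  shows "1 / a \<le> 1 + (\<Sum>k\<le>K. 2 * (1 / 2) ^ k / \<epsilon> * of_bool (a \<le> 2 ^ k * \<epsilon>))"
proof (cases "a \<ge> 1")
  case True
  then have "1 / a \<le> 1" by simp
  moreover have "0 \<le> (\<Sum>k\<le>K. 2 * (1 / 2) ^ k / \<epsilon> * of_bool (a \<le> 2 ^ k * \<epsilon>))"
    using assms by (intro sum_nonneg mult_nonneg_nonneg) auto
  ultimately show ?thesis by linarith
next
  case False
  define k where "k = (LEAST k. a \<le> 2 ^ k * \<epsilon>)"
  have ex: "a \<le> 2 ^ K * \<epsilon>" using False assms by linarith
  have k: "a \<le> 2 ^ k * \<epsilon>" unfolding k_def by (rule LeastI[of _ K]) (rule ex)
  have kK: "k \<le> K" unfolding k_def by (rule Least_le) (rule ex)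
  have "2 ^ k * \<epsilon> / 2 \<le> a"
  proof (cases k)
    case 0 then show ?thesis using assms by simp
  next
    case (Suc j)
    then have "\<not> a \<le> 2 ^ j * \<epsilon>" using not_less_Least[of j "\<lambda>k. a \<le> 2 ^ k * \<epsilon>"] by (simp add: k_def)
    then show ?thesis using Suc by simp
  qed
  then have "1 / a \<le> 1 / (2 ^ k * \<epsilon> / 2)"
    using assms by (intro divide_left_mono mult_pos_pos) auto
  also have "\<dots> = 2 * (1 / 2) ^ k / \<epsilon> * of_bool (a \<le> 2 ^ k * \<epsilon>)"
    using k assms by (simp add: power_divide)
  also have "\<dots> \<le> (\<Sum>k\<le>K. 2 * (1 / 2) ^ k / \<epsilon> * of_bool (a \<le> 2 ^ k * \<epsilon>))"
    by (rule member_le_sum) (use kK assms in auto)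
  finally show ?thesis by simp
qed

lemma ex_dyadic_scale:
  fixes \<epsilon> :: real
  assumes "0 < \<epsilon>" "\<epsilon> \<le> 1"
  shows "\<exists>K. 1 \<le> 2 ^ K * \<epsilon> \<and> 2 ^ K * \<epsilon> \<le> 2"
proof -
  obtain N :: nat where N: "1 / \<epsilon> < 2 ^ N" using real_arch_pow[of 2 "1 / \<epsilon>"] by auto
  define K where "K = (LEAST k. 1 \<le> 2 ^ k * \<epsilon>)"
  have "1 \<le> 2 ^ N * \<epsilon>" using N assms by (simp add: field_simps)
  then have K: "1 \<le> 2 ^ K * \<epsilon>" unfolding K_def by (rule LeastI)
  have "2 ^ K * \<epsilon> \<le> 2"
  proof (cases K)
    case 0 then show ?thesis using assms by simp
  next
    case (Suc j)
    then have "\<not> 1 \<le> 2 ^ j * \<epsilon>" using not_less_Least[of j "\<lambda>k. 1 \<le> 2 ^ k * \<epsilon>"] by (simp add: K_def)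
    then show ?thesis using Suc by simp
  qed
  with K show ?thesis by blast
qed

section \<open>Self-bounding inequality for the Kolmogorov distance\<close>

context perm_array
begin

definition prob :: "real \<Rightarrow> real" where
  "prob t = pavg n (\<lambda>\<pi>. of_bool (T \<pi> \<le> t))"

lemma prob_mono: "s \<le> t \<Longrightarrow> prob s \<le> prob t"
  unfolding prob_def by (intro pavg_mono) auto

lemma prob_bounds: "0 \<le> prob t" "prob t \<le> 1"
  using pavg_mono[of n "\<lambda>_. 0" "\<lambda>\<pi>. of_bool (T \<pi> \<le> t)"] pavg_mono[of n "\<lambda>\<pi>. of_bool (T \<pi> \<le> t)" "\<lambda>_. 1"]
  by (auto simp: prob_def)

lemma prob_neg: "t < 0 \<Longrightarrow> prob t = 0"
proof -
  assume "t < 0"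
  then have "\<not> T \<pi> \<le> t" for \<pi> using T_nonneg[of \<pi>] by linarith
  then show ?thesis by (simp add: prob_def)
qed

lemma sqrt_T_le: "0 \<le> s \<Longrightarrow> sqrt (T \<pi>) \<le> s \<longleftrightarrow> T \<pi> \<le> s\<^sup>2"
  using T_nonneg[of \<pi>] by (metis abs_of_nonneg real_sqrt_abs real_sqrt_le_iff)

lemma pavg_sqrt_T: "pavg n (\<lambda>\<pi>. sqrt (T \<pi>)) \<le> real d"
proof -
  have "pavg n (\<lambda>\<pi>. sqrt (T \<pi>)) \<le> sqrt (pavg n (\<lambda>\<pi>. (sqrt (T \<pi>))\<^sup>2))" by (rule pavg_le_sqrt)
  also have "\<dots> = sqrt (real d)" using pavg_T by (simp add: T_nonneg cong: pavg_cong)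
  also have "\<dots> \<le> real d" using d by (intro real_le_lsqrt) (auto simp: power2_eq_square)
  finally show ?thesis .
qed

text \<open>A ball of radius s = 2^k \<epsilon> has probability at most d s^2 + \<kappa>, weighted
  by 2 / s. The part in s^2 is governed by the largest scale, which is at most 2, and yields 8 d;
  the part in \<kappa> is governed by the smallest scale and yields 4 \<kappa> / \<epsilon>.\<close>

lemma pavg_inverse_sqrt_T:
  assumes \<kappa>: "\<And>t. \<bar>prob t - chi2_cdf d t\<bar> \<le> \<kappa>" and \<epsilon>: "0 < \<epsilon>" "\<epsilon> \<le> 1" and d2: "d \<ge> 2"
  shows "pavg n (\<lambda>\<pi>. of_bool (\<epsilon> / 2 < sqrt (T \<pi>)) * (1 / sqrt (T \<pi>))) \<le> 1 + 8 * real d + 4 * \<kappa> / \<epsilon>"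
proof -
  obtain K where K: "1 \<le> 2 ^ K * \<epsilon>" "2 ^ K * \<epsilon> \<le> 2" using ex_dyadic_scale[OF \<epsilon>] by blast
  have k0: "0 \<le> \<kappa>" using \<kappa>[of 0] by linarith
  have "pavg n (\<lambda>\<pi>. of_bool (\<epsilon> / 2 < sqrt (T \<pi>)) * (1 / sqrt (T \<pi>))) \<le>
      pavg n (\<lambda>\<pi>. 1 + (\<Sum>k\<le>K. 2 * (1 / 2) ^ k / \<epsilon> * of_bool (T \<pi> \<le> (2 ^ k * \<epsilon>)\<^sup>2)))"
  proof (rule pavg_mono)
    fix \<pi>
    have nn: "0 \<le> (\<Sum>k\<le>K. 2 * (1 / 2) ^ k / \<epsilon> * of_bool (T \<pi> \<le> (2 ^ k * \<epsilon>)\<^sup>2))"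
      using \<epsilon> by (intro sum_nonneg mult_nonneg_nonneg) auto
    have "(sqrt (T \<pi>) \<le> 2 ^ k * \<epsilon>) = (T \<pi> \<le> (2 ^ k * \<epsilon>)\<^sup>2)" for k :: nat
      using \<epsilon> by (intro sqrt_T_le) auto
    then show "of_bool (\<epsilon> / 2 < sqrt (T \<pi>)) * (1 / sqrt (T \<pi>)) \<le> 1 + (\<Sum>k\<le>K. 2 * (1 / 2) ^ k / \<epsilon> * of_bool (T \<pi> \<le> (2 ^ k * \<epsilon>)\<^sup>2))"
      using inverse_le_dyadic[OF \<epsilon>(1) _ K(1), of "sqrt (T \<pi>)"] nn
      by (cases "\<epsilon> / 2 < sqrt (T \<pi>)") auto
  qed
  also have "\<dots> = 1 + (\<Sum>k\<le>K. 2 * (1 / 2) ^ k / \<epsilon> * prob ((2 ^ k * \<epsilon>)\<^sup>2))"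
    unfolding pavg_add pavg_sum pavg_cmult prob_def by simp
  also have "\<dots> \<le> 1 + (\<Sum>k\<le>K. 2 * real d * \<epsilon> * 2 ^ k + 2 * \<kappa> / \<epsilon> * (1 / 2) ^ k)"
  proof (intro add_mono sum_mono order_refl)
    fix k
    have "prob ((2 ^ k * \<epsilon>)\<^sup>2) \<le> real d * (2 ^ k * \<epsilon>)\<^sup>2 + \<kappa>"
      using \<kappa>[of "(2 ^ k * \<epsilon>)\<^sup>2"] chi2_cdf_le_linear[OF d2, of "(2 ^ k * \<epsilon>)\<^sup>2"] by auto
    then have "2 * (1 / 2) ^ k / \<epsilon> * prob ((2 ^ k * \<epsilon>)\<^sup>2) \<le> 2 * (1 / 2) ^ k / \<epsilon> * (real d * (2 ^ k * \<epsilon>)\<^sup>2 + \<kappa>)"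
      using \<epsilon> by (intro mult_left_mono) auto
    also have "\<dots> = 2 * real d * \<epsilon> * 2 ^ k + 2 * \<kappa> / \<epsilon> * (1 / 2) ^ k"
      using \<epsilon> by (simp add: field_simps power2_eq_square power_divide)
    finally show "2 * (1 / 2) ^ k / \<epsilon> * prob ((2 ^ k * \<epsilon>)\<^sup>2) \<le> 2 * real d * \<epsilon> * 2 ^ k + 2 * \<kappa> / \<epsilon> * (1 / 2) ^ k" .
  qed
  also have "(\<Sum>k\<le>K. 2 * real d * \<epsilon> * 2 ^ k + 2 * \<kappa> / \<epsilon> * (1 / 2) ^ k) = 2 * real d * \<epsilon> * (\<Sum>k\<le>K. 2 ^ k) + 2 * \<kappa> / \<epsilon> * (\<Sum>k\<le>K. (1 / 2) ^ k)"
    by (simp add: sum.distrib sum_distrib_left)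
  also have "\<dots> \<le> 2 * real d * \<epsilon> * (2 * 2 ^ K) + 2 * \<kappa> / \<epsilon> * 2"
  proof (intro add_mono mult_left_mono)
    have "(\<Sum>k\<le>K. 2 ^ k :: real) = 2 * 2 ^ K - 1" by (induction K) auto
    then show "(\<Sum>k\<le>K. 2 ^ k :: real) \<le> 2 * 2 ^ K" by simp
    have "(\<Sum>k\<le>K. (1 / 2) ^ k :: real) = 2 - (1 / 2) ^ K" by (induction K) auto
    then show "(\<Sum>k\<le>K. (1 / 2) ^ k :: real) \<le> 2" by simp
  qed (use \<epsilon> k0 in auto)
  also have "2 * real d * \<epsilon> * (2 * 2 ^ K) = 4 * real d * (2 ^ K * \<epsilon>)" by simp
  also have "\<dots> \<le> 4 * real d * 2" using K by (intro mult_left_mono) auto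
  finally show ?thesis by simp
qed

text \<open>The inner radius is lowered from r - \<epsilon>/4 to r - \<epsilon>/2, so that the
  closed shell lies inside a difference of two balls. Its width is then 7/4 \<epsilon>, and
  \<open>chi2_shell\<close> charges 2 d per unit of width.\<close>

lemma pavg_shell:
  assumes \<kappa>: "\<And>t. \<bar>prob t - chi2_cdf d t\<bar> \<le> \<kappa>" and \<epsilon>: "0 < \<epsilon>" "\<epsilon> \<le> r"
  shows "pavg n (\<lambda>\<pi>. of_bool (r - \<epsilon> / 4 \<le> sqrt (T \<pi>) \<and> sqrt (T \<pi>) \<le> r + 5 * \<epsilon> / 4)) \<le> 7 / 2 * real d * \<epsilon> + 2 * \<kappa>"
proof -
  have "pavg n (\<lambda>\<pi>. of_bool (r - \<epsilon> / 4 \<le> sqrt (T \<pi>) \<and> sqrt (T \<pi>) \<le> r + 5 * \<epsilon> / 4)) \<le>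
     pavg n (\<lambda>\<pi>. of_bool (T \<pi> \<le> (r + 5 * \<epsilon> / 4)\<^sup>2) - of_bool (T \<pi> \<le> (r - \<epsilon> / 2)\<^sup>2))"
  proof (rule pavg_mono)
    fix \<pi>
    have 1: "(sqrt (T \<pi>) \<le> r + 5 * \<epsilon> / 4) = (T \<pi> \<le> (r + 5 * \<epsilon> / 4)\<^sup>2)"
      "(sqrt (T \<pi>) \<le> r - \<epsilon> / 2) = (T \<pi> \<le> (r - \<epsilon> / 2)\<^sup>2)"
      using \<epsilon> by (intro sqrt_T_le; simp)+
    show "of_bool (r - \<epsilon> / 4 \<le> sqrt (T \<pi>) \<and> sqrt (T \<pi>) \<le> r + 5 * \<epsilon> / 4) \<le>
      (of_bool (T \<pi> \<le> (r + 5 * \<epsilon> / 4)\<^sup>2) - of_bool (T \<pi> \<le> (r - \<epsilon> / 2)\<^sup>2) :: real)"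
      unfolding 1[symmetric] using \<epsilon> by (auto simp: of_bool_def)
  qed
  also have "\<dots> = prob ((r + 5 * \<epsilon> / 4)\<^sup>2) - prob ((r - \<epsilon> / 2)\<^sup>2)"
    by (simp add: pavg_diff prob_def)
  also have "\<dots> \<le> chi2_cdf d ((r + 5 * \<epsilon> / 4)\<^sup>2) - chi2_cdf d ((r - \<epsilon> / 2)\<^sup>2) + 2 * \<kappa>"
    using \<kappa>[of "(r + 5 * \<epsilon> / 4)\<^sup>2"] \<kappa>[of "(r - \<epsilon> / 2)\<^sup>2"] by linarith
  also have "chi2_cdf d ((r + 5 * \<epsilon> / 4)\<^sup>2) - chi2_cdf d ((r - \<epsilon> / 2)\<^sup>2) \<le> 2 * real d * ((r + 5 * \<epsilon> / 4) - (r - \<epsilon> / 2))"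
    using \<epsilon> by (intro chi2_shell d) auto
  finally show ?thesis by (simp add: algebra_simps)
qed

lemma pavg_excess:
  assumes S: "stein_solution d r \<epsilon>" and \<kappa>: "\<And>t. \<bar>prob t - chi2_cdf d t\<bar> \<le> \<kappa>"
  shows "pavg n (\<lambda>\<pi>. stein_solution.excess d r \<epsilon> (sqrt (T \<pi>))) \<le> 578 * (real d)\<^sup>2 + 246 * real d * \<kappa> / \<epsilon>"
proof -
  interpret S: stein_solution d r \<epsilon> by (rule S)
  have d1: "1 \<le> real d" "real d \<le> (real d)\<^sup>2" "1 \<le> (real d)\<^sup>2"
    using d by (simp_all add: self_le_power one_le_power)
  have k0: "0 \<le> \<kappa> / \<epsilon>" using \<kappa>[of 0] S.eps by simp
  have "pavg n (\<lambda>\<pi>. S.excess (sqrt (T \<pi>))) =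
     3 / \<epsilon> * pavg n (\<lambda>\<pi>. of_bool (r - \<epsilon> / 4 \<le> sqrt (T \<pi>) \<and> sqrt (T \<pi>) \<le> r + 5 * \<epsilon> / 4)) + 20
     + 15 / 2 * pavg n (\<lambda>\<pi>. sqrt (T \<pi>))
     + pavg n (\<lambda>\<pi>. of_bool (d \<ge> 2 \<and> \<epsilon> / 2 < sqrt (T \<pi>)) * (60 * real d / sqrt (T \<pi>)))"
    unfolding S.excess_def pavg_add pavg_cmult by simp
  also have "\<dots> \<le> 3 / \<epsilon> * (7 / 2 * real d * \<epsilon> + 2 * \<kappa>) + 20 + 15 / 2 * real d + 60 * real d * (1 + 8 * real d + 4 * \<kappa> / \<epsilon>)"
  proof (intro add_mono mult_left_mono pavg_shell \<kappa> pavg_sqrt_T order_refl)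
    show "pavg n (\<lambda>\<pi>. of_bool (d \<ge> 2 \<and> \<epsilon> / 2 < sqrt (T \<pi>)) * (60 * real d / sqrt (T \<pi>))) \<le> 60 * real d * (1 + 8 * real d + 4 * \<kappa> / \<epsilon>)"
    proof (cases "d \<ge> 2")
      case True
      then have "(\<lambda>\<pi>. of_bool (d \<ge> 2 \<and> \<epsilon> / 2 < sqrt (T \<pi>)) * (60 * real d / sqrt (T \<pi>))) =
        (\<lambda>\<pi>. 60 * real d * (of_bool (\<epsilon> / 2 < sqrt (T \<pi>)) * (1 / sqrt (T \<pi>))))"
        by (intro ext) simp
      moreover have "60 * real d * pavg n (\<lambda>\<pi>. of_bool (\<epsilon> / 2 < sqrt (T \<pi>)) * (1 / sqrt (T \<pi>))) \<le> 60 * real d * (1 + 8 * real d + 4 * \<kappa> / \<epsilon>)"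
        by (intro mult_left_mono pavg_inverse_sqrt_T[OF \<kappa> S.eps True]) simp
      ultimately show ?thesis by (simp only: pavg_cmult)
    next
      case False
      then show ?thesis using k0 by simp
    qed
  qed (use S.eps S.r in auto)
  \<comment> \<open>The powers of d are merged by d \<ge> 1: 10.5 + 20 + 7.5 + 60 + 480 = 578, and 6
    + 240 = 246.\<close>
  also have "\<dots> = 10.5 * real d + 20 + 7.5 * real d + 60 * real d + 480 * (real d)\<^sup>2 + (6 + 240 * real d) * (\<kappa> / \<epsilon>)"
    using S.eps by (simp add: field_simps power2_eq_square)
  also have "\<dots> \<le> 578 * (real d)\<^sup>2 + 246 * real d * (\<kappa> / \<epsilon>)"
  proof (rule add_mono)
    show "10.5 * real d + 20 + 7.5 * real d + 60 * real d + 480 * (real d)\<^sup>2 \<le> 578 * (real d)\<^sup>2"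
      using d1 by linarith
    show "(6 + 240 * real d) * (\<kappa> / \<epsilon>) \<le> 246 * real d * (\<kappa> / \<epsilon>)"
      using d1 k0 by (intro mult_right_mono) auto
  qed
  finally show ?thesis by simp
qed

text \<open>The width \<epsilon> is chosen so that \<kappa> returns with a factor below 1/2: 16 *
  246 = 3936 < 4000. The other constant is 9760 = 512 + 16 * 578, with 512 from the defect.\<close>

lemma ramp_error:
  assumes S: "stein_solution d r \<epsilon>" and \<kappa>: "\<And>t. \<bar>prob t - chi2_cdf d t\<bar> \<le> \<kappa>"
    and \<epsilon>: "\<epsilon> = 8000 * real d * (real n * \<delta> ^ 3)"
  shows "\<bar>pavg n (\<lambda>\<pi>. stein_solution.ramp r \<epsilon> (T \<pi>)) - stein_solution.rmean d r \<epsilon>\<bar> \<le>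
      9760 * (real d)\<^sup>2 * (real n * \<delta> ^ 3) + \<kappa> / 2"
proof -
  interpret S: stein_solution d r \<epsilon> by (rule S)
  define L where "L = real n * \<delta> ^ 3"
  have L: "L > 0" using \<epsilon> S.eps by (simp add: L_def zero_less_mult_iff)
  have d1: "1 \<le> real d" "real d \<le> (real d)\<^sup>2" "1 \<le> (real d)\<^sup>2"
    using d by (simp_all add: self_le_power one_le_power)
  have n0: "real n > 0" using n by simp
  \<comment> \<open>By \<open>delta_lower\<close>, \<delta> is at most a multiple of n \<delta>^3,
    so each jump is short compared with the width of the ramp.\<close>
  have d4: "real d * \<delta> \<le> 4 * L"
    using mult_right_mono[OF delta_lower delta_nonneg] by (simp add: L_def power2_eq_square power3_eq_cube mult_ac)
  have "16 * \<delta> \<le> 8000 * L"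
    using d4 mult_right_mono[OF d1(1) delta_nonneg] L by linarith
  also have "\<dots> \<le> \<epsilon>" unfolding \<epsilon> L_def[symmetric] using d1 L by simp
  finally have \<delta>\<epsilon>: "16 * \<delta> \<le> \<epsilon>" .
  have sd: "sqrt (real d) * (sqrt (real n) * \<delta>\<^sup>2) \<le> 2 * L"
  proof -
    have "sqrt (real d) \<le> sqrt (4 * real n * \<delta>\<^sup>2)" by (intro real_sqrt_le_mono delta_lower)
    also have "\<dots> = 2 * sqrt (real n) * \<delta>" using delta_nonneg by (simp add: real_sqrt_mult)
    finally have "sqrt (real d) * (sqrt (real n) * \<delta>\<^sup>2) \<le> (2 * sqrt (real n) * \<delta>) * (sqrt (real n) * \<delta>\<^sup>2)"
      by (intro mult_right_mono) auto
    also have "\<dots> = 2 * L" by (simp add: L_def power2_eq_square power3_eq_cube)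
    finally show ?thesis .
  qed
  have "(2 * sqrt (real d) + 2) * pavg n defect_norm \<le> (4 * sqrt (real d)) * (64 * sqrt (real n) * \<delta>\<^sup>2)"
    using d1 by (intro mult_mono pavg_defect_norm) (auto simp: pavg_def defect_norm_def sum_nonneg)
  also have "\<dots> \<le> 512 * L" using sd by simp
  also have "\<dots> \<le> (real d)\<^sup>2 * (512 * L)" using mult_right_mono[OF d1(3), of "512 * L"] L by simp
  finally have A: "(2 * sqrt (real d) + 2) * pavg n defect_norm \<le> 512 * (real d)\<^sup>2 * L" by simp
  have "16 * real n * \<delta> ^ 3 * pavg n (\<lambda>\<pi>. S.excess (sqrt (T \<pi>))) \<le> 16 * L * (578 * (real d)\<^sup>2 + 246 * real d * \<kappa> / \<epsilon>)"
    unfolding L_def mult.assoc[symmetric] using delta_nonneg by (intro mult_left_mono pavg_excess[OF S] \<kappa>[unfolded mult.assoc]) auto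
  also have "\<dots> = 9248 * (real d)\<^sup>2 * L + (3936 * real d * L) * (\<kappa> / \<epsilon>)" by (simp add: algebra_simps)
  also have "\<dots> \<le> 9248 * (real d)\<^sup>2 * L + \<kappa> / 2"
  proof -
    have e: "(3936 * real d * L) * (\<kappa> / \<epsilon>) = 3936 / 8000 * \<kappa>"
      unfolding \<epsilon> L_def[symmetric] using L d1 by simp
    have "3936 / 8000 * \<kappa> \<le> \<kappa> / 2" using \<kappa>[of 0] by simp
    then show ?thesis unfolding e by simp
  qed
  finally show ?thesis using A stein_expansion[OF S \<delta>\<epsilon>] unfolding L_def[symmetric] by linarith
qed

text \<open>The ramp of radius r lies between the indicators of the balls of radius r and r +
  \<epsilon>, and passing from one chi-square value to the other costs 2 d \<epsilon>. Ramps exist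
  only for r \<ge> \<epsilon>; smaller radii are handled by the small chi-square mass near 0, which
  raises the cost to 4 d \<epsilon>. The constant covers 9760 + 4 * 8000.\<close>

lemma self_bound:
  assumes \<kappa>: "\<And>t. \<bar>prob t - chi2_cdf d t\<bar> \<le> \<kappa>"
    and \<epsilon>: "\<epsilon> = 8000 * real d * (real n * \<delta> ^ 3)" "0 < \<epsilon>" "\<epsilon> \<le> 1"
  shows "\<bar>prob t - chi2_cdf d t\<bar> \<le> 42000 * (real d)\<^sup>2 * (real n * \<delta> ^ 3) + \<kappa> / 2"
proof -
  define B where "B = 9760 * (real d)\<^sup>2 * (real n * \<delta> ^ 3) + \<kappa> / 2"
  have k0: "0 \<le> \<kappa>" using \<kappa>[of 0] by linarith
  have de: "4 * real d * \<epsilon> = 32000 * (real d)\<^sup>2 * (real n * \<delta> ^ 3)" by (simp add: \<epsilon> power2_eq_square)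
  have B0: "B + 4 * real d * \<epsilon> \<le> 42000 * (real d)\<^sup>2 * (real n * \<delta> ^ 3) + \<kappa> / 2"
    unfolding B_def de using delta_nonneg by (simp add: mult_right_mono)
  have B1: "0 \<le> B" unfolding B_def using delta_nonneg k0 by simp
  have upper: "prob (r\<^sup>2) \<le> chi2_cdf d (r\<^sup>2) + 2 * real d * \<epsilon> + B"
    and lower: "chi2_cdf d ((r + \<epsilon>)\<^sup>2) \<le> prob ((r + \<epsilon>)\<^sup>2) + 2 * real d * \<epsilon> + B" if r: "\<epsilon> \<le> r" for r
  proof -
    interpret S: stein_solution d r \<epsilon> by unfold_locales (use d \<epsilon> r in auto)
    have err: "\<bar>pavg n (\<lambda>\<pi>. S.ramp (T \<pi>)) - S.rmean\<bar> \<le> B"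
      unfolding B_def by (rule ramp_error[OF S.stein_solution_axioms \<kappa> \<epsilon>(1)])
    have "prob (r\<^sup>2) \<le> pavg n (\<lambda>\<pi>. S.ramp (T \<pi>))"
      unfolding prob_def by (intro pavg_mono) (auto simp: S.ramp_low S.lo_def S.ramp_bounds of_bool_def)
    moreover have "pavg n (\<lambda>\<pi>. S.ramp (T \<pi>)) \<le> prob ((r + \<epsilon>)\<^sup>2)"
      unfolding prob_def by (intro pavg_mono) (auto simp: S.ramp_high S.hi_def S.ramp_bounds of_bool_def)
    moreover have "chi2_cdf d ((r + \<epsilon>)\<^sup>2) - chi2_cdf d (r\<^sup>2) \<le> 2 * real d * (r + \<epsilon> - r)"
      using \<epsilon> r by (intro chi2_shell d) auto
    moreover have "chi2_cdf d (r\<^sup>2) \<le> S.rmean" "S.rmean \<le> chi2_cdf d ((r + \<epsilon>)\<^sup>2)"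
      using S.rmean_lower S.rmean_upper by (auto simp: S.lo_def S.hi_def)
    ultimately show "prob (r\<^sup>2) \<le> chi2_cdf d (r\<^sup>2) + 2 * real d * \<epsilon> + B"
      "chi2_cdf d ((r + \<epsilon>)\<^sup>2) \<le> prob ((r + \<epsilon>)\<^sup>2) + 2 * real d * \<epsilon> + B"
      using err by (simp_all add: abs_le_iff)
  qed
  have small: "chi2_cdf d (s\<^sup>2) \<le> 2 * real d * s" if "0 \<le> s" for s
    using chi2_shell[OF d order_refl that] by (simp add: chi2_cdf_nonpos)
  have de0: "0 \<le> real d * \<epsilon>" using \<epsilon> by simp
  have "\<bar>prob t - chi2_cdf d t\<bar> \<le> B + 4 * real d * \<epsilon>"
  proof (cases "t < 0")
    case True
    then show ?thesis using prob_neg chi2_cdf_nonpos[of t d] B1 de0 by simp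
  next
    case False
    define s where "s = sqrt t"
    have s: "0 \<le> s" "t = s\<^sup>2" using False by (auto simp: s_def)
    have "prob t \<le> chi2_cdf d t + 4 * real d * \<epsilon> + B"
    proof (cases "\<epsilon> \<le> s")
      case True then show ?thesis using upper[OF True] de0 s by simp
    next
      case False
      then have "s\<^sup>2 \<le> \<epsilon>\<^sup>2" using s by (intro power_mono) auto
      then have "prob t \<le> prob (\<epsilon>\<^sup>2)" using s by (intro prob_mono) auto
      then show ?thesis using upper[OF order_refl] small[of \<epsilon>] \<epsilon> chi2_cdf_nonneg[OF d, of t] by linarith
    qed
    moreover have "chi2_cdf d t \<le> prob t + 4 * real d * \<epsilon> + B"
    proof (cases "2 * \<epsilon> \<le> s")
      case True then show ?thesis using lower[of "s - \<epsilon>"] de0 s by simp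
    next
      case False
      then have "2 * real d * s \<le> 2 * real d * (2 * \<epsilon>)" by (intro mult_left_mono) auto
      then show ?thesis using small[OF s(1)] prob_bounds[of t] B1 unfolding s(2)[symmetric] by linarith
    qed
    ultimately show ?thesis by (simp add: abs_le_iff)
  qed
  then show ?thesis using B0 by linarith
qed

text \<open>Iterating \<open>self_bound\<close> from the trivial distance 1 halves the excess over
  its fixed point 84000 = 2 * 42000 each time. If \<epsilon> exceeds 1, the claimed bound exceeds 1
  as well.\<close>

lemma chi2_approximation: "\<bar>prob t - chi2_cdf d t\<bar> \<le> 84000 * (real d)\<^sup>2 * (real n * \<delta> ^ 3)"
proof -
  define A where "A = (real d)\<^sup>2 * (real n * \<delta> ^ 3)"
  define \<epsilon> where "\<epsilon> = 8000 * real d * (real n * \<delta> ^ 3)"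
  have d1: "1 \<le> real d" using d by simp
  have triv: "\<bar>prob t - chi2_cdf d t\<bar> \<le> 1" for t
    using prob_bounds[of t] chi2_cdf_nonneg[OF d, of t] chi2_cdf_le_1[OF d, of t] by linarith
  have "\<delta> \<noteq> 0" using delta_lower d by auto
  then have \<delta>: "\<delta> > 0" using delta_nonneg by simp
  then have e0: "0 < \<epsilon>" using d n by (simp add: \<epsilon>_def)
  show ?thesis
  proof (cases "\<epsilon> \<le> 1")
    case False
    have "1 < \<epsilon>" using False by simp
    also have "\<epsilon> \<le> 84000 * A"
    proof -
      have "1 * (real d * (real n * \<delta> ^ 3)) \<le> real d * (real d * (real n * \<delta> ^ 3))"
        using d1 \<delta> by (intro mult_right_mono) auto
      moreover have "0 \<le> A" using \<delta> by (simp add: A_def)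
      ultimately show ?thesis by (simp add: \<epsilon>_def A_def power2_eq_square)
    qed
    finally show ?thesis using triv[of t] by (simp add: A_def)
  next
    case True
    have it: "\<bar>prob t - chi2_cdf d t\<bar> \<le> 84000 * A + (1 / 2) ^ k" for k t
    proof (induction k arbitrary: t)
      case 0
      have "0 \<le> A" using \<delta> by (simp add: A_def)
      then show ?case using triv[of t] by simp
    next
      case (Suc k)
      have "\<bar>prob t - chi2_cdf d t\<bar> \<le> 42000 * (real d)\<^sup>2 * (real n * \<delta> ^ 3) + (84000 * A + (1 / 2) ^ k) / 2"
        by (rule self_bound[OF Suc \<epsilon>_def e0 True])
      also have "\<dots> = 84000 * A + (1 / 2) ^ Suc k" by (simp add: A_def)
      finally show ?case .
    qed
    have "(\<lambda>k. 84000 * A + (1 / 2) ^ k) \<longlonglongrightarrow> 84000 * A + 0"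
      by (intro tendsto_intros LIMSEQ_power_zero) auto
    then have "\<bar>prob t - chi2_cdf d t\<bar> \<le> 84000 * A + 0"
      by (rule LIMSEQ_le_const) (use it in blast)
    then show ?thesis by (simp add: A_def)
  qed
qed

end

section \<open>Whitening and eigenvalue bounds\<close>

definition bilin :: "nat \<Rightarrow> (nat \<Rightarrow> nat \<Rightarrow> real) \<Rightarrow> (nat \<Rightarrow> real) \<Rightarrow> (nat \<Rightarrow> real) \<Rightarrow> real" where
  "bilin n V x y = (\<Sum>k<n. \<Sum>l<n. x k * V k l * y l)"

lemma bilin_sym:
  assumes "\<And>k l. k < n \<Longrightarrow> l < n \<Longrightarrow> V k l = V l k"
  shows "bilin n V x y = bilin n V y x"
  unfolding bilin_def by (subst sum.swap) (intro sum.cong refl, simp add: assms)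

lemma bilin_diff_right: "bilin n V x (\<lambda>k. y k - z k) = bilin n V x y - bilin n V x z"
  by (simp add: bilin_def algebra_simps sum_subtractf)

lemma bilin_add_right: "bilin n V x (\<lambda>k. y k + z k) = bilin n V x y + bilin n V x z"
  by (simp add: bilin_def algebra_simps sum.distrib)

lemma bilin_add_left: "bilin n V (\<lambda>k. y k + z k) x = bilin n V y x + bilin n V z x"
  by (simp add: bilin_def algebra_simps sum.distrib)

lemma bilin_cmult_right: "bilin n V x (\<lambda>k. c * y k) = c * bilin n V x y"
  by (simp add: bilin_def sum_distrib_left mult_ac)

lemma bilin_cmult_left: "bilin n V (\<lambda>k. c * y k) x = c * bilin n V y x"
  by (simp add: bilin_def sum_distrib_left mult_ac)

lemma bilin_zero_right: "bilin n V x (\<lambda>k. 0) = 0"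
  by (simp add: bilin_def)

lemma bilin_zero_left: "bilin n V (\<lambda>k. 0) x = 0"
  by (simp add: bilin_def)

lemma bilin_sum_right:
  assumes "finite A" shows "bilin n V x (\<lambda>k. \<Sum>h\<in>A. c h * y h k) = (\<Sum>h\<in>A. c h * bilin n V x (y h))"
  using assms by (induction A rule: finite_induct)
    (simp_all add: bilin_zero_right bilin_add_right bilin_cmult_right)

lemma bilin_sum_left:
  assumes "finite A" shows "bilin n V (\<lambda>k. \<Sum>h\<in>A. c h * y h k) x = (\<Sum>h\<in>A. c h * bilin n V (y h) x)"
  using assms by (induction A rule: finite_induct)
    (simp_all add: bilin_zero_left bilin_add_left bilin_cmult_left)

text \<open>Gram-Schmidt on the unit vectors for the inner product given by V. The induction also
  records that the first m vectors are supported on the first m coordinates; so the next vector has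
  entry 1 at m and cannot vanish.\<close>

lemma orthonormal_basis_exists:
  assumes sym: "\<And>k l. k < n \<Longrightarrow> l < n \<Longrightarrow> V k l = V l k"
    and pd: "\<And>x. \<exists>k<n. x k \<noteq> 0 \<Longrightarrow> 0 < bilin n V x x"
  shows "\<exists>B. \<forall>h<n. \<forall>k<n. bilin n V (B h) (B k) = of_bool (h = k)"
proof -
  have "m \<le> n \<Longrightarrow> \<exists>B. (\<forall>h<m. \<forall>k<m. bilin n V (B h) (B k) = of_bool (h = k)) \<and> (\<forall>h<m. \<forall>k\<ge>m. B h k = 0)" for m
  proof (induction m)
    case 0 then show ?case by auto
  next
    case (Suc m)
    then obtain B where BB: "(\<forall>h<m. \<forall>k<m. bilin n V (B h) (B k) = of_bool (h = k)) \<and> (\<forall>h<m. \<forall>k\<ge>m. B h k = 0)"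
      using Suc_leD by blast
    have B: "\<And>h k. h < m \<Longrightarrow> k < m \<Longrightarrow> bilin n V (B h) (B k) = of_bool (h = k)"
      and tri: "\<And>h k. h < m \<Longrightarrow> k \<ge> m \<Longrightarrow> B h k = 0" using BB by auto
    define e :: "nat \<Rightarrow> real" where "e = (\<lambda>k. of_bool (k = m))"
    define v where "v = (\<lambda>k. e k - (\<Sum>h<m. bilin n V (B h) e * B h k))"
    have vm: "v m = 1" by (simp add: v_def e_def tri)
    then have "\<exists>k<n. v k \<noteq> 0" using Suc.prems by (intro exI[of _ m]) auto
    then have q: "0 < bilin n V v v" by (rule pd)
    define s where "s = sqrt (bilin n V v v)"
    have s: "s > 0" "s\<^sup>2 = bilin n V v v" using q by (auto simp: s_def)
    have orth: "bilin n V (B h) v = 0" if h: "h < m" for h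
    proof -
      have "bilin n V (B h) v = bilin n V (B h) e - (\<Sum>k<m. bilin n V (B k) e * bilin n V (B h) (B k))"
        unfolding v_def bilin_diff_right by (simp add: bilin_sum_right)
      also have "(\<Sum>k<m. bilin n V (B k) e * bilin n V (B h) (B k)) = (\<Sum>k<m. if k = h then bilin n V (B k) e else 0)"
        by (intro sum.cong refl) (use h B in auto)
      finally show ?thesis using h by simp
    qed
    define B' where "B' = B(m := (\<lambda>k. (1 / s) * v k))"
    have "bilin n V (B' h) (B' k) = of_bool (h = k)" if hk: "h < Suc m" "k < Suc m" for h k
    proof -
      consider "h < m" "k < m" | "h < m" "k = m" | "h = m" "k < m" | "h = m" "k = m"
        using hk unfolding less_Suc_eq by blast
      then show ?thesis
      proof cases
        case 1 then show ?thesis using B by (simp add: B'_def)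
      next
        case 2 then show ?thesis using orth[of h] by (simp add: B'_def bilin_cmult_right del: times_divide_eq_left)
      next
        case 3
        then show ?thesis using orth[of k] bilin_sym[of n V v "B k", OF sym]
          by (simp add: B'_def bilin_cmult_left del: times_divide_eq_left)
      next
        case 4
        have "bilin n V (B' m) (B' m) = (1 / s) * ((1 / s) * bilin n V v v)"
          by (simp only: B'_def fun_upd_same bilin_cmult_left bilin_cmult_right)
        then show ?thesis using 4 s by (simp add: s(2)[symmetric] power2_eq_square)
      qed
    qed
    moreover have "B' h k = 0" if "h < Suc m" "k \<ge> Suc m" for h k
    proof -
      have "v k = 0" using that tri by (simp add: v_def e_def)
      then show ?thesis using that tri by (auto simp: B'_def)
    qed
    ultimately show ?case by blast
  qed
  from this[OF order_refl] show ?thesis by blast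
qed

lemma scalar_prod_mult_vec:
  fixes A :: "real mat"
  assumes "A \<in> carrier_mat n m" "x \<in> carrier_vec n" "y \<in> carrier_vec m"
  shows "scalar_prod x (A *\<^sub>v y) = (\<Sum>i<n. \<Sum>j<m. vec_index x i * index_mat A (i, j) * vec_index y j)"
  using assms
  by (auto simp: scalar_prod_def lessThan_atLeast0 sum_distrib_left mult.assoc intro!: sum.cong)

text \<open>Orthonormality reads B V B^T = I. A one-sided inverse of a square matrix is two-sided,
  hence B^T (B V) = I: the matrix B^T B inverts V.\<close>

lemma bilin_orthonormal_expansion:
  assumes B: "\<And>h k. h < n \<Longrightarrow> k < n \<Longrightarrow> bilin n V (B h) (B k) = of_bool (h = k)"
  shows "\<And>k l. k < n \<Longrightarrow> l < n \<Longrightarrow> (\<Sum>h<n. \<Sum>m<n. B h k * B h m * V m l) = of_bool (k = l)"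
proof -
  define MB MV where "MB = mat n n (\<lambda>(h, k). B h k)" and "MV = mat n n (\<lambda>(k, l). V k l)"
  have c: "MB \<in> carrier_mat n n" "MV \<in> carrier_mat n n" "transpose_mat MB \<in> carrier_mat n n"
    by (auto simp: MB_def MV_def)
  have "(MB * MV) * transpose_mat MB = 1\<^sub>m n"
  proof (rule eq_matI)
    fix h k assume hk: "h < dim_row (1\<^sub>m n)" "k < dim_col (1\<^sub>m n)"
    then have "index_mat ((MB * MV) * transpose_mat MB) (h, k) = (\<Sum>l<n. (\<Sum>m<n. B h m * V m l) * B k l)"
      by (simp add: MB_def MV_def scalar_prod_def lessThan_atLeast0)
    also have "\<dots> = bilin n V (B h) (B k)"
      unfolding bilin_def by (subst sum.swap) (simp add: sum_distrib_right)
    finally show "index_mat ((MB * MV) * transpose_mat MB) (h, k) = index_mat (1\<^sub>m n) (h, k)"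
      using hk B by simp
  qed (use c in auto)
  then have inv: "transpose_mat MB * (MB * MV) = 1\<^sub>m n"
    using mat_mult_left_right_inverse[of "MB * MV" n "transpose_mat MB"] c by auto
  fix k l assume kl: "k < n" "l < n"
  have "of_bool (k = l) = index_mat (transpose_mat MB * (MB * MV)) (k, l)"
    unfolding inv using kl by simp
  also have "\<dots> = (\<Sum>h<n. B h k * (\<Sum>m<n. B h m * V m l))"
    using kl by (simp add: MB_def MV_def scalar_prod_def lessThan_atLeast0)
  finally show "(\<Sum>h<n. \<Sum>m<n. B h k * B h m * V m l) = of_bool (k = l)"
    by (simp add: sum_distrib_left mult.assoc)
qed

text \<open>For x = B^T B f both x^T V x and <x, f> equal U = |B f|^2. The lower bound on the form
  and Cauchy-Schwarz give \<kappa> U^2 \<le> U |f|^2. In effect the inverse of V is bounded by 1 /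
  \<kappa>.\<close>

lemma bilin_whitening_le:
  assumes B: "\<And>h k. h < n \<Longrightarrow> k < n \<Longrightarrow> bilin n V (B h) (B k) = of_bool (h = k)"
    and low: "\<And>x. \<kappa> * (\<Sum>k<n. (x k)\<^sup>2) \<le> bilin n V x x" and \<kappa>: "\<kappa> > 0"
  shows "\<kappa> * (\<Sum>h<n. (\<Sum>k<n. B h k * f k)\<^sup>2) \<le> (\<Sum>k<n. (f k)\<^sup>2)"
proof -
  define u where "u = (\<lambda>h. \<Sum>k<n. B h k * f k)"
  define x where "x = (\<lambda>k. \<Sum>h<n. u h * B h k)"
  define U where "U = (\<Sum>h<n. (u h)\<^sup>2)"
  have "bilin n V x x = (\<Sum>h<n. u h * (\<Sum>k<n. u k * bilin n V (B h) (B k)))"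
    unfolding x_def by (simp add: bilin_sum_left bilin_sum_right)
  also have "\<dots> = (\<Sum>h<n. u h * (\<Sum>k<n. if k = h then u k else 0))"
    by (intro sum.cong refl arg_cong2[where f = "(*)"]) (use B in auto)
  also have "\<dots> = U" by (simp add: U_def power2_eq_square)
  finally have xx: "bilin n V x x = U" .
  have "(\<Sum>k<n. x k * f k) = (\<Sum>h<n. u h * (\<Sum>k<n. B h k * f k))"
    unfolding x_def sum_distrib_right sum_distrib_left by (subst sum.swap) (simp add: mult.assoc)
  then have xf: "(\<Sum>k<n. x k * f k) = U" by (simp add: U_def u_def power2_eq_square)
  have "U\<^sup>2 \<le> (\<Sum>k<n. (x k)\<^sup>2) * (\<Sum>k<n. (f k)\<^sup>2)"
    unfolding xf[symmetric] by (rule Cauchy_Schwarz_ineq_sum)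
  then have "\<kappa> * U\<^sup>2 \<le> (\<kappa> * (\<Sum>k<n. (x k)\<^sup>2)) * (\<Sum>k<n. (f k)\<^sup>2)"
    using \<kappa> by (simp add: mult.assoc)
  also have "\<dots> \<le> U * (\<Sum>k<n. (f k)\<^sup>2)"
    using low[of x] xx by (intro mult_right_mono) (auto simp: sum_nonneg)
  finally have "U * (\<kappa> * U) \<le> U * (\<Sum>k<n. (f k)\<^sup>2)" by (simp add: power2_eq_square mult_ac)
  moreover have "U \<ge> 0" by (simp add: U_def sum_nonneg)
  ultimately have "\<kappa> * U \<le> (\<Sum>k<n. (f k)\<^sup>2)"
    by (cases "U = 0") (auto simp: sum_nonneg)
  then show ?thesis by (simp add: U_def u_def)
qed

section \<open>The smallest eigenvalue as a lower bound of the quadratic form\<close>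

text \<open>A substitute for compactness of the sphere. In a V-orthonormal basis the form is the sum
  of the squared coefficients, and |x|^2 exceeds that sum at most by the squared Frobenius norm of
  the basis. The 1 in \<open>M\<close> only keeps \<open>M\<close> positive.\<close>

lemma bilin_margin:
  assumes sym: "\<And>k l. k < n \<Longrightarrow> l < n \<Longrightarrow> V k l = V l k"
    and pd: "\<And>x. \<exists>k<n. x k \<noteq> 0 \<Longrightarrow> 0 < bilin n V x x"
  shows "\<exists>c>0. \<forall>x. c * (\<Sum>k<n. (x k)\<^sup>2) \<le> bilin n V x x"
proof -
  obtain B where B: "\<And>h k. h < n \<Longrightarrow> k < n \<Longrightarrow> bilin n V (B h) (B k) = of_bool (h = k)"
    using orthonormal_basis_exists[OF sym pd] by blast
  define M where "M = 1 + (\<Sum>k<n. \<Sum>h<n. (B h k)\<^sup>2)"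
  have M: "M > 0" unfolding M_def by (intro add_pos_nonneg) (auto simp: sum_nonneg)
  have "(1 / M) * (\<Sum>k<n. (x k)\<^sup>2) \<le> bilin n V x x" for x
  proof -
    define c where "c = (\<lambda>h. bilin n V (B h) x)"
    have xk: "x k = (\<Sum>h<n. c h * B h k)" if "k < n" for k
    proof -
      have "(\<Sum>h<n. c h * B h k) = (\<Sum>h<n. \<Sum>m<n. \<Sum>l<n. B h k * B h m * V m l * x l)"
        unfolding c_def bilin_def sum_distrib_right by (intro sum.cong refl) (simp only: mult_ac)
      also have "\<dots> = (\<Sum>l<n. (\<Sum>h<n. \<Sum>m<n. B h k * B h m * V m l) * x l)"
        unfolding sum_distrib_right by (subst sum.swap, subst (2) sum.swap, subst sum.swap, subst (2) sum.swap) (rule refl)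
      also have "\<dots> = (\<Sum>l<n. if l = k then x l else 0)"
        by (intro sum.cong refl) (use bilin_orthonormal_expansion[OF B] that in auto)
      finally show ?thesis using that by simp
    qed
    have "bilin n V x x = bilin n V (\<lambda>k. \<Sum>h<n. c h * B h k) x"
      unfolding bilin_def by (intro sum.cong refl) (simp add: xk[symmetric])
    also have "\<dots> = (\<Sum>h<n. (c h)\<^sup>2)" by (simp add: bilin_sum_left c_def power2_eq_square)
    finally have q: "bilin n V x x = (\<Sum>h<n. (c h)\<^sup>2)" .
    have "(\<Sum>k<n. (x k)\<^sup>2) = (\<Sum>k<n. (\<Sum>h<n. c h * B h k)\<^sup>2)" by (simp add: xk)
    also have "\<dots> \<le> (\<Sum>k<n. (\<Sum>h<n. (c h)\<^sup>2) * (\<Sum>h<n. (B h k)\<^sup>2))"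
      by (intro sum_mono Cauchy_Schwarz_ineq_sum)
    also have "\<dots> \<le> bilin n V x x * M"
      unfolding q M_def by (simp add: sum_distrib_left[symmetric] distrib_left sum_nonneg)
    finally show ?thesis using M by (simp add: field_simps)
  qed
  then show ?thesis using M by (intro exI[of _ "1 / M"]) auto
qed

text \<open>Along t x + y the form is affine in t, because its value at x is 0; a nonzero slope
  would make it negative somewhere. The chosen \<open>t\<close> makes it equal to -1.\<close>

lemma semidefinite_kernel:
  assumes sym: "\<And>k l. k < n \<Longrightarrow> l < n \<Longrightarrow> V k l = V l k"
    and psd: "\<And>x. 0 \<le> bilin n V x x" and x: "bilin n V x x = 0"
  shows "\<And>k. k < n \<Longrightarrow> (\<Sum>l<n. V k l * x l) = 0"
proof -
  have orth: "bilin n V x y = 0" for y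
  proof (rule ccontr)
    assume ne: "bilin n V x y \<noteq> 0"
    define b where "b = bilin n V x y"
    define t where "t = - (bilin n V y y + 1) / (2 * b)"
    have b: "b \<noteq> 0" using ne by (simp add: b_def)
    have "0 \<le> bilin n V (\<lambda>k. t * x k + y k) (\<lambda>k. t * x k + y k)" by (rule psd)
    also have "\<dots> = t * (t * bilin n V x x) + t * b + (t * b + bilin n V y y)"
      using bilin_sym[of n V y x, OF sym]
      by (simp add: bilin_add_left bilin_add_right bilin_cmult_left bilin_cmult_right b_def algebra_simps)
    also have "\<dots> = - 1" using b x by (simp add: t_def field_simps)
    finally show False by simp
  qed
  fix k assume k: "k < n"
  have "0 = bilin n V x (\<lambda>l. of_bool (l = k))" using orth by simp
  also have "\<dots> = (\<Sum>l<n. V l k * x l)"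
  proof -
    have "(\<Sum>m<n. x l * V l m * of_bool (m = k)) = V l k * x l" for l
    proof -
      have "(\<Sum>m<n. x l * V l m * of_bool (m = k)) = (\<Sum>m<n. if m = k then x l * V l m else 0)"
        by (intro sum.cong) auto
      then show ?thesis using k by simp
    qed
    then show ?thesis by (simp add: bilin_def)
  qed
  also have "\<dots> = (\<Sum>l<n. V k l * x l)" by (intro sum.cong refl) (use sym k in auto)
  finally show "(\<Sum>l<n. V k l * x l) = 0" by simp
qed

text \<open>The infimum s of the form over unit vectors is an eigenvalue: the form minus s |x|^2 is
  semidefinite, and if it were definite, \<open>bilin_margin\<close> would push the infimum above s.
  Its null vector is an eigenvector. The roots of the characteristic polynomial are finitely many,
  so \<open>Min\<close> lies below s.\<close>

lemma rho_min_le_form: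
  fixes A :: "real mat"
  assumes A: "A \<in> carrier_mat n n" and n: "n \<ge> 1"
    and sym: "\<And>k l. k < n \<Longrightarrow> l < n \<Longrightarrow> index_mat A (k, l) = index_mat A (l, k)"
  shows "rho_min A * (\<Sum>k<n. (x k)\<^sup>2) \<le> bilin n (\<lambda>k l. index_mat A (k, l)) x x"
proof -
  define V where "V = (\<lambda>k l. index_mat A (k, l))"
  define nn where "nn = (\<lambda>x::nat \<Rightarrow> real. \<Sum>k<n. (x k)\<^sup>2)"
  have nn0: "nn x \<ge> 0" for x by (simp add: nn_def sum_nonneg)
  define M where "M = (\<Sum>k<n. \<Sum>l<n. \<bar>V k l\<bar>)"
  have bdd: "- M * nn x \<le> bilin n V x x" for x
  proof -
    have "\<bar>bilin n V x x\<bar> \<le> (\<Sum>k<n. \<Sum>l<n. \<bar>x k * V k l * x l\<bar>)"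
      unfolding bilin_def by (intro order_trans[OF sum_abs] sum_mono sum_abs)
    also have "\<dots> \<le> (\<Sum>k<n. \<Sum>l<n. \<bar>V k l\<bar> * nn x)"
    proof (intro sum_mono)
      fix k l assume kl: "k \<in> {..<n}" "l \<in> {..<n}"
      have xk: "(x j)\<^sup>2 \<le> nn x" if "j \<in> {..<n}" for j
        unfolding nn_def by (rule member_le_sum) (use that in auto)
      have "0 \<le> (\<bar>x k\<bar> - \<bar>x l\<bar>)\<^sup>2" by simp
      then have "2 * (\<bar>x k\<bar> * \<bar>x l\<bar>) \<le> (x k)\<^sup>2 + (x l)\<^sup>2" by (simp add: power2_diff)
      then have "\<bar>x k\<bar> * \<bar>x l\<bar> \<le> nn x" using xk[OF kl(1)] xk[OF kl(2)] by linarith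
      then have "\<bar>V k l\<bar> * (\<bar>x k\<bar> * \<bar>x l\<bar>) \<le> \<bar>V k l\<bar> * nn x" by (intro mult_left_mono) auto
      then show "\<bar>x k * V k l * x l\<bar> \<le> \<bar>V k l\<bar> * nn x" by (simp add: abs_mult mult_ac)
    qed
    also have "\<dots> = M * nn x" by (simp add: M_def sum_distrib_right)
    finally show ?thesis by linarith
  qed
  define R where "R = {bilin n V x x | x. nn x = 1}"
  have Rne: "R \<noteq> {}"
  proof -
    have "nn (\<lambda>k. of_bool (k = 0)) = (\<Sum>k<n. if k = 0 then 1 else 0)"
      unfolding nn_def by (intro sum.cong) auto
    then have "nn (\<lambda>k. of_bool (k = 0)) = 1" using n by simp
    then show ?thesis unfolding R_def by blast
  qed
  have Rbdd: "bdd_below R"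
  proof (rule bdd_belowI[of _ "- M"])
    fix r assume "r \<in> R"
    then obtain x where x: "r = bilin n V x x" "nn x = 1" unfolding R_def by blast
    then show "- M \<le> r" using bdd[of x] by simp
  qed
  define s where "s = Inf R"
  define V' where "V' = (\<lambda>k l. V k l - s * of_bool (k = l))"
  have V': "bilin n V' x x = bilin n V x x - s * nn x" for x
  proof -
    have "(\<Sum>l<n. x k * V' k l * x l) = (\<Sum>l<n. x k * V k l * x l) - s * (x k)\<^sup>2" if k: "k < n" for k
    proof -
      have "(\<Sum>l<n. x k * V' k l * x l) = (\<Sum>l<n. x k * V k l * x l - (if l = k then s * (x k)\<^sup>2 else 0))"
        by (intro sum.cong refl) (auto simp: V'_def algebra_simps power2_eq_square)
      then show ?thesis using k by (simp add: sum_subtractf)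
    qed
    then show ?thesis by (simp add: bilin_def nn_def sum_subtractf sum_distrib_left)
  qed
  have scale: "bilin n V (\<lambda>k. c * x k) (\<lambda>k. c * x k) = c\<^sup>2 * bilin n V x x" "nn (\<lambda>k. c * x k) = c\<^sup>2 * nn x" for c x
    by (simp_all add: bilin_cmult_left bilin_cmult_right nn_def power_mult_distrib sum_distrib_left)
      (simp add: power2_eq_square)
  have ray: "s * nn x \<le> bilin n V x x" for x
  proof (cases "nn x = 0")
    case True
    then show ?thesis using bdd[of x] by simp
  next
    case False
    then have p: "nn x > 0" using nn0[of x] by linarith
    define c where "c = 1 / sqrt (nn x)"
    have c2: "c\<^sup>2 = 1 / nn x" using p by (simp add: c_def power_divide)
    have "nn (\<lambda>k. c * x k) = 1" using p by (simp add: scale c2)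
    then have "bilin n V (\<lambda>k. c * x k) (\<lambda>k. c * x k) \<in> R" unfolding R_def by blast
    then have "s \<le> bilin n V (\<lambda>k. c * x k) (\<lambda>k. c * x k)" unfolding s_def by (rule cInf_lower[OF _ Rbdd])
    then show ?thesis using p by (simp add: scale c2 field_simps)
  qed
  have symV: "V k l = V l k" "V' k l = V' l k" if "k < n" "l < n" for k l
    using sym[OF that] by (auto simp: V_def V'_def)
  have psd: "0 \<le> bilin n V' x x" for x using ray[of x] by (simp add: V')
  have "\<exists>x. (\<exists>k<n. x k \<noteq> 0) \<and> bilin n V' x x = 0"
  proof (rule ccontr)
    assume "\<not> ?thesis"
    then have "0 < bilin n V' x x" if "\<exists>k<n. x k \<noteq> 0" for x using psd[of x] that by (metis less_le)
    then obtain c where c: "c > 0" "\<And>x. c * nn x \<le> bilin n V' x x"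
      using bilin_margin[of n V'] symV unfolding nn_def by blast
    have "s + c \<le> r" if r: "r \<in> R" for r
    proof -
      obtain x where x: "r = bilin n V x x" "nn x = 1" using r unfolding R_def by blast
      then show ?thesis using c(2)[of x] V'[of x] by simp
    qed
    then have "s + c \<le> s" unfolding s_def[symmetric] using cInf_greatest[OF Rne, of "s + c"] by (simp add: s_def)
    then show False using c by simp
  qed
  then obtain x0 where x0: "\<exists>k<n. x0 k \<noteq> 0" "bilin n V' x0 x0 = 0" by blast
  define v where "v = vec n x0"
  have "A *\<^sub>v v = s \<cdot>\<^sub>v v"
  proof (rule eq_vecI)
    fix k assume "k < dim_vec (s \<cdot>\<^sub>v v)"
    then have k: "k < n" by (simp add: v_def)
    have "0 = (\<Sum>l<n. V' k l * x0 l)"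
      using semidefinite_kernel[OF symV(2) psd x0(2) k] by simp
    also have "\<dots> = (\<Sum>l<n. V k l * x0 l - (if l = k then s * x0 k else 0))"
      by (intro sum.cong refl) (auto simp: V'_def algebra_simps)
    also have "\<dots> = (\<Sum>l<n. V k l * x0 l) - s * x0 k" using k by (simp add: sum_subtractf)
    finally show "vec_index (A *\<^sub>v v) k = vec_index (s \<cdot>\<^sub>v v) k"
      using k A by (simp add: v_def V_def scalar_prod_def lessThan_atLeast0)
  qed (use A in \<open>simp add: v_def\<close>)
  moreover have "v \<noteq> 0\<^sub>v n"
  proof
    assume z: "v = 0\<^sub>v n"
    obtain k where k: "k < n" "x0 k \<noteq> 0" using x0(1) by blast
    have "vec_index v k = 0" using z k by simp
    then show False using k by (simp add: v_def)
  qed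
  ultimately have ev: "eigenvalue A s"
    unfolding eigenvalue_def eigenvector_def using A by (intro exI[of _ v]) (auto simp: v_def)
  have "{k. eigenvalue A k} = {k. poly (char_poly A) k = 0}"
    using eigenvalue_root_char_poly[OF A] by simp
  moreover have "char_poly A \<noteq> 0" using degree_monic_char_poly[OF A] by auto
  ultimately have "finite {k. eigenvalue A k}" by (simp add: poly_roots_finite)
  then have "rho_min A \<le> s" unfolding rho_min_def using ev by (intro Min_le) auto
  then have "rho_min A * nn x \<le> s * nn x" using nn0 by (intro mult_right_mono) auto
  then show ?thesis using ray[of x] by (simp add: nn_def V_def)
qed

section \<open>Complete randomization\<close>

text \<open>A reference assignment that fills the groups in consecutive blocks. Permuting its slots
  will generate every assignment.\<close>

lemma labelling_exists:
  fixes Nq :: "nat \<Rightarrow> nat"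
  shows "\<exists>l. (\<forall>i<(\<Sum>q<Q. Nq q). l i < Q) \<and> (\<forall>q<Q. card {i. i < (\<Sum>q<Q. Nq q) \<and> l i = q} = Nq q)"
proof (induction Q)
  case 0 then show ?case by simp
next
  case (Suc Q)
  define N where "N = (\<Sum>q<Q. Nq q)"
  obtain l where l: "\<And>i. i < N \<Longrightarrow> l i < Q" "\<And>q. q < Q \<Longrightarrow> card {i. i < N \<and> l i = q} = Nq q"
    using Suc unfolding N_def by blast
  define l' where "l' = (\<lambda>i. if i < N then l i else Q)"
  have "card {i. i < N + Nq Q \<and> l' i = q} = Nq q" if q: "q < Suc Q" for q
  proof (cases "q = Q")
    case True
    have e: "(l' i = Q) = (N \<le> i)" for i
    proof (cases "i < N")
      case True
      then show ?thesis using l(1)[OF True] by (simp add: l'_def)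
    qed (simp add: l'_def)
    have "{i. i < N + Nq Q \<and> N \<le> i} = {N..<N + Nq Q}" by auto
    then show ?thesis unfolding True e by simp
  next
    case False
    then have "{i. i < N + Nq Q \<and> l' i = q} = {i. i < N \<and> l i = q}"
      by (auto simp: l'_def split: if_splits)
    then show ?thesis using l(2)[of q] False q by simp
  qed
  moreover have "l' i < Suc Q" for i using l(1)[of i] by (auto simp: l'_def less_Suc_eq)
  ultimately show ?case by (intro exI[of _ l']) (auto simp: N_def)
qed

lemma sum_by_label:
  fixes g :: "nat \<Rightarrow> nat \<Rightarrow> real"
  assumes "\<And>i. i < N \<Longrightarrow> l i < Q"
  shows "(\<Sum>i<N. g i (l i)) = (\<Sum>q<Q. \<Sum>i\<in>{i. i < N \<and> l i = q}. g i q)"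
proof -
  have "(\<Sum>q<Q. \<Sum>i\<in>{i. i < N \<and> l i = q}. g i q) = (\<Sum>q<Q. \<Sum>i\<in>{i \<in> {..<N}. l i = q}. g i (l i))"
    by (intro sum.cong) auto
  also have "\<dots> = (\<Sum>i<N. g i (l i))"
    by (rule sum.group) (use assms in auto)
  finally show ?thesis by simp
qed

lemma sum_label_weight:
  fixes g :: "nat \<Rightarrow> real" and l :: "nat \<Rightarrow> nat"
  assumes "\<And>i. i < N \<Longrightarrow> l i < Q" "\<And>q. q < Q \<Longrightarrow> card {i. i < N \<and> l i = q} = Nq q"
  shows "(\<Sum>i<N. g (l i)) = (\<Sum>q<Q. real (Nq q) * g q)"
  using sum_by_label[where g = "\<lambda>_. g" and N = N and l = l and Q = Q] assms by simp

text \<open>Slot \<pi> i of the reference labelling is handed to unit i. The restriction is there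
  because assignments are extensional functions.\<close>

definition relabel :: "nat \<Rightarrow> (nat \<Rightarrow> nat) \<Rightarrow> (nat \<Rightarrow> nat) \<Rightarrow> nat \<Rightarrow> nat" where
  "relabel N l \<pi> = (\<lambda>i\<in>{..<N}. l (\<pi> i))"

lemma relabel_in_assignments:
  assumes "\<And>i. i < N \<Longrightarrow> l i < Q" "\<And>q. q < Q \<Longrightarrow> card {i. i < N \<and> l i = q} = Nq q" "\<pi> \<in> perms N"
  shows "relabel N l \<pi> \<in> assignments N Q Nq"
proof -
  have p: "\<pi> permutes {..<N}" using assms(3) by (simp add: perms_def)
  have "card {i. i < N \<and> relabel N l \<pi> i = q} = Nq q" if "q < Q" for q
  proof -
    have "{i. i < N \<and> l i = q} = \<pi> ` {i. i < N \<and> relabel N l \<pi> i = q}"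
    proof (rule subset_antisym; rule subsetI)
      fix x assume x: "x \<in> {i. i < N \<and> l i = q}"
      then have "inv_into UNIV \<pi> x < N" using permutes_in_image[OF permutes_inv[OF p], of x] by simp
      moreover have "\<pi> (inv_into UNIV \<pi> x) = x" by (rule permutes_inverses[OF p])
      ultimately show "x \<in> \<pi> ` {i. i < N \<and> relabel N l \<pi> i = q}"
        using x by (intro image_eqI[of _ _ "inv_into UNIV \<pi> x"]) (auto simp: relabel_def)
    qed (use perms_less[OF assms(3)] in \<open>auto simp: relabel_def\<close>)
    then have "card {i. i < N \<and> l i = q} = card {i. i < N \<and> relabel N l \<pi> i = q}"
      by (simp add: card_image inj_on_subset[OF permutes_inj[OF p]])
    then show ?thesis using assms(2) that by simp
  qed
  then show ?thesis using assms(1) perms_less[OF assms(3)] by (auto simp: assignments_def relabel_def)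
qed

text \<open>Equal group sizes mean equal multisets of labels, and functions with equal image
  multisets differ by a permutation of the domain.\<close>

lemma assignment_is_relabel:
  assumes l: "\<And>i. i < N \<Longrightarrow> l i < Q" "\<And>q. q < Q \<Longrightarrow> card {i. i < N \<and> l i = q} = Nq q"
    and z: "z \<in> assignments N Q Nq"
  shows "\<exists>\<sigma>\<in>perms N. z = relabel N l \<sigma>"
proof -
  have zQ: "\<And>i. i < N \<Longrightarrow> z i < Q" "\<And>q. q < Q \<Longrightarrow> card {i. i < N \<and> z i = q} = Nq q" "z \<in> extensional {..<N}"
    using z by (auto simp: assignments_def PiE_def)
  have cnt: "count (image_mset f (mset_set {..<N})) q = card {i. i < N \<and> f i = q}" for f :: "nat \<Rightarrow> nat" and q
  proof -
    have "count (image_mset f (mset_set {..<N})) q = (\<Sum>x\<in>f -` {q} \<inter> {..<N}. count (mset_set {..<N}) x)"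
      by (simp add: count_image_mset)
    also have "\<dots> = (\<Sum>x\<in>f -` {q} \<inter> {..<N}. 1)" by (intro sum.cong) auto
    also have "f -` {q} \<inter> {..<N} = {i. i < N \<and> f i = q}" by auto
    finally show ?thesis by simp
  qed
  have "image_mset z (mset_set {..<N}) = image_mset l (mset_set {..<N})"
  proof (rule multiset_eqI)
    fix q
    show "count (image_mset z (mset_set {..<N})) q = count (image_mset l (mset_set {..<N})) q"
    proof (cases "q < Q")
      case True then show ?thesis unfolding cnt using l(2) zQ(2) by simp
    next
      case False
      then have "{i. i < N \<and> z i = q} = {}" "{i. i < N \<and> l i = q} = {}" using l(1) zQ(1) by auto
      then show ?thesis by (simp only: cnt)
    qed
  qed
  then obtain p where p: "p permutes {..<N}" "\<forall>x\<in>{..<N}. z x = l (p x)"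
    using image_mset_eq_implies_permutes[of "{..<N}" z l] by auto
  have "z = relabel N l p"
    using p(2) zQ(3) by (intro extensionalityI[of _ "{..<N}"]) (auto simp: relabel_def)
  then show ?thesis using p(1) by (auto simp: perms_def)
qed

text \<open>Composition with \<sigma> maps the fibre over the reference assignment bijectively onto
  the fibre over its relabelling by \<sigma>. All fibres have the same size, so a uniform
  permutation induces a uniform assignment.\<close>

lemma assignments_average:
  assumes l: "\<And>i. i < N \<Longrightarrow> l i < Q" "\<And>q. q < Q \<Longrightarrow> card {i. i < N \<and> l i = q} = Nq q"
  shows "(\<Sum>z\<in>assignments N Q Nq. g z) / real (card (assignments N Q Nq)) = pavg N (\<lambda>\<pi>. g (relabel N l \<pi>))"
proof -
  let ?A = "assignments N Q Nq"
  have finA: "finite ?A" by (rule finite_subset[of _ "{..<N} \<rightarrow>\<^sub>E {..<Q}"]) (auto simp: assignments_def intro: finite_PiE)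
  define fib where "fib = (\<lambda>z. {\<pi> \<in> perms N. relabel N l \<pi> = z})"
  define c where "c = card (fib (relabel N l id))"
  have fib: "card (fib z) = c" if zA: "z \<in> ?A" for z
  proof -
    obtain \<sigma> where \<sigma>: "\<sigma> permutes {..<N}" "z = relabel N l \<sigma>"
      using assignment_is_relabel[OF l zA] by (auto simp: perms_def)
    have rel: "relabel N l \<pi> = relabel N l \<tau> \<longleftrightarrow> (\<forall>i<N. l (\<pi> i) = l (\<tau> i))" for \<pi> \<tau>
      by (auto simp: relabel_def fun_eq_iff restrict_def)
    have \<sigma>N: "\<sigma> i < N" "inv_into UNIV \<sigma> i < N" if "i < N" for i
      using permutes_in_image[OF \<sigma>(1), of i] permutes_in_image[OF permutes_inv[OF \<sigma>(1)], of i] that by auto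
    have "bij_betw (\<lambda>\<pi>. \<pi> \<circ> \<sigma>) (fib (relabel N l id)) (fib z)"
    proof (rule bij_betw_byWitness[where f' = "\<lambda>\<pi>. \<pi> \<circ> inv_into UNIV \<sigma>"])
      show "\<forall>\<pi>\<in>fib (relabel N l id). \<pi> \<circ> \<sigma> \<circ> inv_into UNIV \<sigma> = \<pi>"
        using permutes_inv_o[OF \<sigma>(1)] by (simp add: o_assoc[symmetric])
      show "\<forall>\<pi>\<in>fib z. \<pi> \<circ> inv_into UNIV \<sigma> \<circ> \<sigma> = \<pi>"
        using permutes_inv_o[OF \<sigma>(1)] by (simp add: o_assoc[symmetric])
      show "(\<lambda>\<pi>. \<pi> \<circ> \<sigma>) ` fib (relabel N l id) \<subseteq> fib z"
        using \<sigma>N \<sigma>(1) by (auto simp: fib_def \<sigma>(2) rel perms_def intro: permutes_compose)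
      show "(\<lambda>\<pi>. \<pi> \<circ> inv_into UNIV \<sigma>) ` fib z \<subseteq> fib (relabel N l id)"
        using \<sigma>N \<sigma>(1) permutes_inverses[OF \<sigma>(1)]
        by (auto simp: fib_def \<sigma>(2) rel perms_def intro: permutes_compose permutes_inv)
    qed
    then show ?thesis unfolding c_def by (simp add: bij_betw_same_card)
  qed
  have sum: "(\<Sum>\<pi>\<in>perms N. g (relabel N l \<pi>)) = real c * (\<Sum>z\<in>?A. g z)" for g :: "(nat \<Rightarrow> nat) \<Rightarrow> real"
  proof -
    have "(\<Sum>\<pi>\<in>perms N. g (relabel N l \<pi>)) = (\<Sum>z\<in>?A. \<Sum>\<pi>\<in>{\<pi> \<in> perms N. relabel N l \<pi> = z}. g (relabel N l \<pi>))"
      by (rule sum.group[symmetric]) (use finA relabel_in_assignments[OF l] in auto)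
    also have "\<dots> = (\<Sum>z\<in>?A. real (card (fib z)) * g z)" by (intro sum.cong) (auto simp: fib_def)
    also have "\<dots> = real c * (\<Sum>z\<in>?A. g z)" by (simp add: fib sum_distrib_left)
    finally show ?thesis .
  qed
  have "fact N = real c * real (card ?A)" using sum[of "\<lambda>_. 1"] by simp
  moreover from this have "real c \<noteq> 0" by (metis fact_nonzero mult_zero_left)
  ultimately show ?thesis unfolding pavg_def sum by simp
qed

section \<open>Moments of permutation sums\<close>

text \<open>Swapping positions shows that the average does not depend on i, and summed over all
  positions the random variable is deterministic.\<close>

lemma pavg_single:
  assumes i: "i < n" shows "pavg n (\<lambda>\<pi>. f (\<pi> i)) = (\<Sum>k<n. f k) / real n"
proof -
  have same: "pavg n (\<lambda>\<pi>. f (\<pi> j)) = pavg n (\<lambda>\<pi>. f (\<pi> i))" if j: "j < n" for j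
  proof -
    have "(\<Sum>\<pi>\<in>perms n. (\<lambda>\<pi>. f (\<pi> i)) (\<pi> \<circ> swp i j)) = (\<Sum>\<pi>\<in>perms n. f (\<pi> i))" by (rule sum_perms_swap[OF i j])
    then show ?thesis by (simp add: pavg_def)
  qed
  have "real n * pavg n (\<lambda>\<pi>. f (\<pi> i)) = (\<Sum>j<n. pavg n (\<lambda>\<pi>. f (\<pi> j)))" using same by simp
  also have "\<dots> = pavg n (\<lambda>\<pi>. \<Sum>j<n. f (\<pi> j))" by (rule pavg_sum[symmetric])
  also have "\<dots> = pavg n (\<lambda>\<pi>. \<Sum>k<n. f k)" by (rule pavg_cong) (rule sum_perms_image)
  finally show ?thesis using i by (simp add: field_simps)
qed

lemma pavg_pair:
  assumes ij: "i < n" "j < n" "i \<noteq> j"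
  shows "pavg n (\<lambda>\<pi>. f (\<pi> i) (\<pi> j)) = ((\<Sum>k<n. \<Sum>l<n. f k l) - (\<Sum>k<n. f k k)) / (real n * (real n - 1))"
proof -
  have n: "real n - 1 > 0" using ij by linarith
  have same: "pavg n (\<lambda>\<pi>. f (\<pi> i) (\<pi> l)) = pavg n (\<lambda>\<pi>. f (\<pi> i) (\<pi> j))" if l: "l < n" "l \<noteq> i" for l
  proof -
    have "(\<Sum>\<pi>\<in>perms n. (\<lambda>\<pi>. f (\<pi> i) (\<pi> j)) (\<pi> \<circ> swp j l)) = (\<Sum>\<pi>\<in>perms n. f (\<pi> i) (\<pi> j))"
      by (rule sum_perms_swap[OF ij(2) l(1)])
    then show ?thesis using l ij by (simp add: pavg_def)
  qed
  have "(\<Sum>l\<in>{..<n} - {i}. pavg n (\<lambda>\<pi>. f (\<pi> i) (\<pi> l))) = (\<Sum>l\<in>{..<n} - {i}. pavg n (\<lambda>\<pi>. f (\<pi> i) (\<pi> j)))"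
    by (intro sum.cong refl same) auto
  also have "\<dots> = (real n - 1) * pavg n (\<lambda>\<pi>. f (\<pi> i) (\<pi> j))"
    using ij by (simp add: of_nat_diff)
  finally have "(real n - 1) * pavg n (\<lambda>\<pi>. f (\<pi> i) (\<pi> j)) = pavg n (\<lambda>\<pi>. \<Sum>l\<in>{..<n} - {i}. f (\<pi> i) (\<pi> l))"
    by (simp add: pavg_sum)
  also have "\<dots> = pavg n (\<lambda>\<pi>. (\<Sum>l<n. f (\<pi> i) l) - f (\<pi> i) (\<pi> i))"
  proof (rule pavg_cong)
    fix \<pi> assume p: "\<pi> \<in> perms n"
    have "(\<Sum>l\<in>{..<n} - {i}. f (\<pi> i) (\<pi> l)) = (\<Sum>l<n. f (\<pi> i) (\<pi> l)) - f (\<pi> i) (\<pi> i)"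
      using ij by (simp add: sum_diff1)
    then show "(\<Sum>l\<in>{..<n} - {i}. f (\<pi> i) (\<pi> l)) = (\<Sum>l<n. f (\<pi> i) l) - f (\<pi> i) (\<pi> i)"
      using sum_perms_image[OF p, of "f (\<pi> i)"] by simp
  qed
  also have "\<dots> = (\<Sum>k<n. (\<Sum>l<n. f k l) - f k k) / real n"
    by (rule pavg_single[OF ij(1)])
  finally show ?thesis using n by (simp add: sum_subtractf field_simps)
qed

text \<open>The diagonal averages are written as the off-diagonal formula plus a correction.
  Centering over i makes the common part sum to zero, and only the corrections remain; the
  uncentered sums over k account for the subtracted term.\<close>

lemma permutation_covariance:
  fixes a b :: "nat \<Rightarrow> nat \<Rightarrow> real"
  assumes n: "n \<ge> 2" and a: "\<And>k. k < n \<Longrightarrow> (\<Sum>i<n. a i k) = 0" and b: "\<And>k. k < n \<Longrightarrow> (\<Sum>i<n. b i k) = 0"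
  shows "pavg n (\<lambda>\<pi>. (\<Sum>i<n. a i (\<pi> i)) * (\<Sum>i<n. b i (\<pi> i))) =
    ((\<Sum>i<n. \<Sum>k<n. a i k * b i k) - (\<Sum>i<n. (\<Sum>k<n. a i k) * (\<Sum>k<n. b i k)) / real n) / (real n - 1)"
proof -
  define A where "A = (\<lambda>i. \<Sum>k<n. a i k)"
  define B where "B = (\<lambda>i. \<Sum>k<n. b i k)"
  define s where "s = (\<lambda>i j. \<Sum>k<n. a i k * b j k)"
  have n0: "real n > 0" "real n - 1 > 0" using n by auto
  have sA: "(\<Sum>i<n. A i) = 0" unfolding A_def by (subst sum.swap) (simp add: a)
  have ss: "(\<Sum>j<n. s i j) = 0" for i
    unfolding s_def by (subst sum.swap) (simp add: sum_distrib_left[symmetric] b)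
  have AB: "(\<Sum>i<n. \<Sum>j<n. A i * B j) = 0"
    unfolding sum_distrib_left[symmetric] sum_distrib_right[symmetric] sA by simp
  have pr: "pavg n (\<lambda>\<pi>. a i (\<pi> i) * b j (\<pi> j)) = (A i * B j - s i j) / (real n * (real n - 1))
      + (if i = j then s i i / real n - (A i * B i - s i i) / (real n * (real n - 1)) else 0)" if "i < n" "j < n" for i j
  proof (cases "i = j")
    case True
    have "pavg n (\<lambda>\<pi>. a i (\<pi> i) * b i (\<pi> i)) = s i i / real n"
      using pavg_single[OF that(1), of "\<lambda>k. a i k * b i k"] by (simp add: s_def)
    then show ?thesis using True by simp
  next
    case False
    have "pavg n (\<lambda>\<pi>. a i (\<pi> i) * b j (\<pi> j)) = (A i * B j - s i j) / (real n * (real n - 1))"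
      using pavg_pair[OF that False, of "\<lambda>k l. a i k * b j l"] by (simp add: s_def A_def B_def sum_product)
    then show ?thesis using False by simp
  qed
  have "pavg n (\<lambda>\<pi>. (\<Sum>i<n. a i (\<pi> i)) * (\<Sum>i<n. b i (\<pi> i))) = (\<Sum>i<n. \<Sum>j<n. pavg n (\<lambda>\<pi>. a i (\<pi> i) * b j (\<pi> j)))"
    by (simp add: sum_product pavg_sum)
  also have "\<dots> = (\<Sum>i<n. \<Sum>j<n. (A i * B j - s i j) / (real n * (real n - 1))
      + (if i = j then s i i / real n - (A i * B i - s i i) / (real n * (real n - 1)) else 0))"
    by (intro sum.cong refl pr) auto
  also have "\<dots> = (\<Sum>i<n. \<Sum>j<n. A i * B j - s i j) / (real n * (real n - 1))
      + (\<Sum>i<n. s i i / real n - (A i * B i - s i i) / (real n * (real n - 1)))"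
    by (simp add: sum.distrib sum_divide_distrib)
  also have "(\<Sum>i<n. \<Sum>j<n. A i * B j - s i j) = 0" by (simp only: sum_subtractf AB ss) simp
  also have "(\<Sum>i<n. s i i / real n - (A i * B i - s i i) / (real n * (real n - 1))) =
     (\<Sum>i<n. (s i i - A i * B i / real n) / (real n - 1))"
    by (intro sum.cong refl) (use n0 in \<open>simp add: field_simps\<close>)
  also have "\<dots> = ((\<Sum>i<n. s i i) - (\<Sum>i<n. A i * B i) / real n) / (real n - 1)"
    by (simp add: sum_divide_distrib[symmetric] sum_subtractf)
  finally show ?thesis by (simp add: s_def A_def B_def)
qed

section \<open>The Wald statistic as a whitened permutation sum\<close>

lemma sandwich_entry:
  assumes A: "A \<in> carrier_mat Q Q" and gh: "g < H" "h < H"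
  shows "index_mat (transpose_mat (Fmat Q H F) * A * Fmat Q H F) (g, h) =
    (\<Sum>q<Q. \<Sum>q'<Q. F q g * index_mat A (q, q') * F q' h)"
proof -
  have "index_mat (transpose_mat (Fmat Q H F) * A * Fmat Q H F) (g, h) =
    (\<Sum>q'<Q. (\<Sum>q<Q. F q g * index_mat A (q, q')) * F q' h)"
    using A gh by (simp add: Fmat_def scalar_prod_def lessThan_atLeast0)
  also have "\<dots> = (\<Sum>q<Q. \<Sum>q'<Q. F q g * index_mat A (q, q') * F q' h)"
    unfolding sum_distrib_right by (rule sum.swap)
  finally show ?thesis .
qed

lemma sandwich_bilin:
  assumes A: "A \<in> carrier_mat Q Q"
  shows "bilin H (\<lambda>g h. index_mat (transpose_mat (Fmat Q H F) * A * Fmat Q H F) (g, h)) x y =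
    bilin Q (\<lambda>q q'. index_mat A (q, q')) (\<lambda>q. \<Sum>g<H. x g * F q g) (\<lambda>q. \<Sum>g<H. y g * F q g)"
proof -
  let ?a = "\<lambda>q q'. index_mat A (q, q')"
  have "bilin H (\<lambda>g h. index_mat (transpose_mat (Fmat Q H F) * A * Fmat Q H F) (g, h)) x y =
     (\<Sum>g<H. \<Sum>h<H. \<Sum>q<Q. \<Sum>q'<Q. x g * (F q g * ?a q q' * F q' h) * y h)"
    unfolding bilin_def
    by (intro sum.cong refl) (simp add: sandwich_entry[OF A] sum_distrib_left sum_distrib_right)
  also have "\<dots> = (\<Sum>q<Q. \<Sum>q'<Q. \<Sum>g<H. \<Sum>h<H. x g * (F q g * ?a q q' * F q' h) * y h)"
  proof -
    have rot: "(\<Sum>h<H. \<Sum>q<Q. \<Sum>q'<Q. f h q q') = (\<Sum>q<Q. \<Sum>q'<Q. \<Sum>h<H. f h q q')" for f :: "nat \<Rightarrow> nat \<Rightarrow> nat \<Rightarrow> real"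
      by (subst sum.swap, intro sum.cong refl sum.swap)
    show ?thesis unfolding rot ..
  qed
  also have "\<dots> = bilin Q ?a (\<lambda>q. \<Sum>g<H. x g * F q g) (\<lambda>q. \<Sum>g<H. y g * F q g)"
    unfolding bilin_def
  proof (intro sum.cong refl)
    fix q q'
    have "(\<Sum>g<H. \<Sum>h<H. x g * (F q g * ?a q q' * F q' h) * y h) = (\<Sum>g<H. \<Sum>h<H. (x g * F q g * ?a q q') * (y h * F q' h))"
      by (simp only: mult_ac)
    also have "\<dots> = (\<Sum>g<H. x g * F q g * ?a q q') * (\<Sum>h<H. y h * F q' h)"
      by (rule sum_product[symmetric])
    finally show "(\<Sum>g<H. \<Sum>h<H. x g * (F q g * ?a q q' * F q' h) * y h) =
        (\<Sum>g<H. x g * F q g) * ?a q q' * (\<Sum>g<H. y g * F q' g)"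
      by (simp only: sum_distrib_right)
  qed
  finally show ?thesis .
qed

text \<open>The matrix B^T B inverts V on both sides, so V is a unit and the result
  \<open>None\<close> is excluded; uniqueness of inverses identifies the result.\<close>

lemma inverse_from_orthonormal:
  fixes V :: "real mat"
  assumes V: "V \<in> carrier_mat n n"
    and B: "\<And>h k. h < n \<Longrightarrow> k < n \<Longrightarrow> bilin n (\<lambda>k l. index_mat V (k, l)) (B h) (B k) = of_bool (h = k)"
  shows "the (mat_inverse V) = mat n n (\<lambda>(k, l). \<Sum>h<n. B h k * B h l)" (is "_ = ?X")
proof -
  have X: "?X \<in> carrier_mat n n" by simp
  have XV: "?X * V = 1\<^sub>m n"
  proof (rule eq_matI)
    fix k l assume "k < dim_row (1\<^sub>m n)" "l < dim_col (1\<^sub>m n)"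
    then have kl: "k < n" "l < n" by auto
    have "index_mat (?X * V) (k, l) = (\<Sum>m<n. (\<Sum>h<n. B h k * B h m) * index_mat V (m, l))"
      using kl V by (simp add: scalar_prod_def lessThan_atLeast0)
    also have "\<dots> = (\<Sum>h<n. \<Sum>m<n. B h k * B h m * index_mat V (m, l))"
      unfolding sum_distrib_right by (rule sum.swap)
    also have "\<dots> = of_bool (k = l)" by (rule bilin_orthonormal_expansion[OF B kl])
    finally show "index_mat (?X * V) (k, l) = index_mat (1\<^sub>m n) (k, l)" using kl by simp
  qed (use V in auto)
  have VX: "V * ?X = 1\<^sub>m n" by (rule mat_mult_left_right_inverse[OF X V XV])
  show ?thesis
  proof (cases "mat_inverse V")
    case None
    have "V \<in> Units (ring_mat TYPE(real) n ())"
      unfolding Units_def ring_mat_simps using V X XV VX by auto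
    then show ?thesis using mat_inverse(1)[OF V None, where b = "()"] by blast
  next
    case (Some W)
    then have W: "W * V = 1\<^sub>m n" "W \<in> carrier_mat n n" using mat_inverse(2)[OF V] by auto
    have "W = W * (V * ?X)" using W VX by simp
    also have "\<dots> = (W * V) * ?X" by (rule assoc_mult_mat[symmetric, OF W(2) V X])
    also have "\<dots> = ?X" unfolding W(1) by (rule left_mult_one_mat[OF X])
    finally show ?thesis using Some by simp
  qed
qed

locale randomized_design =
  fixes N Q H :: nat and Nq :: "nat \<Rightarrow> nat" and Y F :: "nat \<Rightarrow> nat \<Rightarrow> real"
  assumes H: "H \<ge> 1" and N2: "N \<ge> 2"
    and sizes: "\<And>q. q < Q \<Longrightarrow> Nq q \<ge> 1" and total: "(\<Sum>q<Q. Nq q) = N"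
begin

definition dev :: "nat \<Rightarrow> nat \<Rightarrow> real" where "dev i q = Y i q - Ybar N Y q"

lemma sum_dev: "(\<Sum>i<N. dev i q) = 0"
  using N2 by (simp add: dev_def sum_subtractf Ybar_def)

lemma Scov_dev: "Scov N Y q q' = (\<Sum>i<N. dev i q * dev i q') / (real N - 1)"
  by (simp add: Scov_def dev_def)

lemma Vgamma_carrier: "Vgamma N Q H Nq Y F \<in> carrier_mat H H"
  by (rule carrier_matI) (simp_all add: Vgamma_def Fmat_def VYhat_def)

abbreviation Vg :: "nat \<Rightarrow> nat \<Rightarrow> real" where
  "Vg \<equiv> \<lambda>g h. index_mat (Vgamma N Q H Nq Y F) (g, h)"

lemma bilin_Vg:
  "bilin H Vg x y = bilin Q (\<lambda>q q'. (if q = q' then Scov N Y q q / real (Nq q) else 0) - Scov N Y q q' / real N)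
     (\<lambda>q. \<Sum>g<H. x g * F q g) (\<lambda>q. \<Sum>g<H. y g * F q g)"
proof -
  have "bilin H Vg x y = bilin Q (\<lambda>q q'. index_mat (VYhat N Q Nq Y) (q, q')) (\<lambda>q. \<Sum>g<H. x g * F q g) (\<lambda>q. \<Sum>g<H. y g * F q g)"
    unfolding Vgamma_def by (rule sandwich_bilin) (simp add: VYhat_def)
  also have "\<dots> = bilin Q (\<lambda>q q'. (if q = q' then Scov N Y q q / real (Nq q) else 0) - Scov N Y q q' / real N)
     (\<lambda>q. \<Sum>g<H. x g * F q g) (\<lambda>q. \<Sum>g<H. y g * F q g)"
    unfolding bilin_def by (intro sum.cong refl) (simp add: VYhat_def)
  finally show ?thesis .
qed

lemma Vg_sym: "g < H \<Longrightarrow> h < H \<Longrightarrow> Vg g h = Vg h g"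
proof -
  assume gh: "g < H" "h < H"
  have c: "VYhat N Q Nq Y \<in> carrier_mat Q Q" by (simp add: VYhat_def)
  have s: "Scov N Y q q' = Scov N Y q' q" for q q' by (simp add: Scov_def mult.commute)
  show ?thesis unfolding Vgamma_def sandwich_entry[OF c gh] sandwich_entry[OF c gh(2,1)]
    by (subst sum.swap) (intro sum.cong refl, auto simp: VYhat_def s)
qed

lemma bilin_Dmat:
  "bilin H (\<lambda>g h. index_mat (transpose_mat (Fmat Q H F) * Dmat N Q Nq Y * Fmat Q H F) (g, h)) x x =
    (\<Sum>q<Q. Scov N Y q q / real (Nq q) * (\<Sum>g<H. x g * F q g)\<^sup>2)"
proof -
  let ?u = "\<lambda>q. \<Sum>g<H. x g * F q g"
  have "bilin H (\<lambda>g h. index_mat (transpose_mat (Fmat Q H F) * Dmat N Q Nq Y * Fmat Q H F) (g, h)) x x =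
     bilin Q (\<lambda>q q'. index_mat (Dmat N Q Nq Y) (q, q')) ?u ?u"
    by (rule sandwich_bilin) (simp add: Dmat_def)
  also have "\<dots> = (\<Sum>q<Q. \<Sum>q'<Q. if q' = q then Scov N Y q q / real (Nq q) * (?u q)\<^sup>2 else 0)"
    unfolding bilin_def by (intro sum.cong refl) (auto simp: Dmat_def power2_eq_square)
  finally show ?thesis by simp
qed

text \<open>The entries of B F^T, that is, the contrast coefficients after whitening.\<close>

definition load :: "(nat \<Rightarrow> nat \<Rightarrow> real) \<Rightarrow> nat \<Rightarrow> nat \<Rightarrow> real" where
  "load B h q = (\<Sum>g<H. B h g * F q g)"

text \<open>The contribution of unit i when it receives the level that the reference labelling l
  gives to slot k. Its sums over k do not vanish, and they create the part - S / N of the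
  covariance.\<close>

definition arr :: "(nat \<Rightarrow> nat \<Rightarrow> real) \<Rightarrow> (nat \<Rightarrow> nat) \<Rightarrow> nat \<Rightarrow> nat \<Rightarrow> nat \<Rightarrow> real" where
  "arr B l i k h = load B h (l k) * dev i (l k) / real (Nq (l k))"

context
  fixes B :: "nat \<Rightarrow> nat \<Rightarrow> real"
  assumes B: "\<And>h k. h < H \<Longrightarrow> k < H \<Longrightarrow> bilin H Vg (B h) (B k) = of_bool (h = k)"
begin

text \<open>Since the inverse covariance is B^T B, the statistic is the squared norm of B applied to
  the estimation error. That error is a sum over units, as each group mean is a mean of
  deviations.\<close>

lemma Tstat_eq:
  assumes z: "z \<in> assignments N Q Nq"
  shows "Tstat N Q H Nq Y F z = (\<Sum>h<H. (\<Sum>i<N. load B h (z i) * dev i (z i) / real (Nq (z i)))\<^sup>2)"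
proof -
  have zQ: "\<And>i. i < N \<Longrightarrow> z i < Q" "\<And>q. q < Q \<Longrightarrow> card {i. i < N \<and> z i = q} = Nq q"
    using z by (auto simp: assignments_def)
  have diff: "Yhat N Nq Y z q - Ybar N Y q = (\<Sum>i\<in>{i. i < N \<and> z i = q}. dev i q / real (Nq q))" if q: "q < Q" for q
  proof -
    have "(\<Sum>i\<in>{i. i < N \<and> z i = q}. dev i q / real (Nq q)) = (\<Sum>i\<in>{i. i < N \<and> z i = q}. Y i q) / real (Nq q) - real (Nq q) * Ybar N Y q / real (Nq q)"
      using zQ(2)[OF q] by (simp add: dev_def sum_divide_distrib[symmetric] sum_subtractf diff_divide_distrib)
    then show ?thesis using sizes[OF q] by (simp add: Yhat_def)
  qed
  define dv where "dv = gammahat_vec N Q H Nq Y F z - gamma_vec N Q H Y F"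
  have dvc: "dv \<in> carrier_vec H" by (simp add: dv_def gammahat_vec_def gamma_vec_def)
  have dvi: "vec_index dv g = (\<Sum>q<Q. F q g * (Yhat N Nq Y z q - Ybar N Y q))" if "g < H" for g
    using that by (simp add: dv_def gammahat_vec_def gamma_vec_def right_diff_distrib sum_subtractf)
  have W: "(\<Sum>g<H. B h g * vec_index dv g) = (\<Sum>i<N. load B h (z i) * dev i (z i) / real (Nq (z i)))" for h
  proof -
    have "(\<Sum>g<H. B h g * vec_index dv g) = (\<Sum>g<H. \<Sum>q<Q. (B h g * F q g) * (Yhat N Nq Y z q - Ybar N Y q))"
      by (intro sum.cong refl) (simp add: dvi sum_distrib_left mult.assoc)
    also have "\<dots> = (\<Sum>q<Q. load B h q * (Yhat N Nq Y z q - Ybar N Y q))"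
      unfolding load_def sum_distrib_right by (rule sum.swap)
    also have "\<dots> = (\<Sum>q<Q. \<Sum>i\<in>{i. i < N \<and> z i = q}. load B h q * dev i q / real (Nq q))"
      by (intro sum.cong refl) (simp add: diff sum_distrib_left)
    also have "\<dots> = (\<Sum>i<N. load B h (z i) * dev i (z i) / real (Nq (z i)))"
      using sum_by_label[of N z Q "\<lambda>i q. load B h q * dev i q / real (Nq q)"] zQ(1) by simp
    finally show ?thesis .
  qed
  let ?X = "mat H H (\<lambda>(k, l). \<Sum>h<H. B h k * B h l)"
  have inv: "the (mat_inverse (Vgamma N Q H Nq Y F)) = ?X"
    by (rule inverse_from_orthonormal[OF Vgamma_carrier B])
  have "Tstat N Q H Nq Y F z = scalar_prod dv (?X *\<^sub>v dv)"
    by (simp only: Tstat_def Let_def dv_def inv)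
  also have "\<dots> = (\<Sum>k<H. \<Sum>l<H. vec_index dv k * index_mat ?X (k, l) * vec_index dv l)"
    by (rule scalar_prod_mult_vec) (use dvc in auto)
  also have "\<dots> = (\<Sum>k<H. \<Sum>l<H. \<Sum>h<H. (B h k * vec_index dv k) * (B h l * vec_index dv l))"
    by (intro sum.cong refl) (simp add: sum_distrib_left sum_distrib_right mult_ac)
  also have "\<dots> = (\<Sum>h<H. \<Sum>k<H. \<Sum>l<H. (B h k * vec_index dv k) * (B h l * vec_index dv l))"
  proof -
    have "(\<Sum>k<H. \<Sum>l<H. \<Sum>h<H. f h k l) = (\<Sum>h<H. \<Sum>k<H. \<Sum>l<H. f h k l)" for f :: "nat \<Rightarrow> nat \<Rightarrow> nat \<Rightarrow> real"
      by (subst (2) sum.swap, subst sum.swap, rule refl)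
    then show ?thesis .
  qed
  also have "\<dots> = (\<Sum>h<H. (\<Sum>g<H. B h g * vec_index dv g)\<^sup>2)"
    by (simp add: power2_eq_square sum_product)
  finally show ?thesis unfolding W .
qed

lemma arr_column: "(\<Sum>i<N. arr B l i k h) = 0"
proof -
  have "(\<Sum>i<N. arr B l i k h) = load B h (l k) * (\<Sum>i<N. dev i (l k)) / real (Nq (l k))"
    by (simp add: arr_def sum_distrib_left sum_divide_distrib)
  then show ?thesis by (simp add: sum_dev)
qed

text \<open>In \<open>permutation_covariance\<close> the products within a row give the diagonal
  part S(q,q) / N_q, the products of row sums give S / N, and N - 1 cancels. The outcome is B V B^T,
  so the standardization is exact.\<close>

lemma arr_covariance:
  assumes l: "\<And>i. i < N \<Longrightarrow> l i < Q" "\<And>q. q < Q \<Longrightarrow> card {i. i < N \<and> l i = q} = Nq q"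
    and hk: "h < H" "k < H"
  shows "pavg N (\<lambda>\<pi>. (\<Sum>i<N. arr B l i (\<pi> i) h) * (\<Sum>i<N. arr B l i (\<pi> i) k)) = of_bool (h = k)"
proof -
  have n1: "real N - 1 > 0" using N2 by simp
  have Sc: "(\<Sum>i<N. dev i q * dev i q') = (real N - 1) * Scov N Y q q'" for q q'
    using n1 by (simp add: Scov_dev)
  have rowsum: "(\<Sum>m<N. arr B l i m h) = (\<Sum>q<Q. load B h q * dev i q)" for i h
  proof -
    have "(\<Sum>m<N. arr B l i m h) = (\<Sum>q<Q. real (Nq q) * (load B h q * dev i q / real (Nq q)))"
      unfolding arr_def using sum_label_weight[where g = "\<lambda>q. load B h q * dev i q / real (Nq q)", OF l] by simp
    also have "\<dots> = (\<Sum>q<Q. load B h q * dev i q)" using sizes by (intro sum.cong refl) force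
    finally show ?thesis .
  qed
  have rowprod: "(\<Sum>m<N. arr B l i m h * arr B l i m k) = (\<Sum>q<Q. load B h q * load B k q * (dev i q * dev i q) / real (Nq q))" for i
  proof -
    have "(\<Sum>m<N. arr B l i m h * arr B l i m k) = (\<Sum>q<Q. real (Nq q) * (load B h q * dev i q / real (Nq q) * (load B k q * dev i q / real (Nq q))))"
      unfolding arr_def using sum_label_weight[where g = "\<lambda>q. load B h q * dev i q / real (Nq q) * (load B k q * dev i q / real (Nq q))", OF l] by simp
    also have "\<dots> = (\<Sum>q<Q. load B h q * load B k q * (dev i q * dev i q) / real (Nq q))"
      using sizes by (intro sum.cong refl) force
    finally show ?thesis .
  qed
  have 1: "(\<Sum>i<N. \<Sum>m<N. arr B l i m h * arr B l i m k) = (real N - 1) * (\<Sum>q<Q. load B h q * load B k q * (Scov N Y q q / real (Nq q)))"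
  proof -
    have "(\<Sum>i<N. \<Sum>m<N. arr B l i m h * arr B l i m k) = (\<Sum>q<Q. \<Sum>i<N. load B h q * load B k q * (dev i q * dev i q) / real (Nq q))"
      unfolding rowprod by (rule sum.swap)
    also have "\<dots> = (\<Sum>q<Q. load B h q * load B k q * (\<Sum>i<N. dev i q * dev i q) / real (Nq q))"
      by (simp add: sum_distrib_left sum_divide_distrib)
    also have "\<dots> = (\<Sum>q<Q. (real N - 1) * (load B h q * load B k q * (Scov N Y q q / real (Nq q))))"
      by (intro sum.cong refl) (use n1 in \<open>simp add: Scov_dev\<close>)
    finally show ?thesis by (simp add: sum_distrib_left)
  qed
  have 2: "(\<Sum>i<N. (\<Sum>m<N. arr B l i m h) * (\<Sum>m<N. arr B l i m k)) = (real N - 1) * (\<Sum>q<Q. \<Sum>q'<Q. load B h q * load B k q' * Scov N Y q q')"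
  proof -
    have "(\<Sum>i<N. (\<Sum>m<N. arr B l i m h) * (\<Sum>m<N. arr B l i m k)) = (\<Sum>i<N. \<Sum>q<Q. \<Sum>q'<Q. load B h q * load B k q' * (dev i q * dev i q'))"
      unfolding rowsum sum_product by (intro sum.cong refl) (simp only: mult_ac)
    also have "\<dots> = (\<Sum>q<Q. \<Sum>q'<Q. \<Sum>i<N. load B h q * load B k q' * (dev i q * dev i q'))"
      by (subst sum.swap, intro sum.cong refl sum.swap)
    also have "\<dots> = (\<Sum>q<Q. \<Sum>q'<Q. (real N - 1) * (load B h q * load B k q' * Scov N Y q q'))"
      by (intro sum.cong refl) (simp add: sum_distrib_left[symmetric] Sc)
    finally show ?thesis by (simp add: sum_distrib_left)
  qed
  have "pavg N (\<lambda>\<pi>. (\<Sum>i<N. arr B l i (\<pi> i) h) * (\<Sum>i<N. arr B l i (\<pi> i) k)) =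
     ((\<Sum>i<N. \<Sum>m<N. arr B l i m h * arr B l i m k) - (\<Sum>i<N. (\<Sum>m<N. arr B l i m h) * (\<Sum>m<N. arr B l i m k)) / real N) / (real N - 1)"
    by (rule permutation_covariance[OF N2 arr_column arr_column])
  also have "\<dots> = (\<Sum>q<Q. load B h q * load B k q * (Scov N Y q q / real (Nq q))) - (\<Sum>q<Q. \<Sum>q'<Q. load B h q * load B k q' * Scov N Y q q') / real N"
    unfolding 1 2 using n1 by (simp add: diff_divide_distrib)
  also have "\<dots> = (\<Sum>q<Q. \<Sum>q'<Q. load B h q * ((if q = q' then Scov N Y q q / real (Nq q) else 0) - Scov N Y q q' / real N) * load B k q')"
  proof -
    have "(\<Sum>q'<Q. load B h q * ((if q = q' then Scov N Y q q / real (Nq q) else 0) - Scov N Y q q' / real N) * load B k q')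
       = load B h q * load B k q * (Scov N Y q q / real (Nq q)) - (\<Sum>q'<Q. load B h q * load B k q' * Scov N Y q q') / real N" if "q < Q" for q
    proof -
      have "(\<Sum>q'<Q. load B h q * ((if q = q' then Scov N Y q q / real (Nq q) else 0) - Scov N Y q q' / real N) * load B k q')
        = (\<Sum>q'<Q. (if q' = q then load B h q * load B k q * (Scov N Y q q / real (Nq q)) else 0) - load B h q * load B k q' * Scov N Y q q' / real N)"
        by (intro sum.cong refl) (auto simp: algebra_simps)
      then show ?thesis using that by (simp add: sum_subtractf sum_divide_distrib)
    qed
    then show ?thesis by (simp add: sum_subtractf sum_divide_distrib)
  qed
  also have "\<dots> = bilin H Vg (B h) (B k)" unfolding bilin_Vg by (simp add: bilin_def load_def)
  finally show ?thesis using B[OF hk] by simp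
qed

lemma prob_T_bound:
  assumes bound: "\<And>i q. i < N \<Longrightarrow> q < Q \<Longrightarrow> L2_set (\<lambda>h. load B h q * dev i q / real (Nq q)) {..<H} \<le> \<delta>"
  shows "\<bar>prob_T_le N Q H Nq Y F t - chi2_cdf H t\<bar> \<le> 84000 * (real H)\<^sup>2 * (real N * \<delta> ^ 3)"
proof -
  obtain l where l: "\<And>i. i < N \<Longrightarrow> l i < Q" "\<And>q. q < Q \<Longrightarrow> card {i. i < N \<and> l i = q} = Nq q"
    using labelling_exists[where Q = Q and Nq = Nq] unfolding total by blast
  interpret perm_array N H "arr B l" \<delta>
  proof unfold_locales
    show "L2_set (arr B l i k) {..<H} \<le> \<delta>" if "i < N" "k < N" for i k
      unfolding arr_def using bound[OF that(1) l(1)[OF that(2)]] .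
  qed (use N2 H arr_column arr_covariance[OF l] in auto)
  let ?A = "assignments N Q Nq"
  have finA: "finite ?A" by (rule finite_subset[of _ "{..<N} \<rightarrow>\<^sub>E {..<Q}"]) (auto simp: assignments_def intro: finite_PiE)
  have "prob_T_le N Q H Nq Y F t = (\<Sum>z\<in>?A. of_bool (Tstat N Q H Nq Y F z \<le> t)) / real (card ?A)"
    unfolding prob_T_le_def using finA by (simp add: sum_of_bool_eq Int_def)
  also have "\<dots> = pavg N (\<lambda>\<pi>. of_bool (Tstat N Q H Nq Y F (relabel N l \<pi>) \<le> t))"
    by (rule assignments_average[OF l])
  also have "\<dots> = prob t"
    unfolding prob_def
  proof (rule pavg_cong)
    fix \<pi> assume p: "\<pi> \<in> perms N"
    have "relabel N l \<pi> \<in> assignments N Q Nq" by (rule relabel_in_assignments[OF l p])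
    from Tstat_eq[OF this] have "Tstat N Q H Nq Y F (relabel N l \<pi>) = T \<pi>"
      by (simp add: T_def W_def arr_def relabel_def)
    then show "of_bool (Tstat N Q H Nq Y F (relabel N l \<pi>) \<le> t) = (of_bool (T \<pi> \<le> t) :: real)" by simp
  qed
  finally show ?thesis using chi2_approximation[of t] by simp
qed

end

end

section \<open>Eigenvalue margin from the design conditions\<close>

lemma scalar_prod_form:
  assumes "A \<in> carrier_mat n n"
  shows "scalar_prod (vec n x) (A *\<^sub>v vec n x) = bilin n (\<lambda>k l. index_mat A (k, l)) x x"
proof -
  have "scalar_prod (vec n x) (A *\<^sub>v vec n x) =
      (\<Sum>i<n. \<Sum>j<n. vec_index (vec n x) i * index_mat A (i, j) * vec_index (vec n x) j)"
    by (rule scalar_prod_mult_vec) (use assms in auto)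
  then show ?thesis by (simp add: bilin_def)
qed

lemma gram_entry:
  "g < H \<Longrightarrow> h < H \<Longrightarrow> index_mat (transpose_mat (Fmat Q H F) * Fmat Q H F) (g, h) = (\<Sum>q<Q. F q g * F q h)"
  by (simp add: Fmat_def scalar_prod_def lessThan_atLeast0)

lemma gram_form:
  "bilin H (\<lambda>g h. index_mat (transpose_mat (Fmat Q H F) * Fmat Q H F) (g, h)) x x = (\<Sum>q<Q. (\<Sum>g<H. x g * F q g)\<^sup>2)"
proof -
  have "bilin H (\<lambda>g h. index_mat (transpose_mat (Fmat Q H F) * Fmat Q H F) (g, h)) x x =
      (\<Sum>g<H. \<Sum>h<H. \<Sum>q<Q. (x g * F q g) * (x h * F q h))"
    unfolding bilin_def by (intro sum.cong refl) (simp add: gram_entry sum_distrib_left mult_ac)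
  also have "\<dots> = (\<Sum>q<Q. \<Sum>g<H. \<Sum>h<H. (x g * F q g) * (x h * F q h))"
    by (subst (2) sum.swap, subst sum.swap, rule refl)
  finally show ?thesis by (simp add: power2_eq_square sum_product)
qed

lemma rho_min_gram:
  assumes "H \<ge> 1"
  shows "rho_min (transpose_mat (Fmat Q H F) * Fmat Q H F) * (\<Sum>g<H. (x g)\<^sup>2) \<le> (\<Sum>q<Q. (\<Sum>g<H. x g * F q g)\<^sup>2)"
proof -
  have c: "transpose_mat (Fmat Q H F) * Fmat Q H F \<in> carrier_mat H H"
    by (rule carrier_matI) (simp_all add: Fmat_def)
  have "rho_min (transpose_mat (Fmat Q H F) * Fmat Q H F) * (\<Sum>g<H. (x g)\<^sup>2) \<le>
      bilin H (\<lambda>g h. index_mat (transpose_mat (Fmat Q H F) * Fmat Q H F) (g, h)) x x"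
    by (rule rho_min_le_form[OF c assms]) (simp add: gram_entry mult.commute)
  then show ?thesis by (simp only: gram_form)
qed

lemma load_square_le:
  fixes F :: "nat \<Rightarrow> nat \<Rightarrow> real"
  assumes F: "\<And>h. h < H \<Longrightarrow> \<bar>F q h\<bar> \<le> b"
  shows "(\<Sum>g<H. (F q g)\<^sup>2) \<le> real H * b\<^sup>2"
    and "(\<Sum>g<H. x g * F q g)\<^sup>2 \<le> (\<Sum>g<H. (x g)\<^sup>2) * (real H * b\<^sup>2)"
proof -
  have "(F q g)\<^sup>2 \<le> b\<^sup>2" if "g < H" for g
    using F[OF that] abs_le_square_iff[of "F q g" b] by simp
  then have "(\<Sum>g<H. (F q g)\<^sup>2) \<le> (\<Sum>g<H. b\<^sup>2)" by (intro sum_mono) auto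
  then show 1: "(\<Sum>g<H. (F q g)\<^sup>2) \<le> real H * b\<^sup>2" by simp
  have "(\<Sum>g<H. x g * F q g)\<^sup>2 \<le> (\<Sum>g<H. (x g)\<^sup>2) * (\<Sum>g<H. (F q g)\<^sup>2)"
    by (rule Cauchy_Schwarz_ineq_sum)
  also have "\<dots> \<le> (\<Sum>g<H. (x g)\<^sup>2) * (real H * b\<^sup>2)"
    by (intro mult_left_mono 1 sum_nonneg) auto
  finally show "(\<Sum>g<H. x g * F q g)\<^sup>2 \<le> (\<Sum>g<H. (x g)\<^sup>2) * (real H * b\<^sup>2)" .
qed

context randomized_design
begin

text \<open>A lower bound for the smallest eigenvalue of the covariance of the estimated contrasts:
  half of c' / Q, times the least variance Smin / nbar of a small group mean, over the loss
  \<sigma>F^2.\<close>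

definition margin :: "real \<Rightarrow> real \<Rightarrow> real \<Rightarrow> nat \<Rightarrow> real" where
  "margin c' \<sigma>F Smin nbar = c' * Smin / (2 * real nbar * \<sigma>F\<^sup>2 * real Q)"

context
  fixes c c' \<sigma>F Smin :: real and nbar :: nat and QS QL :: "nat set"
  assumes pos: "c > 0" "c' > 0" "\<sigma>F \<ge> 1" "Smin > 0" "nbar \<ge> 1" and Q: "Q \<ge> 1"
    and split: "QS \<union> QL = {..<Q}" "QS \<inter> QL = {}"
    and small: "\<And>q. q \<in> QS \<Longrightarrow> Nq q \<le> nbar" "\<And>q. q \<in> QS \<Longrightarrow> Smin \<le> Scov N Y q q"
    and S: "\<And>q. q < Q \<Longrightarrow> Scov N Y q q \<ge> 0"
    and cond1: "\<And>x. x \<in> carrier_vec H \<Longrightarrow>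
       scalar_prod x ((transpose_mat (Fmat Q H F) * Dmat N Q Nq Y * Fmat Q H F) *\<^sub>v x)
         \<le> \<sigma>F\<^sup>2 * scalar_prod x (Vgamma N Q H Nq Y F *\<^sub>v x)"
    and cond2: "\<And>q h. q < Q \<Longrightarrow> h < H \<Longrightarrow> \<bar>F q h\<bar> \<le> c / real Q"
      "rho_min (transpose_mat (Fmat Q H F) * Fmat Q H F) \<ge> c' / real Q"
    and few: "real Q \<ge> 2 * (c\<^sup>2 / c') * real H * real (card QL)"
begin

lemma margin_pos: "margin c' \<sigma>F Smin nbar > 0"
  using pos Q by (simp add: margin_def)

text \<open>By the entrywise bound on F, large groups carry at most c^2 H |QL| |x|^2 / Q^2 of |F
  x|^2, which \<open>few\<close> makes at most half of c' |x|^2 / Q. The small groups carry the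
  rest, with weights S(q,q) / N_q bounded below; \<open>cond1\<close> passes from the diagonal
  matrix to the full covariance.\<close>

lemma Vg_lower: "margin c' \<sigma>F Smin nbar * (\<Sum>g<H. (x g)\<^sup>2) \<le> bilin H Vg x x"
proof -
  define u where "u = (\<lambda>q. (\<Sum>g<H. x g * F q g)\<^sup>2)"
  define X where "X = (\<Sum>g<H. (x g)\<^sup>2)"
  have X: "0 \<le> X" by (simp add: X_def sum_nonneg)
  have Q0: "real Q > 0" using Q by simp
  have fin: "finite QS" "finite QL" using split(1) by (metis finite_Un finite_lessThan)+
  have "c' / real Q * X \<le> rho_min (transpose_mat (Fmat Q H F) * Fmat Q H F) * X"
    using cond2(2) X by (intro mult_right_mono)
  also have "\<dots> \<le> (\<Sum>q<Q. u q)" unfolding X_def u_def by (rule rho_min_gram[OF H])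
  also have "\<dots> = (\<Sum>q\<in>QS. u q) + (\<Sum>q\<in>QL. u q)"
    unfolding split(1)[symmetric] by (rule sum.union_disjoint[OF fin split(2)])
  finally have 1: "c' / real Q * X \<le> (\<Sum>q\<in>QS. u q) + (\<Sum>q\<in>QL. u q)" .
  have "(\<Sum>q\<in>QL. u q) \<le> (\<Sum>q\<in>QL. X * (real H * (c / real Q)\<^sup>2))"
    unfolding u_def X_def by (intro sum_mono load_square_le(2) cond2(1)) (use split(1) in auto)
  also have "\<dots> = (c\<^sup>2 * real H * real (card QL)) * (X / (real Q)\<^sup>2)" by (simp add: power_divide)
  also have "\<dots> \<le> (c' * real Q / 2) * (X / (real Q)\<^sup>2)"
  proof (rule mult_right_mono)
    have "2 * (c\<^sup>2 / c') * real H * real (card QL) * (c' / 2) \<le> real Q * (c' / 2)"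
      using few pos by (intro mult_right_mono) auto
    then show "c\<^sup>2 * real H * real (card QL) \<le> c' * real Q / 2" using pos by (simp add: mult_ac)
  qed (use X in simp)
  also have "\<dots> = c' / (2 * real Q) * X" using Q0 by (simp add: power2_eq_square)
  finally have 2: "c' / (2 * real Q) * X \<le> (\<Sum>q\<in>QS. u q)" using 1 by (simp add: field_simps)
  have "Smin / real nbar * (c' / (2 * real Q) * X) \<le> Smin / real nbar * (\<Sum>q\<in>QS. u q)"
    using 2 pos by (intro mult_left_mono) auto
  also have "\<dots> = (\<Sum>q\<in>QS. Smin / real nbar * u q)" by (rule sum_distrib_left)
  also have "\<dots> \<le> (\<Sum>q\<in>QS. Scov N Y q q / real (Nq q) * u q)"
  proof (rule sum_mono)
    fix q assume q: "q \<in> QS"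
    then have "q < Q" using split(1) by auto
    then have "Smin / real nbar \<le> Scov N Y q q / real (Nq q)"
      using small[OF q] pos sizes[of q] by (intro frac_le) auto
    then show "Smin / real nbar * u q \<le> Scov N Y q q / real (Nq q) * u q"
      by (rule mult_right_mono) (simp add: u_def)
  qed
  also have "\<dots> \<le> (\<Sum>q<Q. Scov N Y q q / real (Nq q) * u q)"
    using S split(1) by (intro sum_mono2) (auto simp: u_def)
  also have "\<dots> = bilin H (\<lambda>g h. index_mat (transpose_mat (Fmat Q H F) * Dmat N Q Nq Y * Fmat Q H F) (g, h)) x x"
    unfolding bilin_Dmat u_def ..
  also have "\<dots> \<le> \<sigma>F\<^sup>2 * bilin H Vg x x"
  proof -
    have "transpose_mat (Fmat Q H F) * Dmat N Q Nq Y * Fmat Q H F \<in> carrier_mat H H"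
      by (rule carrier_matI) (simp_all add: Fmat_def)
    from scalar_prod_form[OF this] show ?thesis
      using cond1[of "vec H x"] by (simp add: scalar_prod_form[OF Vgamma_carrier])
  qed
  finally have "Smin / real nbar * (c' / (2 * real Q) * X) / \<sigma>F\<^sup>2 \<le> bilin H Vg x x"
    using pos(3) by (subst pos_divide_le_eq) (simp_all add: mult.commute[of _ "\<sigma>F\<^sup>2"])
  then show ?thesis by (simp add: margin_def X_def mult_ac)
qed

text \<open>The margin bounds the whitened coefficients by \<open>bilin_whitening_le\<close>, and
  division by a group size of at least 1 does not increase them. The inequality on \<delta> is
  therefore what the uniform entry bound of the permutation array demands.\<close>

lemma design_bound:
  assumes M: "\<And>i q. i < N \<Longrightarrow> q < Q \<Longrightarrow> \<bar>dev i q\<bar> \<le> M" and \<delta>: "0 \<le> \<delta>" "real H * (c / real Q)\<^sup>2 * M\<^sup>2 \<le> margin c' \<sigma>F Smin nbar * \<delta>\<^sup>2"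
  shows "\<bar>prob_T_le N Q H Nq Y F t - chi2_cdf H t\<bar> \<le> 84000 * (real H)\<^sup>2 * (real N * \<delta> ^ 3)"
proof -
  have "0 < bilin H Vg x x" if x: "\<exists>k<H. x k \<noteq> 0" for x
  proof -
    have "0 < (\<Sum>g<H. (x g)\<^sup>2)" using x by (auto intro: sum_pos2)
    then have "0 < margin c' \<sigma>F Smin nbar * (\<Sum>g<H. (x g)\<^sup>2)" using margin_pos by simp
    then show ?thesis using Vg_lower[of x] by linarith
  qed
  then obtain B where B: "\<And>h k. h < H \<Longrightarrow> k < H \<Longrightarrow> bilin H Vg (B h) (B k) = of_bool (h = k)"
    using orthonormal_basis_exists[of H Vg] Vg_sym by blast
  show ?thesis
  proof (rule prob_T_bound[of B, OF B])
    fix i q assume iq: "i < N" "q < Q"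
    have n1: "1 \<le> real (Nq q)" using sizes[OF iq(2)] by simp
    have "margin c' \<sigma>F Smin nbar * (\<Sum>h<H. (\<Sum>g<H. B h g * F q g)\<^sup>2) \<le> (\<Sum>g<H. (F q g)\<^sup>2)"
      by (rule bilin_whitening_le[of H Vg B "margin c' \<sigma>F Smin nbar" "F q", OF B Vg_lower margin_pos])
    then have "margin c' \<sigma>F Smin nbar * (\<Sum>h<H. (load B h q)\<^sup>2) \<le> (\<Sum>g<H. (F q g)\<^sup>2)"
      by (simp only: load_def)
    also have "\<dots> \<le> real H * (c / real Q)\<^sup>2" by (rule load_square_le) (use cond2(1) iq in auto)
    finally have 1: "margin c' \<sigma>F Smin nbar * (\<Sum>h<H. (load B h q)\<^sup>2) \<le> real H * (c / real Q)\<^sup>2" .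
    define w where "w = dev i q / real (Nq q)"
    have "\<bar>w\<bar> \<le> \<bar>dev i q\<bar> / 1" unfolding w_def abs_divide using n1 by (intro frac_le) auto
    then have "\<bar>w\<bar> \<le> M" using M[OF iq] by simp
    then have w2: "w\<^sup>2 \<le> M\<^sup>2" using abs_le_square_iff[of w M] by simp
    have "margin c' \<sigma>F Smin nbar * (\<Sum>h<H. (load B h q * dev i q / real (Nq q))\<^sup>2) = margin c' \<sigma>F Smin nbar * (\<Sum>h<H. (load B h q)\<^sup>2) * w\<^sup>2"
      unfolding mult.assoc sum_distrib_right
      by (intro arg_cong[where f = "\<lambda>x. margin c' \<sigma>F Smin nbar * x"] sum.cong refl)
        (simp add: w_def power_mult_distrib power_divide)
    also have "\<dots> \<le> real H * (c / real Q)\<^sup>2 * M\<^sup>2"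
      by (intro mult_mono 1 w2) auto
    also have "\<dots> \<le> margin c' \<sigma>F Smin nbar * \<delta>\<^sup>2" by (rule \<delta>)
    finally have "(\<Sum>h<H. (load B h q * dev i q / real (Nq q))\<^sup>2) \<le> \<delta>\<^sup>2" using margin_pos by simp
    then show "L2_set (\<lambda>h. load B h q * dev i q / real (Nq q)) {..<H} \<le> \<delta>"
      unfolding L2_set_def using \<delta>(1) by (intro real_le_lsqrt) (auto simp: sum_nonneg)
  qed
qed

end

end

lemma powr_three_halves: "0 \<le> x \<Longrightarrow> sqrt x ^ 3 = x powr (3 / 2)"
  by (simp add: powr_half_sqrt[symmetric] powr_realpow'[symmetric] powr_powr)

theorem theorem8:
  fixes c c' c_lo \<sigma>F K :: real and nbar :: nat
  assumes "c > 0" and "c' > 0" and "c_lo > 0" and "\<sigma>F \<ge> 1" and "K > 0"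
  shows "\<exists>C > 0. \<forall>(c_hi::real) (N::nat) (Q::nat) (H::nat) (Nq::nat \<Rightarrow> nat)
      (Y::nat \<Rightarrow> nat \<Rightarrow> real) (F::nat \<Rightarrow> nat \<Rightarrow> real) (QS::nat set) (QL::nat set) (N0::nat).
    H \<ge> 1 \<and>
    (\<forall>q<Q. Nq q \<ge> 1) \<and> (\<Sum>q<Q. Nq q) = N \<and>
    \<comment> \<open>non-uniform design\<close>
    QS \<union> QL = {..<Q} \<and> QS \<inter> QL = {} \<and> N0 > 0 \<and> c_lo \<le> c_hi \<and>
    (\<forall>q\<in>QL. \<exists>cq::real. real (Nq q) = cq * real N0 \<and> c_lo \<le> cq \<and> cq \<le> c_hi) \<and>
    (\<forall>q\<in>QS. Nq q \<le> nbar) \<and>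
    \<comment> \<open>V_gammahat nonsingular\<close>
    invertible_mat (Vgamma N Q H Nq Y F) \<and>
    \<comment> \<open>Condition 1\<close>
    (\<forall>x \<in> carrier_vec H.
       scalar_prod x ((transpose_mat (Fmat Q H F) * Dmat N Q Nq Y * Fmat Q H F) *\<^sub>v x)
         \<le> \<sigma>F\<^sup>2 * scalar_prod x (Vgamma N Q H Nq Y F *\<^sub>v x)) \<and>
    \<comment> \<open>Condition 2\<close>
    (\<forall>q<Q. \<forall>h<H. \<bar>F q h\<bar> \<le> c / real Q) \<and>
    rho_min (transpose_mat (Fmat Q H F) * Fmat Q H F) \<ge> c' / real Q \<and>
    \<comment> \<open>further assumptions\<close>
    real Q \<ge> 2 * (c\<^sup>2 / c') * real H * real (card QL) \<and>
    real N \<le> K * real Q \<and>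
    (\<forall>q<Q. Scov N Y q q > 0)
    \<longrightarrow> (\<forall>t::real. \<bar>prob_T_le N Q H Nq Y F t - chi2_cdf H t\<bar>
          \<le> C * (Max {MN N Y q | q. q < Q}) ^ 3 / (Min {Scov N Y q q | q. q \<in> QS}) powr (3/2)
              * real H powr (19/4) / sqrt (real N))"
proof -
  \<comment> \<open>Chosen so that \<delta>^2 = C1 H M^2 / (Smin N) satisfies the requirement of
    \<open>design_bound\<close>, with 1 / Q replaced by K / N.\<close>
  define C1 where "C1 = 2 * real nbar * \<sigma>F\<^sup>2 * c\<^sup>2 * K / c'"
  have C1: "C1 \<ge> 0" using assms by (simp add: C1_def)
  \<comment> \<open>The added 1 keeps C positive in the degenerate case nbar = 0, where C1 =
    0.\<close>
  define C where "C = 84000 * sqrt C1 ^ 3 + 1"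
  have C: "C > 0" "84000 * sqrt C1 ^ 3 \<le> C" using C1 by (auto simp: C_def intro: add_nonneg_pos)
  show ?thesis
  proof (intro exI[of _ C] conjI allI impI C(1), elim conjE)
    fix c_hi :: real and N Q H :: nat and Nq :: "nat \<Rightarrow> nat" and Y F :: "nat \<Rightarrow> nat \<Rightarrow> real"
      and QS QL :: "nat set" and N0 :: nat and t :: real
    assume H: "1 \<le> H" and sizes: "\<forall>q<Q. Nq q \<ge> 1" and total: "(\<Sum>q<Q. Nq q) = N"
      and split: "QS \<union> QL = {..<Q}" "QS \<inter> QL = {}"
      and small: "\<forall>q\<in>QS. Nq q \<le> nbar"
      and inv: "invertible_mat (Vgamma N Q H Nq Y F)"
      and cond1: "\<forall>x \<in> carrier_vec H.
       scalar_prod x ((transpose_mat (Fmat Q H F) * Dmat N Q Nq Y * Fmat Q H F) *\<^sub>v x)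
         \<le> \<sigma>F\<^sup>2 * scalar_prod x (Vgamma N Q H Nq Y F *\<^sub>v x)"
      and Fb: "\<forall>q<Q. \<forall>h<H. \<bar>F q h\<bar> \<le> c / real Q"
      and rho: "c' / real Q \<le> rho_min (transpose_mat (Fmat Q H F) * Fmat Q H F)"
      and few: "2 * (c\<^sup>2 / c') * real H * real (card QL) \<le> real Q"
      and NK: "real N \<le> K * real Q" and S: "\<forall>q<Q. Scov N Y q q > 0"
    \<comment> \<open>Without levels the covariance would be the zero matrix of size H \<ge> 1,
      which is not invertible.\<close>
    have Q: "Q \<ge> 1"
    proof (rule ccontr)
      assume "\<not> Q \<ge> 1"
      then have Q0: "Q = 0" by simp
      let ?V = "Vgamma N Q H Nq Y F"
      have dims: "dim_row ?V = H" "dim_col ?V = H" by (simp_all add: Vgamma_def Fmat_def)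
      obtain B where B: "?V * B = 1\<^sub>m H" "B * ?V = 1\<^sub>m (dim_row B)"
        using inv unfolding invertible_mat_def inverts_mat_def dims by blast
      have "dim_col (B * ?V) = dim_row B" "dim_col (?V * B) = H" unfolding B by simp_all
      then have Bc: "B \<in> carrier_mat H H" using dims by (intro carrier_matI) simp_all
      have "?V = 0\<^sub>m H H"
      proof (rule eq_matI)
        fix g h assume gh: "g < dim_row (0\<^sub>m H H :: real mat)" "h < dim_col (0\<^sub>m H H :: real mat)"
        have "VYhat N Q Nq Y \<in> carrier_mat Q Q" by (simp add: VYhat_def)
        from sandwich_entry[OF this, of g H h F] show "index_mat ?V (g, h) = index_mat (0\<^sub>m H H) (g, h)"
          using gh by (simp add: Vgamma_def Q0)
      qed (simp_all add: dims)
      then have "1\<^sub>m H = (0\<^sub>m H H :: real mat)" using B(1) left_mult_zero_mat[OF Bc, of H] by simp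
      then have "index_mat (1\<^sub>m H :: real mat) (0, 0) = index_mat (0\<^sub>m H H) (0, 0)" by simp
      then show False using H by simp
    qed
    have NQ: "Q \<le> N"
    proof -
      have "(\<Sum>q<Q. 1) \<le> (\<Sum>q<Q. Nq q)" using sizes by (intro sum_mono) auto
      then show ?thesis by (simp add: total)
    qed
    \<comment> \<open>For N = 1 the covariance is 0 / 0 = 0, contradicting positive
      variances.\<close>
    have N2: "N \<ge> 2"
    proof (rule ccontr)
      assume "\<not> N \<ge> 2"
      then have "N = 1" using NQ Q by linarith
      then have "Scov N Y 0 0 = 0" by (simp add: Scov_def)
      then show False using S Q by force
    qed
    interpret randomized_design N Q H Nq Y F
      by unfold_locales (use H N2 sizes total in auto)
    have Q0: "real Q > 0" and N0: "real N > 0" and H1: "1 \<le> real H" using Q N2 H by auto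
    \<comment> \<open>The eigenvalue bound at the unit vector of column 0 against the entrywise
      bound on F. It forces small groups to exist, so that the minimum of their variances is taken
      over a nonempty set.\<close>
    have "c' \<le> c\<^sup>2"
    proof -
      have e: "(\<Sum>g<H. of_bool (g = 0) * F q g) = F q 0" for q
      proof -
        have "(\<Sum>g<H. of_bool (g = 0) * F q g) = (\<Sum>g<H. if g = 0 then F q g else 0)" by (intro sum.cong) auto
        then show ?thesis using H by simp
      qed
      have e2: "(\<Sum>g<H. (of_bool (g = 0) :: real)\<^sup>2) = 1"
      proof -
        have "(\<Sum>g<H. (of_bool (g = 0) :: real)\<^sup>2) = (\<Sum>g<H. if g = 0 then 1 else 0)" by (intro sum.cong) auto
        then show ?thesis using H by simp
      qed
      have "c' / real Q \<le> (\<Sum>q<Q. (F q 0)\<^sup>2)"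
        using rho rho_min_gram[OF H, of Q F "\<lambda>g. of_bool (g = 0)"] unfolding e e2 by simp
      also have "\<dots> \<le> (\<Sum>q<Q. (c / real Q)\<^sup>2)"
      proof (rule sum_mono)
        fix q assume "q \<in> {..<Q}"
        then have "q < Q" "0 < H" using H by simp_all
        then have "\<bar>F q 0\<bar> \<le> c / real Q" using Fb by blast
        then have "\<bar>F q 0\<bar> \<le> \<bar>c / real Q\<bar>" by linarith
        then show "(F q 0)\<^sup>2 \<le> (c / real Q)\<^sup>2" by (simp only: abs_le_square_iff)
      qed
      also have "\<dots> = c\<^sup>2 / real Q" using Q0 by (simp add: power2_eq_square)
      finally show ?thesis using Q0 by (simp add: divide_le_cancel)
    qed
    have QS: "QS \<noteq> {}"
    proof
      assume "QS = {}"
      \<comment> \<open>If every level were large, \<open>few\<close> would read Q \<ge> 2 Q at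
        least.\<close>
      then have "real (card QL) = real Q" using split by simp
      moreover have "1 \<le> c\<^sup>2 / c'" using \<open>c' \<le> c\<^sup>2\<close> assms by simp
      then have "2 * 1 * 1 * real Q \<le> 2 * (c\<^sup>2 / c') * real H * real Q"
        using H1 by (intro mult_mono mult_nonneg_nonneg) auto
      ultimately show False using few Q0 by simp
    qed
    have QSQ: "QS \<subseteq> {..<Q}" and finS: "finite QS" using split(1) by (auto intro: finite_subset)
    define Smin where "Smin = Min {Scov N Y q q | q. q \<in> QS}"
    define M where "M = Max {MN N Y q | q. q < Q}"
    have Sset: "{Scov N Y q q | q. q \<in> QS} = (\<lambda>q. Scov N Y q q) ` QS" by auto
    have Smin_pos: "Smin > 0"
      unfolding Smin_def Sset using finS QS S QSQ by (subst Min_gr_iff) auto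
    have Smin_le: "Smin \<le> Scov N Y q q" if "q \<in> QS" for q
      unfolding Smin_def Sset using finS that by (intro Min_le) auto
    have nbar: "nbar \<ge> 1"
    proof -
      obtain q where "q \<in> QS" using QS by blast
      then show ?thesis using small sizes QSQ by (metis lessThan_iff order_trans subsetD)
    qed
    have Mdev: "\<bar>dev i q\<bar> \<le> M" if "i < N" "q < Q" for i q
    proof -
      have "\<bar>dev i q\<bar> \<le> MN N Y q"
        unfolding MN_def dev_def by (intro Max_ge) (use that in \<open>auto simp: setcompr_eq_image\<close>)
      also have "\<dots> \<le> M"
        unfolding M_def by (intro Max_ge) (use that in \<open>auto simp: setcompr_eq_image\<close>)
      finally show ?thesis .
    qed
    have M0: "M \<ge> 0" using Mdev[of 0 0] N2 Q by force
    define R where "R = M / sqrt Smin"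
    define \<delta> where "\<delta> = sqrt C1 * sqrt (real H) * R / sqrt (real N)"
    have R0: "R \<ge> 0" using M0 Smin_pos by (simp add: R_def)
    have \<delta>0: "\<delta> \<ge> 0" using R0 C1 by (simp add: \<delta>_def)
    have \<delta>2: "\<delta>\<^sup>2 = C1 * real H * M\<^sup>2 / (Smin * real N)"
      using C1 Smin_pos by (simp add: \<delta>_def R_def power_mult_distrib power_divide)
    have bd: "\<bar>prob_T_le N Q H Nq Y F t - chi2_cdf H t\<bar> \<le> 84000 * (real H)\<^sup>2 * (real N * \<delta> ^ 3)"
    proof (rule design_bound[where c = c and c' = c' and \<sigma>F = \<sigma>F and Smin = Smin and nbar = nbar and QS = QS and QL = QL and M = M])
      have "real H * (c / real Q)\<^sup>2 * M\<^sup>2 = (real H * c\<^sup>2 * M\<^sup>2 / real Q) * (1 / real Q)"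
        by (simp add: power_divide power2_eq_square)
      \<comment> \<open>One factor 1 / Q is kept to match the margin, the other is exchanged for K /
        N.\<close>
      also have "\<dots> \<le> (real H * c\<^sup>2 * M\<^sup>2 / real Q) * (K / real N)"
        using NK Q0 N0 by (intro mult_left_mono) (auto simp: field_simps)
      also have "\<dots> = c' * Smin / (2 * real nbar * \<sigma>F\<^sup>2 * real Q) * \<delta>\<^sup>2"
        unfolding \<delta>2 C1_def using assms nbar Smin_pos Q0 N0 by (simp add: field_simps)
      finally show "real H * (c / real Q)\<^sup>2 * M\<^sup>2 \<le> margin c' \<sigma>F Smin nbar * \<delta>\<^sup>2"
        by (simp add: margin_def)
    qed (use assms Smin_pos nbar Q split small Smin_le S cond1 Fb rho few Mdev \<delta>0 in \<open>auto intro: less_imp_le\<close>)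
    have d3: "\<delta> ^ 3 = sqrt C1 ^ 3 * real H powr (3 / 2) * R ^ 3 / (real N * sqrt (real N))"
    proof -
      have "sqrt (real N) ^ 3 = real N * sqrt (real N)" using N0 by (simp add: power3_eq_cube)
      moreover have "sqrt (real H) ^ 3 = real H powr (3 / 2)" by (rule powr_three_halves) simp
      ultimately show ?thesis by (simp only: \<delta>_def power_mult_distrib power_divide)
    qed
    have "84000 * (real H)\<^sup>2 * (real N * \<delta> ^ 3) = (84000 * sqrt C1 ^ 3) * R ^ 3 * ((real H)\<^sup>2 * real H powr (3 / 2)) / sqrt (real N)"
    proof -
      have "real N * \<delta> ^ 3 = sqrt C1 ^ 3 * real H powr (3 / 2) * R ^ 3 / sqrt (real N)"
        unfolding d3 using N0 by simp
      then show ?thesis by (simp only: times_divide_eq_right mult_ac)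
    qed
    also have "(real H)\<^sup>2 * real H powr (3 / 2) = real H powr (7 / 2)"
    proof -
      have "(real H)\<^sup>2 = real H powr 2" using H1 by (simp add: powr_numeral)
      then show ?thesis by (simp only: powr_add[symmetric]) simp
    qed
    \<comment> \<open>The power H^(7/2) combines H^2 from the chi-square bound with H^(3/2) from
      \<delta>^3; by H \<ge> 1 it is at most H^(19/4).\<close>
    also have "(84000 * sqrt C1 ^ 3) * R ^ 3 * real H powr (7 / 2) / sqrt (real N) \<le> C * R ^ 3 * real H powr (19 / 4) / sqrt (real N)"
      using C C1 R0 H1 by (intro divide_right_mono mult_mono powr_mono) auto
    also have "C * R ^ 3 = C * M ^ 3 / Smin powr (3 / 2)"
      using Smin_pos by (simp add: R_def power_divide powr_three_halves)
    finally show "\<bar>prob_T_le N Q H Nq Y F t - chi2_cdf H t\<bar>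
          \<le> C * (Max {MN N Y q | q. q < Q}) ^ 3 / (Min {Scov N Y q q | q. q \<in> QS}) powr (3/2)
              * real H powr (19/4) / sqrt (real N)"
      using bd unfolding M_def Smin_def by linarith
  qed
qed

end
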